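(* Let $J\neq F_n^\infty$ be a WOT-closed two-sided ideal of $F_n^\infty$ and $T:=[T_1,\ldots,T_n]$, $T_i\in B(\mathcal H)$, be a pure $J$-constrained row contraction. Then the constrained characteristic function $\Theta_{J,T}\in\mathcal W(W_1,\ldots,W_n)\bar\otimes B(\mathcal D_{T^*},\mathcal D_T)$ is a partial isometry and $T$ is unitarily equivalent to the row contraction $$\left[P_{\mathbb H_{J,T}}(B_1\otimes I_{\mathcal D_T})|_{\mathbb H_{J,T}},\ldots,P_{\mathbb H_{J,T}}(B_n\otimes I_{\mathcal D_T})|_{\mathbb H_{J,T}}\right],$$ where $P_{\mathbb H_{J,T}}$ is the orthogonal projection of $\mathcal N_J\otimes\mathcal D_T$ onto the Hilbert space $$\mathbb H_{J,T}:=(\mathcal N_J\otimes\mathcal D_T)\ominus\Theta_{J,T}(\mathcal N_J\otimes\mathcal D_{T^*}).$$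
   Context: Let $n\in\{1,2,\dots\}$ and let $F^2(H_n)=\bigoplus_{k\ge 0}H_n^{\otimes k}$ be the full Fock space of an $n$-dimensional complex Hilbert space $H_n$ with orthonormal basis $e_1,\dots,e_n$ (with $H_n^{\otimes 0}=\mathbb C1$). Left and right creation operators: $S_i\varphi=e_i\otimes\varphi$, $R_i\varphi=\varphi\otimes e_i$. $F_n^\infty\subset B(F^2(H_n))$ is the WOT-closed algebra generated by $S_1,\dots,S_n$ and the identity. Put $\mathcal N_J=F^2(H_n)\ominus\overline{JF^2(H_n)}$, $B_i=P_{\mathcal N_J}S_i|_{\mathcal N_J}$, $W_i=P_{\mathcal N_J}R_i|_{\mathcal N_J}$. $\mathcal W(W_1,\dots,W_n)$ is the $w^*$-closed algebra generated by $W_1,\dots,W_n$ and $I$; $\mathcal W(W_1,\dots,W_n)\bar\otimes B(\mathcal K,\mathcal K')$ is the WOT-closed operator space generated by the spatial tensor product. $\mathbb F_n^+$ is the unital free semigroup on $g_1,\dots,g_n$; $|\alpha|$ is the length of $\alpha$; $T_\alpha=T_{i_1}\cdots T_{i_k}$, $e_\alpha=e_{i_1}\otimes\cdots\otimes e_{i_k}$ for $\alpha=g_{i_1}\cdots g_{i_k}$. $T$ is a row contraction if $TT^*=\sum_iT_iT_i^*\le I$ ($T$ viewed as an operator $\mathcal H^{(n)}\to\mathcal H$); it is pure if $\text{SOT-}\lim_k\sum_{|\alpha|=k}T_\alpha T_\alpha^*=0$. A pure $T$ is $J$-constrained if $f(T_1,\dots,T_n)=0$ for all $f\in J$, where for $f\in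 F_n^\infty$ with $f(1)=\sum_\alpha a_\alpha e_\alpha$, $f(T_1,\dots,T_n)=\text{SOT-}\lim_{r\to1}\sum_{k\ge0}\sum_{|\alpha|=k}r^{|\alpha|}a_\alpha T_\alpha$. Set $\Delta_T=(I-TT^* )^{1/2}$, $\Delta_{T^*}=(I-T^*T)^{1/2}\in B(\mathcal H^{(n)})$, $\mathcal D_T=\overline{\Delta_T\mathcal H}$, $\mathcal D_{T^*}=\overline{\Delta_{T^*}\mathcal H^{(n)}}$. Two $n$-tuples $[T_i]$, $[T_i']$ are unitarily equivalent if $T_i=U^*T_i'U$, $i=1,\dots,n$, for some unitary $U$. The constrained characteristic function $\Theta_{J,T}:\mathcal N_J\otimes\mathcal D_{T^*}\to\mathcal N_J\otimes\mathcal D_T$ is the bounded operator with formal Fourier representation $$-I_{\mathcal N_J}\otimes T+(I_{\mathcal N_J}\otimes\Delta_T)\Big(I-\sum_{i=1}^nW_i\otimes T_i^*\Big)^{-1}[W_1\otimes I_{\mathcal H},\dots,W_n\otimes I_{\mathcal H}](I_{\mathcal N_J}\otimes\Delta_{T^*}),$$ understood as the SOT-limit as $r\to1$, $r<1$, of the expressions with each $W_i$ replaced by $rW_i$. Equivalently it is the compression $P_{\mathcal N_J\otimes\mathcal D_T}\Theta_T|_{\mathcal N_J\otimes\mathcal D_{T^*}}$, where $\Theta_T$ on $F^2(H_n)\otimes\mathcal D_{T^*}$ is given by the same formula with $R_i$ in place of $W_i$. *)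

theory Defs
  imports "HOL-Analysis.Analysis"
begin

section \<open>Complex Hilbert spaces\<close>

text \<open>The inner product is linear in the first argument.\<close>

class complex_hilbert = banach +
  fixes scaleC :: "complex \<Rightarrow> 'a \<Rightarrow> 'a" (infixr \<open>*\<^sub>C\<close> 75)
    and cinner :: "'a \<Rightarrow> 'a \<Rightarrow> complex"
  assumes scaleC_add_right: "c *\<^sub>C (x + y) = c *\<^sub>C x + c *\<^sub>C y"
    and scaleC_add_left: "(c + d) *\<^sub>C x = c *\<^sub>C x + d *\<^sub>C x"
    and scaleC_scaleC: "c *\<^sub>C d *\<^sub>C x = (c * d) *\<^sub>C x"
    and scaleC_of_real: "complex_of_real r *\<^sub>C x = r *\<^sub>R x"
    and cinner_commute: "cinner x y = cnj (cinner y x)"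
    and cinner_add_left: "cinner (x + y) z = cinner x z + cinner y z"
    and cinner_scaleC_left: "cinner (c *\<^sub>C x) y = c * cinner x y"
    and cinner_same: "cinner x x = complex_of_real ((norm x)\<^sup>2)"

lemma scaleC_one: "1 *\<^sub>C x = (x :: 'a::complex_hilbert)"
  using scaleC_of_real[of 1 x] by simp

global_interpretation complex_vector: vector_space "scaleC :: complex \<Rightarrow> 'a \<Rightarrow> 'a::complex_hilbert"
  by unfold_locales (simp_all add: scaleC_add_right scaleC_add_left scaleC_scaleC scaleC_one)

lemma cinner_add_right: "cinner z (x + y) = cinner z x + cinner z (y :: 'a::complex_hilbert)"
  by (metis cinner_add_left cinner_commute complex_cnj_add)

lemma cinner_scaleC_right: "cinner x (c *\<^sub>C y) = cnj c * cinner x (y :: 'a::complex_hilbert)"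
  by (metis cinner_scaleC_left cinner_commute complex_cnj_mult)

lemma norm_scaleC: "norm (c *\<^sub>C x) = cmod c * norm (x :: 'a::complex_hilbert)"
proof -
  have "complex_of_real ((norm (c *\<^sub>C x))\<^sup>2) = c * (cnj c * complex_of_real ((norm x)\<^sup>2))"
    by (simp only: cinner_same[symmetric] cinner_scaleC_left cinner_scaleC_right mult.left_commute)
  also have "\<dots> = complex_of_real ((cmod c * norm x)\<^sup>2)"
    by (simp add: power_mult_distrib complex_norm_square del: of_real_power)
  finally have "(norm (c *\<^sub>C x))\<^sup>2 = (cmod c * norm x)\<^sup>2"
    by (simp only: of_real_eq_iff)
  then show ?thesis
    by simp
qed

lemma norm_cinner_le: "cmod (cinner x y) \<le> norm x * norm (y :: 'a::complex_hilbert)"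
proof (cases "y = 0")
  case True
  have "cinner x (0 *\<^sub>C y) = 0" by (simp only: cinner_scaleC_right) simp
  then show ?thesis using True by simp
next
  case False
  define a where "a = cinner x y"
  define n where "n = complex_of_real ((norm y)\<^sup>2)"
  have n: "n \<noteq> 0" "cnj n = n" using False by (simp_all add: n_def)
  define c where "c = - (a / n)"
  define z where "z = x + c *\<^sub>C y"
  have "cinner z y = a + c * n"
    by (simp only: z_def cinner_add_left cinner_scaleC_left cinner_same a_def n_def)
  then have "cinner z y = 0"
    using n by (simp add: c_def)
  then have "cinner z z = cinner z x"
    by (subst (2) z_def) (simp add: cinner_add_right cinner_scaleC_right)
  also have "\<dots> = complex_of_real ((norm x)\<^sup>2) + c * cnj a"
    by (simp add: z_def cinner_add_left cinner_scaleC_left cinner_same a_def cinner_commute[of y x])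
  also have "\<dots> = complex_of_real ((norm x)\<^sup>2 - (cmod a)\<^sup>2 / (norm y)\<^sup>2)"
    by (simp add: c_def n_def complex_norm_square flip: of_real_power)
  finally have "(norm z)\<^sup>2 = (norm x)\<^sup>2 - (cmod a)\<^sup>2 / (norm y)\<^sup>2"
    by (simp only: cinner_same of_real_eq_iff)
  then have "(cmod a)\<^sup>2 / (norm y)\<^sup>2 \<le> (norm x)\<^sup>2"
    by (metis diff_ge_0_iff_ge zero_le_power2)
  then have "(cmod a)\<^sup>2 \<le> (norm x * norm y)\<^sup>2"
    using False by (simp add: field_simps)
  then show ?thesis
    by (simp add: a_def power2_le_iff_abs_le)
qed

instantiation complex :: complex_hilbert
begin
definition scaleC_complex :: "complex \<Rightarrow> complex \<Rightarrow> complex" where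
  "scaleC_complex = (*)"
definition cinner_complex :: "complex \<Rightarrow> complex \<Rightarrow> complex" where
  "cinner_complex x y = x * cnj y"
instance
proof
  fix x y z c d :: complex and r :: real
  show "cinner x x = complex_of_real ((norm x)\<^sup>2)"
    unfolding cinner_complex_def by (rule complex_norm_square[symmetric])
qed (simp_all add: scaleC_complex_def cinner_complex_def algebra_simps scaleR_conv_of_real)
end

text \<open>The Hilbert space direct sum of finitely many copies of one space.\<close>

instantiation vec :: (complex_hilbert, finite) complex_hilbert
begin
definition scaleC_vec :: "complex \<Rightarrow> 'a ^ 'b \<Rightarrow> 'a ^ 'b" where
  "scaleC_vec c x = (\<chi> i. c *\<^sub>C (x $ i))"
definition cinner_vec :: "'a ^ 'b \<Rightarrow> 'a ^ 'b \<Rightarrow> complex" where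
  "cinner_vec x y = (\<Sum>i\<in>UNIV. cinner (x $ i) (y $ i))"
instance
proof
  fix x y z :: "'a ^ 'b" and c d :: complex and r :: real
  show "c *\<^sub>C (x + y) = c *\<^sub>C x + c *\<^sub>C y"
    by (simp add: vec_eq_iff scaleC_vec_def scaleC_add_right)
  show "(c + d) *\<^sub>C x = c *\<^sub>C x + d *\<^sub>C x"
    by (simp add: vec_eq_iff scaleC_vec_def scaleC_add_left)
  show "c *\<^sub>C d *\<^sub>C x = (c * d) *\<^sub>C x"
    by (simp add: vec_eq_iff scaleC_vec_def scaleC_scaleC)
  show "complex_of_real r *\<^sub>C x = r *\<^sub>R x"
    by (simp add: vec_eq_iff scaleC_vec_def scaleC_of_real)
  show "cinner x y = cnj (cinner y x)"
    by (simp add: cinner_vec_def cinner_commute[symmetric])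
  show "cinner (x + y) z = cinner x z + cinner y z"
    by (simp add: cinner_vec_def cinner_add_left sum.distrib)
  show "cinner (c *\<^sub>C x) y = c * cinner x y"
    by (simp add: cinner_vec_def scaleC_vec_def cinner_scaleC_left sum_distrib_left)
  show "cinner x x = complex_of_real ((norm x)\<^sup>2)"
    by (simp add: cinner_vec_def cinner_same norm_vec_def L2_set_def sum_nonneg)
qed
end


section \<open>Square-summable families\<close>

typedef (overloaded) ('i, 'a) ell2 =
  "{f :: 'i \<Rightarrow> 'a::complex_hilbert. (\<lambda>i. (norm (f i))\<^sup>2) summable_on UNIV}"
  morphisms ell2_nth Abs_ell2
  by (rule exI[of _ "\<lambda>_. 0"]) simp

setup_lifting type_definition_ell2

lemma L2_set_sq: "(L2_set f F)\<^sup>2 = (\<Sum>i\<in>F. (f i)\<^sup>2)"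
  by (simp add: L2_set_def sum_nonneg)

lemma ell2_bound:
  fixes f :: "'i \<Rightarrow> 'a::complex_hilbert"
  assumes "\<And>F. finite F \<Longrightarrow> L2_set (\<lambda>i. norm (f i)) F \<le> C"
  shows "(\<lambda>i. (norm (f i))\<^sup>2) summable_on UNIV"
    and "sqrt (infsum (\<lambda>i. (norm (f i))\<^sup>2) UNIV) \<le> C"
proof -
  have C: "0 \<le> C" using assms[of "{}"] by simp
  have b: "(\<Sum>i\<in>F. (norm (f i))\<^sup>2) \<le> C\<^sup>2" if "finite F" for F
    using power_mono[OF assms[OF that], of 2] by (simp add: L2_set_sq)
  show s: "(\<lambda>i. (norm (f i))\<^sup>2) summable_on UNIV"
    by (rule nonneg_bdd_above_summable_on) (auto intro!: bdd_aboveI2[of _ _ "C\<^sup>2"] b)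
  have "infsum (\<lambda>i. (norm (f i))\<^sup>2) UNIV \<le> C\<^sup>2"
    by (rule infsum_le_finite_sums[OF s]) (auto intro: b)
  then show "sqrt (infsum (\<lambda>i. (norm (f i))\<^sup>2) UNIV) \<le> C"
    using C by (rule_tac real_le_lsqrt) auto
qed

lemma L2_set_le_ell2:
  fixes f :: "'i \<Rightarrow> 'a::complex_hilbert"
  assumes "(\<lambda>i. (norm (f i))\<^sup>2) summable_on UNIV" "finite F"
  shows "L2_set (\<lambda>i. norm (f i)) F \<le> sqrt (infsum (\<lambda>i. (norm (f i))\<^sup>2) UNIV)"
  unfolding L2_set_def by (intro real_sqrt_le_mono finite_sum_le_infsum assms) auto

lemma ell2_add_bound:
  fixes f g :: "'i \<Rightarrow> 'a::complex_hilbert"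
  assumes "(\<lambda>i. (norm (f i))\<^sup>2) summable_on UNIV" "(\<lambda>i. (norm (g i))\<^sup>2) summable_on UNIV" "finite F"
  shows "L2_set (\<lambda>i. norm (f i + g i)) F \<le>
    sqrt (infsum (\<lambda>i. (norm (f i))\<^sup>2) UNIV) + sqrt (infsum (\<lambda>i. (norm (g i))\<^sup>2) UNIV)"
proof -
  have "L2_set (\<lambda>i. norm (f i + g i)) F \<le> L2_set (\<lambda>i. norm (f i) + norm (g i)) F"
    by (intro L2_set_mono norm_triangle_ineq norm_ge_zero)
  also have "\<dots> \<le> L2_set (\<lambda>i. norm (f i)) F + L2_set (\<lambda>i. norm (g i)) F"
    by (rule L2_set_triangle_ineq)
  finally show ?thesis
    using L2_set_le_ell2[OF assms(1,3)] L2_set_le_ell2[OF assms(2,3)] by linarith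
qed

lemma ell2_scaleC_bound:
  fixes f :: "'i \<Rightarrow> 'a::complex_hilbert"
  assumes "(\<lambda>i. (norm (f i))\<^sup>2) summable_on UNIV"
  shows "(\<lambda>i. (norm (c *\<^sub>C f i))\<^sup>2) summable_on UNIV"
  using summable_on_cmult_right[OF assms, of "(cmod c)\<^sup>2"] by (simp add: norm_scaleC power_mult_distrib)

lemma ell2_cinner_summable:
  fixes f g :: "'i \<Rightarrow> 'a::complex_hilbert"
  assumes "(\<lambda>i. (norm (f i))\<^sup>2) summable_on UNIV" "(\<lambda>i. (norm (g i))\<^sup>2) summable_on UNIV"
  shows "(\<lambda>i. cinner (f i) (g i)) summable_on UNIV"
proof (rule Infinite_Sum.abs_summable_summable, rule Infinite_Sum.abs_summable_on_comparison_test')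
  show "(\<lambda>i. (norm (f i))\<^sup>2 + (norm (g i))\<^sup>2) summable_on UNIV"
    by (rule summable_on_add[OF assms])
  fix i
  have "norm (f i) * norm (g i) \<le> (norm (f i))\<^sup>2 + (norm (g i))\<^sup>2"
    using sum_squares_bound[of "norm (f i)" "norm (g i)"]
      mult_nonneg_nonneg[OF norm_ge_zero norm_ge_zero, of "f i" "g i"] by linarith
  then show "cmod (cinner (f i) (g i)) \<le> (norm (f i))\<^sup>2 + (norm (g i))\<^sup>2"
    using norm_cinner_le[of "f i" "g i"] by linarith
qed

instantiation ell2 :: (type, complex_hilbert) real_normed_vector
begin
lift_definition zero_ell2 :: "('a, 'b) ell2" is "\<lambda>_. 0" by simp
lift_definition plus_ell2 :: "('a, 'b) ell2 \<Rightarrow> ('a, 'b) ell2 \<Rightarrow> ('a, 'b) ell2" is "\<lambda>f g i. f i + g i"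
  by (rule ell2_bound(1), rule ell2_add_bound)
lift_definition uminus_ell2 :: "('a, 'b) ell2 \<Rightarrow> ('a, 'b) ell2" is "\<lambda>f i. - f i" by simp
lift_definition minus_ell2 :: "('a, 'b) ell2 \<Rightarrow> ('a, 'b) ell2 \<Rightarrow> ('a, 'b) ell2" is "\<lambda>f g i. f i - g i"
  subgoal for f g
    using ell2_bound(1)[OF ell2_add_bound[of f "\<lambda>i. - g i"]] by simp
  done
lift_definition scaleR_ell2 :: "real \<Rightarrow> ('a, 'b) ell2 \<Rightarrow> ('a, 'b) ell2" is "\<lambda>r f i. r *\<^sub>R f i"
  by (simp only: scaleC_of_real[symmetric] ell2_scaleC_bound)
lift_definition norm_ell2 :: "('a, 'b) ell2 \<Rightarrow> real"
  is "\<lambda>f. sqrt (infsum (\<lambda>i. (norm (f i))\<^sup>2) UNIV)" .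
definition sgn_ell2 :: "('a, 'b) ell2 \<Rightarrow> ('a, 'b) ell2" where
  "sgn_ell2 x = inverse (norm x) *\<^sub>R x"
definition dist_ell2 :: "('a, 'b) ell2 \<Rightarrow> ('a, 'b) ell2 \<Rightarrow> real" where
  "dist_ell2 x y = norm (x - y)"
definition uniformity_ell2 :: "(('a, 'b) ell2 \<times> ('a, 'b) ell2) filter" where
  "uniformity_ell2 = (INF e\<in>{0<..}. principal {(x, y). dist x y < e})"
definition open_ell2 :: "('a, 'b) ell2 set \<Rightarrow> bool" where
  "open_ell2 U = (\<forall>x\<in>U. eventually (\<lambda>(x', y). x' = x \<longrightarrow> y \<in> U) uniformity)"
instance
proof
  fix x y z :: "('a, 'b) ell2" and r s :: real
  show "x + y + z = x + (y + z)" by transfer (simp add: algebra_simps)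
  show "x + y = y + x" by transfer (simp add: algebra_simps)
  show "0 + x = x" by transfer simp
  show "- x + x = 0" by transfer simp
  show "x - y = x + - y" by transfer simp
  show "r *\<^sub>R (x + y) = r *\<^sub>R x + r *\<^sub>R y" by transfer (simp add: algebra_simps)
  show "(r + s) *\<^sub>R x = r *\<^sub>R x + s *\<^sub>R x" by transfer (simp add: algebra_simps)
  show "r *\<^sub>R s *\<^sub>R x = (r * s) *\<^sub>R x" by transfer simp
  show "1 *\<^sub>R x = x" by transfer simp
  show "dist x y = norm (x - y)" by (fact dist_ell2_def)
  show "sgn x = inverse (norm x) *\<^sub>R x" by (fact sgn_ell2_def)
  show "uniformity = (INF e\<in>{0<..}. principal {(x, y :: ('a, 'b) ell2). dist x y < e})"
    by (fact uniformity_ell2_def)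
  show "open U = (\<forall>x\<in>U. eventually (\<lambda>(x', y). x' = x \<longrightarrow> y \<in> U) uniformity)"
    for U :: "('a, 'b) ell2 set" by (fact open_ell2_def)
  show "norm x = 0 \<longleftrightarrow> x = 0"
  proof (transfer, safe)
    fix f :: "'a \<Rightarrow> 'b" assume s: "(\<lambda>i. (norm (f i))\<^sup>2) summable_on UNIV"
      and z: "sqrt (infsum (\<lambda>i. (norm (f i))\<^sup>2) UNIV) = 0"
    show "f = (\<lambda>_. 0)"
    proof
      fix i show "f i = 0" using L2_set_le_ell2[OF s, of "{i}"] z by (simp add: L2_set_def)
    qed
  qed simp
  show "norm (x + y) \<le> norm x + norm y"
    by transfer (rule ell2_bound(2), rule ell2_add_bound)
  show "norm (r *\<^sub>R x) = \<bar>r\<bar> * norm x"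
    by transfer (simp add: power_mult_distrib infsum_cmult_right' real_sqrt_mult)
qed
end

lemma norm_ell2_nth_le: "norm (ell2_nth x i) \<le> norm x"
  by transfer (use L2_set_le_ell2[of _ "{_}"] in \<open>force simp: L2_set_def\<close>)

instance ell2 :: (type, complex_hilbert) banach
proof
  fix X :: "nat \<Rightarrow> ('a, 'b) ell2" assume X: "Cauchy X"
  have "Cauchy (\<lambda>n. ell2_nth (X n) i)" for i
  proof (rule metric_CauchyI)
    fix e :: real assume "0 < e"
    then obtain M where M: "\<And>m n. m \<ge> M \<Longrightarrow> n \<ge> M \<Longrightarrow> dist (X m) (X n) < e"
      using metric_CauchyD[OF X] by blast
    have "dist (ell2_nth (X m) i) (ell2_nth (X n) i) \<le> dist (X m) (X n)" for m n
      using norm_ell2_nth_le[of "X m - X n" i] by (simp add: dist_norm minus_ell2.rep_eq)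
    with M show "\<exists>M. \<forall>m\<ge>M. \<forall>n\<ge>M. dist (ell2_nth (X m) i) (ell2_nth (X n) i) < e"
      by (meson le_less_trans)
  qed
  then have "\<exists>l. (\<lambda>n. ell2_nth (X n) i) \<longlonglongrightarrow> l" for i
    by (simp add: Cauchy_convergent_iff convergent_def)
  then obtain g where g: "\<And>i. (\<lambda>n. ell2_nth (X n) i) \<longlonglongrightarrow> g i" by metis
  have tail: "\<exists>M. \<forall>m\<ge>M. \<forall>F. finite F \<longrightarrow> L2_set (\<lambda>i. norm (ell2_nth (X m) i - g i)) F \<le> e"
    if "0 < e" for e
  proof -
    obtain M where M: "\<And>m n. m \<ge> M \<Longrightarrow> n \<ge> M \<Longrightarrow> dist (X m) (X n) < e"
      using metric_CauchyD[OF X \<open>0 < e\<close>] by blast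
    have "L2_set (\<lambda>i. norm (ell2_nth (X m) i - g i)) F \<le> e" if "m \<ge> M" "finite F" for m F
    proof (rule tendsto_upperbound)
      show "(\<lambda>n. L2_set (\<lambda>i. norm (ell2_nth (X m) i - ell2_nth (X n) i)) F)
          \<longlonglongrightarrow> L2_set (\<lambda>i. norm (ell2_nth (X m) i - g i)) F"
        unfolding L2_set_def by (intro tendsto_intros g)
      have "L2_set (\<lambda>i. norm (ell2_nth (X m) i - ell2_nth (X n) i)) F \<le> e" if "n \<ge> M" for n
      proof -
        have "L2_set (\<lambda>i. norm (ell2_nth (X m - X n) i)) F \<le> norm (X m - X n)"
          unfolding norm_ell2.rep_eq using ell2_nth \<open>finite F\<close> by (intro L2_set_le_ell2) auto
        then show ?thesis
          using M[OF \<open>m \<ge> M\<close> that] by (simp add: dist_norm minus_ell2.rep_eq)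
      qed
      then show "\<forall>\<^sub>F n in sequentially. L2_set (\<lambda>i. norm (ell2_nth (X m) i - ell2_nth (X n) i)) F \<le> e"
        by (auto simp: eventually_sequentially)
    qed simp
    then show ?thesis by blast
  qed
  obtain M where M: "\<And>F. finite F \<Longrightarrow> L2_set (\<lambda>i. norm (ell2_nth (X M) i - g i)) F \<le> 1"
    using tail[of 1] by auto
  have d: "(\<lambda>i. (norm (ell2_nth (X M) i - g i))\<^sup>2) summable_on UNIV"
    by (rule ell2_bound(1)[OF M])
  have "(\<lambda>i. (norm (ell2_nth (X M) i + - (ell2_nth (X M) i - g i)))\<^sup>2) summable_on UNIV"
    using ell2_nth[of "X M"] d by (intro ell2_bound(1)[OF ell2_add_bound]) (auto simp: norm_minus_commute)
  then obtain y where y: "ell2_nth y = g"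
    using Abs_ell2_inverse[of g] by auto
  have "X \<longlonglongrightarrow> y"
  proof (rule metric_LIMSEQ_I)
    fix e :: real assume "0 < e"
    then obtain M where M: "\<And>m F. m \<ge> M \<Longrightarrow> finite F \<Longrightarrow> L2_set (\<lambda>i. norm (ell2_nth (X m) i - g i)) F \<le> e/2"
      using tail[of "e/2"] by auto
    have "norm (X m - y) \<le> e/2" if "m \<ge> M" for m
      unfolding norm_ell2.rep_eq using M[OF that]
      by (intro ell2_bound(2)) (simp add: minus_ell2.rep_eq y)
    then show "\<exists>no. \<forall>n\<ge>no. dist (X n) y < e"
      using \<open>0 < e\<close> by (intro exI[of _ M]) (force simp: dist_norm)
  qed
  then show "convergent X" by (auto simp: convergent_def)
qed

instantiation ell2 :: (type, complex_hilbert) complex_hilbert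
begin
lift_definition scaleC_ell2 :: "complex \<Rightarrow> ('a, 'b) ell2 \<Rightarrow> ('a, 'b) ell2" is "\<lambda>c f i. c *\<^sub>C f i"
  by (rule ell2_scaleC_bound)
lift_definition cinner_ell2 :: "('a, 'b) ell2 \<Rightarrow> ('a, 'b) ell2 \<Rightarrow> complex"
  is "\<lambda>f g. infsum (\<lambda>i. cinner (f i) (g i)) UNIV" .
instance
proof
  fix x y z :: "('a, 'b) ell2" and c d :: complex and r :: real
  show "c *\<^sub>C (x + y) = c *\<^sub>C x + c *\<^sub>C y" by transfer (simp add: scaleC_add_right)
  show "(c + d) *\<^sub>C x = c *\<^sub>C x + d *\<^sub>C x" by transfer (simp add: scaleC_add_left)
  show "c *\<^sub>C d *\<^sub>C x = (c * d) *\<^sub>C x" by transfer (simp add: scaleC_scaleC)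
  show "complex_of_real r *\<^sub>C x = r *\<^sub>R x" by transfer (simp add: scaleC_of_real)
  show "cinner x y = cnj (cinner y x)"
    by transfer (simp add: cinner_commute[symmetric] flip: infsum_cnj)
  show "cinner (x + y) z = cinner x z + cinner y z"
    by transfer (simp add: cinner_add_left infsum_add ell2_cinner_summable)
  show "cinner (c *\<^sub>C x) y = c * cinner x y"
    by transfer (simp add: cinner_scaleC_left infsum_cmult_right')
  show "cinner x x = complex_of_real ((norm x)\<^sup>2)"
  proof transfer
    fix f :: "'a \<Rightarrow> 'b" assume s: "(\<lambda>i. (norm (f i))\<^sup>2) summable_on UNIV"
    have "((\<lambda>i. complex_of_real ((norm (f i))\<^sup>2)) has_sum
        complex_of_real (infsum (\<lambda>i. (norm (f i))\<^sup>2) UNIV)) UNIV"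
      by (rule has_sum_of_real[OF has_sum_infsum[OF s]])
    then show "infsum (\<lambda>i. cinner (f i) (f i)) UNIV =
        complex_of_real ((sqrt (infsum (\<lambda>i. (norm (f i))\<^sup>2) UNIV))\<^sup>2)"
      by (simp only: cinner_same infsumI real_sqrt_pow2 infsum_nonneg zero_le_power2)
  qed
qed
end


section \<open>Bounded operators\<close>

definition bounded_clinear :: "('a::complex_hilbert \<Rightarrow> 'b::complex_hilbert) \<Rightarrow> bool" where
  "bounded_clinear A \<longleftrightarrow> bounded_linear A \<and> (\<forall>c x. A (c *\<^sub>C x) = c *\<^sub>C A x)"

definition cadjoint :: "('a::complex_hilbert \<Rightarrow> 'b::complex_hilbert) \<Rightarrow> 'b \<Rightarrow> 'a" where
  "cadjoint A = (THE B. bounded_clinear B \<and> (\<forall>x y. cinner (A x) y = cinner x (B y)))"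

definition positive_op :: "('a::complex_hilbert \<Rightarrow> 'a) \<Rightarrow> bool" where
  "positive_op A \<longleftrightarrow> bounded_clinear A \<and> (\<forall>x. cinner (A x) x \<in> \<real>\<^sub>\<ge>\<^sub>0)"

definition sqrt_op :: "('a::complex_hilbert \<Rightarrow> 'a) \<Rightarrow> 'a \<Rightarrow> 'a" where
  "sqrt_op A = (THE B. positive_op B \<and> B \<circ> B = A)"

definition ortho_diff :: "'a::complex_hilbert set \<Rightarrow> 'a set \<Rightarrow> 'a set" (infixl \<open>\<ominus>\<close> 65) where
  "M \<ominus> N = {x \<in> M. \<forall>y\<in>N. cinner x y = 0}"

definition Proj :: "'a::complex_hilbert set \<Rightarrow> 'a \<Rightarrow> 'a" where
  "Proj M x = (THE y. y \<in> M \<and> (\<forall>z\<in>M. cinner (x - y) z = 0))"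

text \<open>For closed subspaces \<open>M\<close> and \<open>N\<close>, an operator from \<open>M\<close> to \<open>N\<close> is represented by
  its extension by zero on the orthogonal complement of \<open>M\<close>. Under this identification
  \<open>Proj M\<close> is the identity of \<open>M\<close>, products, linear combinations and adjoints
  are the usual ones, and the SOT, the WOT and the weak-* topology of the operators from \<open>M\<close> to
  \<open>N\<close> are the subspace topologies of those defined below.\<close>

definition ops :: "'a::complex_hilbert set \<Rightarrow> 'b::complex_hilbert set \<Rightarrow> ('a \<Rightarrow> 'b) set" where
  "ops M N = {A. bounded_clinear A \<and> range A \<subseteq> N \<and> A \<circ> Proj M = A}"

definition partial_isometry ::
    "'a::complex_hilbert set \<Rightarrow> 'b::complex_hilbert set \<Rightarrow> ('a \<Rightarrow> 'b) \<Rightarrow> bool" where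
  "partial_isometry M N A \<longleftrightarrow>
     A \<in> ops M N \<and> (\<forall>x \<in> M \<ominus> {y \<in> M. A y = 0}. norm (A x) = norm x)"

definition SOT :: "('a::complex_hilbert \<Rightarrow> 'b::complex_hilbert) topology" where
  "SOT = pullback_topology (Collect bounded_clinear) (\<lambda>A. A) euclidean"

definition WOT :: "('a::complex_hilbert \<Rightarrow> 'b::complex_hilbert) topology" where
  "WOT = pullback_topology (Collect bounded_clinear) (\<lambda>A (x, y). cinner (A x) y) euclidean"

text \<open>The weak-* topology is induced by the normal functionals
  \<open>A \<mapsto> (\<Sum>k. cinner (A (x k)) (y k))\<close> with square-summable sequences \<open>x\<close> and \<open>y\<close>.\<close>

definition weak_star :: "('a::complex_hilbert \<Rightarrow> 'b::complex_hilbert) topology" where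
  "weak_star = pullback_topology (Collect bounded_clinear)
     (\<lambda>A (x :: (nat, 'a) ell2, y :: (nat, 'b) ell2). \<Sum>k. cinner (A (ell2_nth x k)) (ell2_nth y k))
     euclidean"

definition op_subspace :: "('a::complex_hilbert \<Rightarrow> 'b::complex_hilbert) set \<Rightarrow> bool" where
  "op_subspace V \<longleftrightarrow> V \<subseteq> Collect bounded_clinear \<and> (\<lambda>_. 0) \<in> V \<and>
     (\<forall>A\<in>V. \<forall>B\<in>V. (\<lambda>x. A x + B x) \<in> V) \<and> (\<forall>c. \<forall>A\<in>V. (\<lambda>x. c *\<^sub>C A x) \<in> V)"

definition op_algebra :: "('a::complex_hilbert \<Rightarrow> 'a) set \<Rightarrow> bool" where
  "op_algebra V \<longleftrightarrow> op_subspace V \<and> (\<forall>A\<in>V. \<forall>B\<in>V. A \<circ> B \<in> V)"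

definition generated_algebra ::
    "('a::complex_hilbert \<Rightarrow> 'a) topology \<Rightarrow> ('a \<Rightarrow> 'a) set \<Rightarrow> ('a \<Rightarrow> 'a) set" where
  "generated_algebra \<tau> G = \<Inter>{V. op_algebra V \<and> closedin \<tau> V \<and> G \<subseteq> V}"

definition WOT_closed_span ::
    "('a::complex_hilbert \<Rightarrow> 'b::complex_hilbert) set \<Rightarrow> ('a \<Rightarrow> 'b) set" where
  "WOT_closed_span G = \<Inter>{V. op_subspace V \<and> closedin WOT V \<and> G \<subseteq> V}"


section \<open>Tensor products\<close>

text \<open>The Hilbert space tensor product of \<open>('i, complex) ell2\<close> and \<open>'a\<close> is realised as
  \<open>('i, 'a) ell2\<close>.\<close>

lift_definition tensor :: "('i, complex) ell2 \<Rightarrow> 'a::complex_hilbert \<Rightarrow> ('i, 'a) ell2" (infixr \<open>\<otimes>\<close> 70)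
  is "\<lambda>f h i. f i *\<^sub>C h"
  using summable_on_cmult_left by (fastforce simp: norm_scaleC power_mult_distrib)

definition tensor_space ::
    "('i, complex) ell2 set \<Rightarrow> 'a::complex_hilbert set \<Rightarrow> ('i, 'a) ell2 set" (infixr \<open>\<otimes>\<^sub>S\<close> 70) where
  "M \<otimes>\<^sub>S D = closure (complex_vector.span {\<phi> \<otimes> h | \<phi> h. \<phi> \<in> M \<and> h \<in> D})"

definition tensor_op ::
    "(('i, complex) ell2 \<Rightarrow> ('j, complex) ell2) \<Rightarrow> ('a::complex_hilbert \<Rightarrow> 'b::complex_hilbert)
      \<Rightarrow> ('i, 'a) ell2 \<Rightarrow> ('j, 'b) ell2" (infixr \<open>\<otimes>\<^sub>O\<close> 70) where
  "A \<otimes>\<^sub>O B = (THE C. bounded_clinear C \<and> (\<forall>\<phi> h. C (\<phi> \<otimes> h) = A \<phi> \<otimes> B h))"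

text \<open>The WOT-closed operator space generated by the spatial (norm-closed) tensor product, which is
  the one generated by the elementary tensors.\<close>

definition spatial_tensor ::
    "(('i, complex) ell2 \<Rightarrow> ('j, complex) ell2) set \<Rightarrow> ('a::complex_hilbert \<Rightarrow> 'b::complex_hilbert) set
      \<Rightarrow> (('i, 'a) ell2 \<Rightarrow> ('j, 'b) ell2) set" (infixr \<open>\<otimes>\<^sub>W\<close> 70) where
  "V \<otimes>\<^sub>W X = WOT_closed_span {A \<otimes>\<^sub>O B | A B. A \<in> V \<and> B \<in> X}"


section \<open>The full Fock space\<close>

text \<open>Words over the alphabet \<open>'n\<close> form the free semigroup on \<open>n = CARD('n)\<close> generators. The
  full Fock space is realised through its orthonormal basis \<open>e\<^sub>\<alpha> = ket \<alpha>\<close>, the words of length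
  \<open>k\<close> spanning the \<open>k\<close>-fold tensor power; \<open>ket []\<close> is the vacuum vector \<open>1\<close>.\<close>

type_synonym 'n fock = "('n list, complex) ell2"

lift_definition ket :: "'i \<Rightarrow> ('i, complex) ell2" is "\<lambda>j i. if i = j then 1 else 0"
  subgoal for j
    by (rule finite_nonzero_values_imp_summable_on) simp
  done

lemma ell2_shift:
  fixes f :: "'i \<Rightarrow> complex" and h :: "'i \<Rightarrow> 'i"
  assumes "(\<lambda>i. (norm (f i))\<^sup>2) summable_on UNIV" "inj h"
    and "\<And>w. g (h w) = f w" "\<And>w. w \<notin> range h \<Longrightarrow> g w = 0"
  shows "(\<lambda>i. (norm (g i))\<^sup>2) summable_on UNIV"
proof -
  have "(\<lambda>i. (norm (g i))\<^sup>2) summable_on range h"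
    using assms(1,3) by (simp add: summable_on_reindex[OF assms(2)] comp_def)
  then show ?thesis
    by (rule summable_on_cong_neutral[THEN iffD1, rotated -1]) (auto simp: assms(4))
qed

lift_definition left_creation :: "'n \<Rightarrow> 'n fock \<Rightarrow> 'n fock"
  is "\<lambda>i f w. if w \<noteq> [] \<and> hd w = i then f (tl w) else 0"
  subgoal for i f
    by (rule ell2_shift[of f "(#) i"]) (auto simp: image_iff neq_Nil_conv)
  done

lift_definition right_creation :: "'n \<Rightarrow> 'n fock \<Rightarrow> 'n fock"
  is "\<lambda>i f w. if w \<noteq> [] \<and> last w = i then f (butlast w) else 0"
  subgoal for i f
    by (rule ell2_shift[of f "\<lambda>w. w @ [i]"]) (auto simp: inj_def image_iff, metis append_butlast_last_id)
  done

lemma left_creation_ket: "left_creation i (ket \<alpha>) = ket (i # \<alpha>)"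
  by transfer (auto simp: fun_eq_iff neq_Nil_conv)

lemma right_creation_ket: "right_creation i (ket \<alpha>) = ket (\<alpha> @ [i])"
  by transfer (auto simp: fun_eq_iff)

definition F_infinity :: "('n fock \<Rightarrow> 'n fock) set" where
  "F_infinity = generated_algebra WOT (insert (\<lambda>\<phi>. \<phi>) (range left_creation))"

definition WOT_closed_ideal :: "('n fock \<Rightarrow> 'n fock) set \<Rightarrow> bool" where
  "WOT_closed_ideal J \<longleftrightarrow> op_subspace J \<and> J \<subseteq> F_infinity \<and> closedin WOT J \<and>
     (\<forall>f\<in>J. \<forall>g\<in>F_infinity. f \<circ> g \<in> J \<and> g \<circ> f \<in> J)"

definition N_space :: "('n fock \<Rightarrow> 'n fock) set \<Rightarrow> 'n fock set" where
  "N_space J = UNIV \<ominus> closure (complex_vector.span {f \<phi> | f \<phi>. f \<in> J})"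

definition B_op :: "('n fock \<Rightarrow> 'n fock) set \<Rightarrow> 'n \<Rightarrow> 'n fock \<Rightarrow> 'n fock" where
  "B_op J i = Proj (N_space J) \<circ> left_creation i \<circ> Proj (N_space J)"

definition W_op :: "('n fock \<Rightarrow> 'n fock) set \<Rightarrow> 'n \<Rightarrow> 'n fock \<Rightarrow> 'n fock" where
  "W_op J i = Proj (N_space J) \<circ> right_creation i \<circ> Proj (N_space J)"

definition W_algebra :: "('n fock \<Rightarrow> 'n fock) set \<Rightarrow> ('n fock \<Rightarrow> 'n fock) set" where
  "W_algebra J = generated_algebra weak_star (insert (Proj (N_space J)) (range (W_op J)))"


section \<open>Row contractions\<close>

definition row_op :: "('n::finite \<Rightarrow> 'h \<Rightarrow> 'h) \<Rightarrow> 'h ^ 'n \<Rightarrow> 'h::complex_hilbert" where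
  "row_op T v = (\<Sum>i\<in>UNIV. T i (v $ i))"

definition row_contraction :: "('n::finite \<Rightarrow> 'h \<Rightarrow> 'h::complex_hilbert) \<Rightarrow> bool" where
  "row_contraction T \<longleftrightarrow> (\<forall>i. bounded_clinear (T i)) \<and>
     positive_op (\<lambda>x. x - (\<Sum>i\<in>UNIV. T i (cadjoint (T i) x)))"

definition word_op :: "('n \<Rightarrow> 'h \<Rightarrow> 'h) \<Rightarrow> 'n list \<Rightarrow> 'h \<Rightarrow> 'h" where
  "word_op T \<alpha> = foldr (\<lambda>i A. T i \<circ> A) \<alpha> (\<lambda>x. x)"

definition pure_row :: "('n::finite \<Rightarrow> 'h \<Rightarrow> 'h::complex_hilbert) \<Rightarrow> bool" where
  "pure_row T \<longleftrightarrow> limitin SOT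
     (\<lambda>k x. \<Sum>\<alpha> | length \<alpha> = k. word_op T \<alpha> (cadjoint (word_op T \<alpha>) x)) (\<lambda>_. 0) sequentially"

text \<open>\<open>functional_calculus f T A\<close> says that \<open>f(T) = A\<close>; the Fourier coefficients of \<open>f\<close> are the
  coordinates of \<open>f(1) = f (ket [])\<close>.\<close>

definition functional_calculus ::
    "('n::finite fock \<Rightarrow> 'n fock) \<Rightarrow> ('n \<Rightarrow> 'h \<Rightarrow> 'h) \<Rightarrow> ('h \<Rightarrow> 'h::complex_hilbert) \<Rightarrow> bool" where
  "functional_calculus f T A \<longleftrightarrow> limitin SOT
     (\<lambda>r x. \<Sum>k. \<Sum>\<alpha> | length \<alpha> = k.
        (complex_of_real (r ^ length \<alpha>) * ell2_nth (f (ket [])) \<alpha>) *\<^sub>C word_op T \<alpha> x) A (at_left 1)"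

definition constrained ::
    "('n::finite fock \<Rightarrow> 'n fock) set \<Rightarrow> ('n \<Rightarrow> 'h \<Rightarrow> 'h::complex_hilbert) \<Rightarrow> bool" where
  "constrained J T \<longleftrightarrow> (\<forall>f\<in>J. functional_calculus f T (\<lambda>_. 0))"

definition defect_op :: "('n::finite \<Rightarrow> 'h \<Rightarrow> 'h) \<Rightarrow> 'h \<Rightarrow> 'h::complex_hilbert" where
  "defect_op T = sqrt_op (\<lambda>x. x - row_op T (cadjoint (row_op T) x))"

definition defect_op_adj :: "('n::finite \<Rightarrow> 'h \<Rightarrow> 'h) \<Rightarrow> 'h ^ 'n \<Rightarrow> 'h::complex_hilbert ^ 'n" where
  "defect_op_adj T = sqrt_op (\<lambda>v. v - cadjoint (row_op T) (row_op T v))"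

definition defect_space :: "('n::finite \<Rightarrow> 'h \<Rightarrow> 'h) \<Rightarrow> 'h::complex_hilbert set" where
  "defect_space T = closure (range (defect_op T))"

definition defect_space_adj :: "('n::finite \<Rightarrow> 'h \<Rightarrow> 'h) \<Rightarrow> ('h::complex_hilbert ^ 'n) set" where
  "defect_space_adj T = closure (range (defect_op_adj T))"


section \<open>The constrained characteristic function\<close>

text \<open>The formal expression defining the characteristic function, with an arbitrary tuple \<open>X\<close> in
  place of \<open>[W\<^sub>1, \<dots>, W\<^sub>n]\<close>, as an operator on \<open>N \<otimes>\<^sub>S defect_space_adj T\<close>. Since
  \<open>N \<otimes>\<^sub>S UNIV\<close> (with \<open>UNIV :: ('h ^ 'n) set\<close>) is the direct sum of \<open>n\<close> copies of
  \<open>N \<otimes>\<^sub>S (UNIV :: 'h set)\<close>, the row operator \<open>[X\<^sub>1 \<otimes> I, \<dots>, X\<^sub>n \<otimes> I]\<close> is the sum of the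
  operators \<open>X\<^sub>i \<otimes> \<pi>\<^sub>i\<close>, where \<open>\<pi>\<^sub>i v = v $ i\<close>. The inverse is taken on
  \<open>N \<otimes>\<^sub>S (UNIV :: 'h set)\<close>.\<close>

definition char_expression ::
    "'n::finite fock set \<Rightarrow> ('n \<Rightarrow> 'n fock \<Rightarrow> 'n fock) \<Rightarrow> ('n \<Rightarrow> 'h \<Rightarrow> 'h::complex_hilbert)
      \<Rightarrow> ('n list, 'h ^ 'n) ell2 \<Rightarrow> ('n list, 'h) ell2" where
  "char_expression N X T \<xi> =
    (let \<eta> = Proj (N \<otimes>\<^sub>S defect_space_adj T) \<xi>;
         \<zeta> = \<Sum>i\<in>UNIV. (X i \<otimes>\<^sub>O (\<lambda>v. v $ i)) ((Proj N \<otimes>\<^sub>O defect_op_adj T) \<eta>)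
     in - (Proj N \<otimes>\<^sub>O row_op T) \<eta> +
        (Proj N \<otimes>\<^sub>O defect_op T)
          (inv_into (N \<otimes>\<^sub>S UNIV) (\<lambda>x. x - (\<Sum>i\<in>UNIV. (X i \<otimes>\<^sub>O cadjoint (T i)) x)) \<zeta>))"

definition char_fun_radial ::
    "('n::finite fock \<Rightarrow> 'n fock) set \<Rightarrow> ('n \<Rightarrow> 'h \<Rightarrow> 'h::complex_hilbert) \<Rightarrow> real
      \<Rightarrow> ('n list, 'h ^ 'n) ell2 \<Rightarrow> ('n list, 'h) ell2" where
  "char_fun_radial J T r = char_expression (N_space J) (\<lambda>i \<phi>. complex_of_real r *\<^sub>C W_op J i \<phi>) T"

definition char_fun ::
    "('n::finite fock \<Rightarrow> 'n fock) set \<Rightarrow> ('n \<Rightarrow> 'h \<Rightarrow> 'h::complex_hilbert)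
      \<Rightarrow> ('n list, 'h ^ 'n) ell2 \<Rightarrow> ('n list, 'h) ell2" where
  "char_fun J T \<xi> = Lim (at_left 1) (\<lambda>r. char_fun_radial J T r \<xi>)"

definition model_space ::
    "('n::finite fock \<Rightarrow> 'n fock) set \<Rightarrow> ('n \<Rightarrow> 'h \<Rightarrow> 'h::complex_hilbert) \<Rightarrow> ('n list, 'h) ell2 set" where
  "model_space J T = (N_space J \<otimes>\<^sub>S defect_space T) \<ominus>
     char_fun J T ` (N_space J \<otimes>\<^sub>S defect_space_adj T)"

definition model_op ::
    "('n::finite fock \<Rightarrow> 'n fock) set \<Rightarrow> ('n \<Rightarrow> 'h \<Rightarrow> 'h::complex_hilbert) \<Rightarrow> 'n
      \<Rightarrow> ('n list, 'h) ell2 \<Rightarrow> ('n list, 'h) ell2" where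
  "model_op J T i = Proj (model_space J T) \<circ> (B_op J i \<otimes>\<^sub>O Proj (defect_space T)) \<circ>
     Proj (model_space J T)"

text \<open>Unitary equivalence of a tuple on the whole space with a tuple on a closed subspace \<open>M\<close>.
  The adjoint of \<open>U\<close>, taken in the ambient space, restricts on \<open>M\<close> to the inverse of \<open>U\<close>.\<close>

definition unitary_onto :: "'b::complex_hilbert set \<Rightarrow> ('a::complex_hilbert \<Rightarrow> 'b) \<Rightarrow> bool" where
  "unitary_onto M U \<longleftrightarrow>
     bounded_clinear U \<and> (\<forall>x y. cinner (U x) (U y) = cinner x y) \<and> range U = M"

definition unitarily_equivalent ::
    "('n \<Rightarrow> 'a \<Rightarrow> 'a::complex_hilbert) \<Rightarrow> 'b::complex_hilbert set \<Rightarrow> ('n \<Rightarrow> 'b \<Rightarrow> 'b) \<Rightarrow> bool" where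
  "unitarily_equivalent T M T' \<longleftrightarrow> (\<exists>U. unitary_onto M U \<and> (\<forall>i. T i = cadjoint U \<circ> T' i \<circ> U))"

end

theory Submission
  imports Defs
begin

text \<open>Write \<open>\<Delta>\<^sub>T\<close> and \<open>\<Delta>\<^bsub>T*\<^esub>\<close> for the defect operators. The Julia operator
  \<open>(x, v) \<mapsto> (T\<^sup>* x + \<Delta>\<^bsub>T*\<^esub> v, \<Delta>\<^sub>T x - T v)\<close> is isometric. Iterating it along words, from an initial
  state \<open>a\<close> and with an input family \<open>\<eta>\<close>, gives an output family \<open>K a + \<Theta> \<eta>\<close>, where \<open>K\<close> is the
  Poisson kernel and \<open>\<Theta>\<close> the characteristic function on the full Fock space. The energy balance
  along words and the purity of \<open>T\<close> make \<open>(a, \<eta>) \<mapsto> K a + \<Theta> \<eta>\<close> isometric; running the recursion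
  backwards shows that it is onto. Hence \<open>K K\<^sup>* + \<Theta> \<Theta>\<^sup>* = I\<close>.

  Since \<open>J\<close> commutes with the right creation operators, \<open>N\<^sub>J\<close> is coinvariant for them, and the
  constrained characteristic function is the compression \<open>P \<Theta>\<close>, \<open>P\<close> being the projection onto
  \<open>N\<^sub>J \<otimes> D\<^sub>T\<close>. The constraint on \<open>T\<close> says that \<open>K\<close> maps into this space, so
  \<open>(P \<Theta>) (P \<Theta>)\<^sup>* = P - K K\<^sup>*\<close> is a projection. This makes \<open>P \<Theta>\<close> a partial isometry and the range of
  \<open>K\<close> the model space, and \<open>K\<close> intertwines \<open>T\<^sub>i\<^sup>*\<close> with the adjoint of the left shift.\<close>

section \<open>Hilbert space geometry\<close>

text \<open>The inverse in the definition of the characteristic function is guaranteed only for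
  \<open>r < 1\<close>, while the state recursion defines \<open>Theta\<close> directly at
  \<open>r = 1\<close>. The bridge: damping coordinate \<open>w\<close> by
  \<open>r ^ length w\<close> turns the undamped recursion into the damped one. With a norm bound
  for \<open>Theta_rad\<close> uniform in \<open>r\<close> this gives strong convergence. The
  recursion runs on all of \<open>'h\<close> and \<open>'h ^ 'n\<close>, because there the Julia
  operator is unitary and can be inverted. Cutting down to the defect spaces is harmless: on the
  complement of \<open>defect_space_adj T\<close> the operator \<open>E\<close> vanishes, so
  \<open>Theta\<close> acts there as minus the row operator, whose image lies in the complement of
  \<open>defect_space T\<close> and disappears under compression. Purity controls a state only once
  the input has stopped, and the backward recursion needs a level beyond which everything is zero;
  both are used for finitely supported families and extended by density. Membership in the tensor
  product comes from the Neumann series of the compressed resolvent at fixed \<open>r\<close>, whose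
  terms are finite sums of elementary tensors.\<close>

lemma cinner_zero_left [simp]: "cinner 0 (y :: 'a::complex_hilbert) = 0"
  using cinner_add_left[of 0 0 y] by simp

lemma cinner_zero_right [simp]: "cinner (y :: 'a::complex_hilbert) 0 = 0"
  using cinner_add_right[of y 0 0] by simp

lemma cinner_minus_left: "cinner (- x) (y :: 'a::complex_hilbert) = - cinner x y"
  using cinner_add_left[of x "- x" y] by (simp add: eq_neg_iff_add_eq_0 add.commute)

lemma cinner_minus_right: "cinner (x :: 'a::complex_hilbert) (- y) = - cinner x y"
  using cinner_add_right[of x y "- y"] by (simp add: eq_neg_iff_add_eq_0 add.commute)

lemma cinner_diff_left: "cinner (x - z) (y :: 'a::complex_hilbert) = cinner x y - cinner z y"
  using cinner_add_left[of x "- z" y] by (simp add: cinner_minus_left)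

lemma cinner_diff_right: "cinner (x :: 'a::complex_hilbert) (y - z) = cinner x y - cinner x z"
  using cinner_add_right[of x y "- z"] by (simp add: cinner_minus_right)

lemmas cinner_simps = cinner_add_left cinner_add_right cinner_diff_left cinner_diff_right
  cinner_minus_left cinner_minus_right cinner_scaleC_left cinner_scaleC_right

lemma cinner_scaleR_left: "cinner (r *\<^sub>R x) (y :: 'a::complex_hilbert) = of_real r * cinner x y"
  by (simp add: cinner_scaleC_left flip: scaleC_of_real)

lemma cinner_scaleR_right: "cinner (x :: 'a::complex_hilbert) (r *\<^sub>R y) = of_real r * cinner x y"
  by (simp add: cinner_scaleC_right flip: scaleC_of_real)

lemma cinner_sum_left: "cinner (\<Sum>i\<in>F. f i) (y :: 'a::complex_hilbert) = (\<Sum>i\<in>F. cinner (f i) y)"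
  by (induction F rule: infinite_finite_induct) (auto simp: cinner_simps)

lemma bounded_bilinear_cinner: "bounded_bilinear (cinner :: 'a::complex_hilbert \<Rightarrow> _)"
proof
  show "\<exists>K. \<forall>a b :: 'a. norm (cinner a b) \<le> norm a * norm b * K"
    by (rule exI[of _ 1]) (simp add: norm_cinner_le)
qed (simp_all add: cinner_simps cinner_scaleR_left cinner_scaleR_right scaleR_conv_of_real)

lemmas tendsto_cinner = bounded_bilinear.tendsto[OF bounded_bilinear_cinner]

lemma norm_add_sq: "(norm (x + y :: 'a::complex_hilbert))\<^sup>2 = (norm x)\<^sup>2 + (norm y)\<^sup>2 + 2 * Re (cinner x y)"
proof -
  have "complex_of_real ((norm (x + y))\<^sup>2) = of_real ((norm x)\<^sup>2) + of_real ((norm y)\<^sup>2) + (cinner x y + cinner y x)"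
    unfolding cinner_same[symmetric] by (simp add: cinner_simps)
  also have "cinner x y + cinner y x = of_real (2 * Re (cinner x y))"
    using cinner_commute[of y x] by (simp add: complex_add_cnj)
  finally show ?thesis
    by (simp only: of_real_add[symmetric] of_real_eq_iff)
qed

lemma norm_diff_sq: "(norm (x - y :: 'a::complex_hilbert))\<^sup>2 = (norm x)\<^sup>2 + (norm y)\<^sup>2 - 2 * Re (cinner x y)"
  using norm_add_sq[of x "- y"] by (simp add: cinner_minus_right)

lemma cinner_eq_zero_all: "(\<And>y. cinner x y = 0) \<Longrightarrow> (x :: 'a::complex_hilbert) = 0"
  using cinner_same[of x] by simp

lemma cinner_ext: "(\<And>z. cinner x z = cinner y z) \<Longrightarrow> (x :: 'a::complex_hilbert) = y"
  using cinner_eq_zero_all[of "x - y"] by (simp add: cinner_diff_left)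

lemma cinner_ext': "(\<And>z. cinner z x = cinner z y) \<Longrightarrow> (x :: 'a::complex_hilbert) = y"
  by (metis cinner_ext cinner_commute)

lemma cinner_swap_zero: "cinner x y = 0 \<Longrightarrow> cinner y (x :: 'a::complex_hilbert) = 0"
  by (metis cinner_commute complex_cnj_zero)

lemma norm_eq_of_cinner: "cinner x x = cinner y y \<Longrightarrow> norm (x :: 'a::complex_hilbert) = norm (y :: 'b::complex_hilbert)"
  unfolding cinner_same of_real_eq_iff by simp


section \<open>Bounded operators and orthogonal projections\<close>

lemma bounded_clinearI:
  assumes "\<And>x y. A (x + y) = A x + A y" "\<And>c x. A (c *\<^sub>C x) = c *\<^sub>C A x" "\<And>x. norm (A x) \<le> norm x * K"
  shows "bounded_clinear A"
  unfolding bounded_clinear_def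
proof
  show "bounded_linear A"
    by (rule bounded_linear_intro[of _ K]) (use assms in \<open>auto simp flip: scaleC_of_real\<close>)
qed (use assms in auto)

lemma bounded_clinear_bounded_linear: "bounded_clinear A \<Longrightarrow> bounded_linear A"
  by (simp add: bounded_clinear_def)

lemma clin_add: "bounded_clinear A \<Longrightarrow> A (x + y) = A x + A y"
  and clin_diff: "bounded_clinear A \<Longrightarrow> A (x - y) = A x - A y"
  and clin_minus: "bounded_clinear A \<Longrightarrow> A (- x) = - A x"
  and clin_zero: "bounded_clinear A \<Longrightarrow> A 0 = 0"
  and clin_scaleC: "bounded_clinear A \<Longrightarrow> A (c *\<^sub>C x) = c *\<^sub>C A x"
  and clin_scaleR: "bounded_clinear A \<Longrightarrow> A (r *\<^sub>R x) = r *\<^sub>R A x"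
  and clin_sum: "bounded_clinear A \<Longrightarrow> A (\<Sum>i\<in>F. f i) = (\<Sum>i\<in>F. A (f i))"
  by (auto simp: bounded_clinear_def linear_simps bounded_linear.linear linear_sum)

lemmas clin_simps = clin_add clin_diff clin_minus clin_zero clin_scaleC clin_scaleR

lemma clin_tendsto: "bounded_clinear A \<Longrightarrow> (f \<longlongrightarrow> l) F \<Longrightarrow> ((\<lambda>x. A (f x)) \<longlongrightarrow> A l) F"
  by (rule bounded_linear.tendsto[OF bounded_clinear_bounded_linear])

lemma clin_continuous_on: "bounded_clinear A \<Longrightarrow> continuous_on S A"
  using linear_continuous_on bounded_clinear_bounded_linear by blast

lemma clin_bound:
  assumes "bounded_clinear A"
  obtains K where "K \<ge> 0" "\<And>x. norm (A x) \<le> norm x * K"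
  using bounded_linear.nonneg_bounded[OF bounded_clinear_bounded_linear[OF assms]] by blast

lemma clin_id: "bounded_clinear (\<lambda>x. x)"
  by (rule bounded_clinearI[of _ 1]) auto

lemma clin_zero_op: "bounded_clinear (\<lambda>x. 0)"
  by (rule bounded_clinearI[of _ 1]) auto

lemma clin_comp: "bounded_clinear A \<Longrightarrow> bounded_clinear B \<Longrightarrow> bounded_clinear (\<lambda>x. A (B x))"
  by (auto simp: bounded_clinear_def intro: bounded_linear_compose)

lemma clin_o: "bounded_clinear A \<Longrightarrow> bounded_clinear B \<Longrightarrow> bounded_clinear (A \<circ> B)"
  unfolding comp_def by (rule clin_comp)

lemma clin_add_op: "bounded_clinear A \<Longrightarrow> bounded_clinear B \<Longrightarrow> bounded_clinear (\<lambda>x. A x + B x)"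
  by (auto simp: bounded_clinear_def scaleC_add_right intro: bounded_linear_add)

lemma clin_minus_op: "bounded_clinear A \<Longrightarrow> bounded_clinear (\<lambda>x. - A x)"
  by (auto simp: bounded_clinear_def complex_vector.scale_minus_right intro: bounded_linear_minus)

lemma clin_diff_op: "bounded_clinear A \<Longrightarrow> bounded_clinear B \<Longrightarrow> bounded_clinear (\<lambda>x. A x - B x)"
  using clin_add_op[OF _ clin_minus_op] by fastforce

lemma clin_scale_op: "bounded_clinear A \<Longrightarrow> bounded_clinear (\<lambda>x. c *\<^sub>C A x)"
proof -
  assume A: "bounded_clinear A"
  obtain K where "\<And>x. norm (A x) \<le> norm x * K" using clin_bound[OF A] by blast
  then have "cmod c * norm (A x) \<le> cmod c * (norm x * K)" for x
    by (rule mult_left_mono) simp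
  then have "cmod c * norm (A x) \<le> norm x * (cmod c * K)" for x
    by (simp add: mult.left_commute)
  then show ?thesis
    by (intro bounded_clinearI[of _ "cmod c * K"])
      (simp_all only: clin_add[OF A] clin_scaleC[OF A] scaleC_add_right scaleC_scaleC norm_scaleC mult.commute)
qed

lemma clin_sum_op: "(\<And>i. i \<in> F \<Longrightarrow> bounded_clinear (A i)) \<Longrightarrow> bounded_clinear (\<lambda>x. \<Sum>i\<in>F. A i x)"
  by (induction F rule: infinite_finite_induct) (auto intro: clin_add_op clin_zero_op)

lemmas clin_intros = clin_id clin_zero_op clin_add_op clin_minus_op clin_diff_op
  clin_scale_op clin_sum_op

lemma bounded_clinear_cinner_left: "bounded_clinear (\<lambda>x. cinner x (y :: 'a::complex_hilbert))"
  by (rule bounded_clinearI[of _ "norm y"]) (auto simp: cinner_simps scaleC_complex_def norm_cinner_le)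

section \<open>Closed complex subspaces and orthogonal projections\<close>

definition closed_csubspace :: "'a::complex_hilbert set \<Rightarrow> bool" where
  "closed_csubspace M \<longleftrightarrow> closed M \<and> complex_vector.subspace M"

lemma closed_csubspaceD:
  assumes "closed_csubspace M"
  shows "closed M" "0 \<in> M" "\<And>x y. x \<in> M \<Longrightarrow> y \<in> M \<Longrightarrow> x + y \<in> M"
    "\<And>c x. x \<in> M \<Longrightarrow> c *\<^sub>C x \<in> M" "\<And>x y. x \<in> M \<Longrightarrow> y \<in> M \<Longrightarrow> x - y \<in> M"
    "\<And>r x. x \<in> M \<Longrightarrow> r *\<^sub>R x \<in> M"
  using assms unfolding closed_csubspace_def
  by (auto simp: complex_vector.subspace_0 complex_vector.subspace_add complex_vector.subspace_scale
      complex_vector.subspace_diff simp flip: scaleC_of_real)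

lemma closed_csubspaceI:
  assumes "closed M" "0 \<in> M" "\<And>x y. x \<in> M \<Longrightarrow> y \<in> M \<Longrightarrow> x + y \<in> M"
    "\<And>c x. x \<in> M \<Longrightarrow> c *\<^sub>C x \<in> M"
  shows "closed_csubspace M"
  using assms by (auto simp: closed_csubspace_def intro!: complex_vector.subspaceI)

lemma closed_csubspace_UNIV: "closed_csubspace UNIV"
  by (rule closed_csubspaceI) auto

lemma closed_csubspace_closure:
  assumes S: "complex_vector.subspace S"
  shows "closed_csubspace (closure S)"
proof (rule closed_csubspaceI)
  show "0 \<in> closure S"
    using S complex_vector.subspace_0 closure_subset by blast
  fix x y :: 'a and c assume x: "x \<in> closure S"
  obtain f where f: "\<And>n::nat. f n \<in> S" "f \<longlonglongrightarrow> x"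
    using x unfolding closure_sequential by blast
  show "c *\<^sub>C x \<in> closure S"
    unfolding closure_sequential
    using f S by (intro exI[of _ "\<lambda>n. c *\<^sub>C f n"])
      (auto simp: complex_vector.subspace_scale intro: clin_tendsto[OF clin_scale_op[OF clin_id]])
  assume "y \<in> closure S"
  then obtain g where g: "\<And>n::nat. g n \<in> S" "g \<longlonglongrightarrow> y"
    unfolding closure_sequential by blast
  show "x + y \<in> closure S"
    unfolding closure_sequential
    using f g S by (intro exI[of _ "\<lambda>n. f n + g n"])
      (auto simp: complex_vector.subspace_add intro: tendsto_add)
qed auto

lemma closure_span_le:
  assumes "closed_csubspace M" "S \<subseteq> M"
  shows "closure (complex_vector.span S) \<subseteq> M"
  using assms by (intro closure_minimal complex_vector.span_minimal) (auto simp: closed_csubspace_def)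

text \<open>The standard way below to extend a linear identity from generators to a closed span. A
  single identity is handled with the index set \<open>{()}\<close>.\<close>

lemma closed_csubspace_zero_set:
  assumes "\<And>i. bounded_clinear (f i)"
  shows "closed_csubspace {x. \<forall>i\<in>I. f i x = 0}"
proof (rule closed_csubspaceI)
  have "closed (\<Inter>i\<in>I. {x. f i x = 0})"
    by (intro closed_INT ballI closed_Collect_eq clin_continuous_on assms continuous_on_const)
  then show "closed {x. \<forall>i\<in>I. f i x = 0}"
    by (simp add: INTER_eq)
qed (auto simp: clin_simps[OF assms])

lemma ortho_complement_closed: "closed_csubspace (UNIV \<ominus> S)"
  using closed_csubspace_zero_set[of "\<lambda>y x. cinner x y" S, OF bounded_clinear_cinner_left]
  by (simp add: ortho_diff_def)

text \<open>The parallelogram law makes every minimising sequence Cauchy.\<close>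

lemma Proj_exists:
  fixes M :: "'a::complex_hilbert set"
  assumes M: "closed_csubspace M"
  shows "\<exists>y\<in>M. \<forall>z\<in>M. cinner (x - y) z = 0"
proof -
  note s = closed_csubspaceD[OF M]
  define d where "d = (INF y\<in>M. (norm (x - y))\<^sup>2)"
  have bdd: "bdd_below ((\<lambda>y. (norm (x - y))\<^sup>2) ` M)"
    by (rule bdd_belowI2[of _ 0]) auto
  have d_le: "d \<le> (norm (x - y))\<^sup>2" if "y \<in> M" for y
    unfolding d_def by (rule cINF_lower[OF bdd that])
  have "\<exists>y\<in>M. (norm (x - y))\<^sup>2 < d + 1 / Suc n" for n
    using cInf_lessD[of "(\<lambda>y. (norm (x - y))\<^sup>2) ` M" "d + 1 / Suc n"] s(2) unfolding d_def by force
  then obtain f where f: "\<And>n. f n \<in> M" "\<And>n. (norm (x - f n))\<^sup>2 < d + 1 / Suc n"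
    by metis
  have par: "(norm (a - b))\<^sup>2 \<le> 2 * (norm (x - a))\<^sup>2 + 2 * (norm (x - b))\<^sup>2 - 4 * d"
    if "a \<in> M" "b \<in> M" for a b
  proof -
    have "(norm ((x - a) + (x - b)))\<^sup>2 = 4 * (norm (x - (1/2) *\<^sub>R (a + b)))\<^sup>2"
    proof -
      have "(x - a) + (x - b) = 2 *\<^sub>R (x - (1/2) *\<^sub>R (a + b))"
        by (simp add: algebra_simps scaleR_2)
      then show ?thesis by (simp add: power_mult_distrib)
    qed
    moreover have "(norm ((x - a) - (x - b)))\<^sup>2 + (norm ((x - a) + (x - b)))\<^sup>2
        = 2 * (norm (x - a))\<^sup>2 + 2 * (norm (x - b))\<^sup>2"
      unfolding norm_add_sq norm_diff_sq by simp
    moreover have "d \<le> (norm (x - (1/2) *\<^sub>R (a + b)))\<^sup>2"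
      by (rule d_le) (use that s in auto)
    ultimately show ?thesis
      by (simp add: norm_minus_commute)
  qed
  have "Cauchy f"
  proof (rule metric_CauchyI)
    fix e :: real assume e: "0 < e"
    obtain N where N: "4 / e\<^sup>2 < real N" using reals_Archimedean2 by blast
    show "\<exists>M. \<forall>m\<ge>M. \<forall>n\<ge>M. dist (f m) (f n) < e"
    proof (intro exI[of _ N] allI impI)
      fix m n assume mn: "N \<le> m" "N \<le> n"
      have Npos: "0 < real N" using N e by (smt (verit) divide_pos_pos zero_less_power)
      have le: "1 / real (Suc k) \<le> 1 / real N" if "N \<le> k" for k
        using that Npos by (intro divide_left_mono) auto
      have "(norm (f m - f n))\<^sup>2 < 4 / N"
        using par[OF f(1)[of m] f(1)[of n]] f(2)[of m] f(2)[of n] le[OF mn(1)] le[OF mn(2)] by linarith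
      also have "\<dots> < e\<^sup>2" using N e Npos by (simp add: field_simps)
      finally show "dist (f m) (f n) < e"
        using e by (simp add: dist_norm power2_less_imp_less)
    qed
  qed
  then obtain y where y: "f \<longlonglongrightarrow> y"
    by (auto simp: Cauchy_convergent_iff convergent_def)
  have yM: "y \<in> M" using closed_sequentially[OF s(1)] f(1) y by blast
  have "(\<lambda>n. (norm (x - f n))\<^sup>2) \<longlonglongrightarrow> (norm (x - y))\<^sup>2"
    by (intro tendsto_intros y)
  moreover have "(\<lambda>n. d + 1 / Suc n) \<longlonglongrightarrow> d + 0"
    by (intro tendsto_add tendsto_const LIMSEQ_Suc[OF lim_1_over_n])
  ultimately have yd: "(norm (x - y))\<^sup>2 \<le> d"
    using f(2) by (simp add: LIMSEQ_le less_imp_le)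
  have "cinner (x - y) z = 0" if z: "z \<in> M" for z
  proof (rule ccontr)
    assume nz: "cinner (x - y) z \<noteq> 0"
    then have zn: "z \<noteq> 0" by auto
    define a where "a = cinner (x - y) z"
    define q where "q = (norm z)\<^sup>2"
    have q: "q > 0" using zn by (simp add: q_def)
    \<comment> \<open>The multiple of \<open>z\<close> by \<open>c\<close> is the component of
      \<open>x - y\<close> along \<open>z\<close>; moving \<open>y\<close> by it would lower the
      squared distance by the positive amount \<open>(cmod a)\<^sup>2 / q\<close>.\<close>
    define c where "c = a / of_real q"
    have "(norm (x - y))\<^sup>2 \<le> (norm (x - (y + c *\<^sub>C z)))\<^sup>2"
      by (rule order_trans[OF yd d_le[OF s(3)[OF yM s(4)[OF z]]]])
    also have "\<dots> = (norm ((x - y) - c *\<^sub>C z))\<^sup>2" by (simp add: algebra_simps)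
    also have "\<dots> = (norm (x - y))\<^sup>2 + (cmod c)\<^sup>2 * q - 2 * Re (cnj c * a)"
      unfolding norm_diff_sq by (simp add: cinner_scaleC_right norm_scaleC power_mult_distrib a_def q_def)
    finally have "2 * Re (cnj c * a) \<le> (cmod c)\<^sup>2 * q" by simp
    moreover have "cnj c * a = of_real ((cmod a)\<^sup>2 / q)"
      by (simp add: c_def complex_norm_square mult.commute flip: of_real_power)
    moreover have "(cmod c)\<^sup>2 * q = (cmod a)\<^sup>2 / q"
      using q by (simp add: c_def norm_divide power_divide power2_eq_square)
    ultimately have "(cmod a)\<^sup>2 / q \<le> 0" by simp
    then show False using q nz by (simp add: a_def divide_le_0_iff)
  qed
  then show ?thesis using yM by blast
qed

lemma Proj_eqI:
  assumes M: "closed_csubspace M" and y: "y \<in> M" "\<And>z. z \<in> M \<Longrightarrow> cinner (x - y) z = 0"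
  shows "Proj M x = y"
  unfolding Proj_def
proof (rule the_equality)
  fix y' assume y': "y' \<in> M \<and> (\<forall>z\<in>M. cinner (x - y') z = 0)"
  have "cinner (y' - y) z = 0" if "z \<in> M" for z
    using y(2)[OF that] y' that by (simp add: cinner_diff_left)
  moreover have "y' - y \<in> M" using y y' closed_csubspaceD(5)[OF M] by blast
  ultimately have "cinner (y' - y) (y' - y) = 0" by blast
  then show "y' = y" by (simp add: cinner_same)
qed (use y in blast)

lemma
  assumes M: "closed_csubspace M"
  shows Proj_in: "Proj M x \<in> M"
    and Proj_ortho: "z \<in> M \<Longrightarrow> cinner (x - Proj M x) z = 0"
  using Proj_exists[OF M, of x] Proj_eqI[OF M] by metis+

lemma Proj_id: "closed_csubspace M \<Longrightarrow> x \<in> M \<Longrightarrow> Proj M x = x"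
  by (rule Proj_eqI) auto

lemma Proj_idem: "closed_csubspace M \<Longrightarrow> Proj M (Proj M x) = Proj M x"
  by (simp add: Proj_id Proj_in)

lemma Proj_UNIV [simp]: "Proj UNIV x = x"
  by (simp add: Proj_id closed_csubspace_UNIV)

lemma Proj_cinner:
  assumes M: "closed_csubspace M"
  shows "cinner (Proj M x) y = cinner x (Proj M y)"
proof -
  have "cinner (x - Proj M x) (Proj M y) = 0" using Proj_ortho[OF M Proj_in[OF M]] .
  moreover have "cinner (Proj M x) (y - Proj M y) = 0"
    using Proj_ortho[OF M Proj_in[OF M]] cinner_swap_zero by blast
  ultimately show ?thesis by (simp add: cinner_simps)
qed

lemma Proj_norm_le: "closed_csubspace M \<Longrightarrow> norm (Proj M x) \<le> norm x"
proof -
  assume M: "closed_csubspace M"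
  have "cinner (x - Proj M x) (Proj M x) = 0" by (rule Proj_ortho[OF M Proj_in[OF M]])
  then have "(norm ((x - Proj M x) + Proj M x))\<^sup>2 = (norm (x - Proj M x))\<^sup>2 + (norm (Proj M x))\<^sup>2"
    unfolding norm_add_sq by simp
  then have "(norm (Proj M x))\<^sup>2 \<le> (norm x)\<^sup>2" by simp
  then show ?thesis by (simp add: power2_le_iff_abs_le)
qed

lemma Proj_clin: "closed_csubspace M \<Longrightarrow> bounded_clinear (Proj M)"
proof (rule bounded_clinearI[of _ 1])
  assume M: "closed_csubspace M"
  note s = closed_csubspaceD[OF M] and i = Proj_in[OF M] and o = Proj_ortho[OF M]
  show "Proj M (x + y) = Proj M x + Proj M y" for x y
  proof (rule Proj_eqI[OF M])
    fix z assume "z \<in> M"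
    then show "cinner (x + y - (Proj M x + Proj M y)) z = 0"
      using o[of z x] o[of z y] by (simp add: cinner_simps)
  qed (use s i in auto)
  show "Proj M (c *\<^sub>C x) = c *\<^sub>C Proj M x" for x c
  proof (rule Proj_eqI[OF M])
    fix z assume "z \<in> M"
    then show "cinner (c *\<^sub>C x - c *\<^sub>C Proj M x) z = 0"
      using o[of z x] by (simp add: cinner_simps)
  qed (use s i in auto)
  show "norm (Proj M x) \<le> norm x * 1" for x using Proj_norm_le[OF M] by simp
qed

lemma Proj_eq_zero_iff: "closed_csubspace M \<Longrightarrow> Proj M x = 0 \<longleftrightarrow> (\<forall>z\<in>M. cinner x z = 0)"
  using Proj_ortho[of M _ x] Proj_eqI[of M 0 x] closed_csubspaceD(2)[of M] by auto

lemma Proj_ortho_complement: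
  assumes M: "closed_csubspace M"
  shows "Proj (UNIV \<ominus> M) x = x - Proj M x"
  by (rule Proj_eqI[OF ortho_complement_closed])
    (use Proj_ortho[OF M] Proj_in[OF M] in \<open>auto simp: ortho_diff_def dest: cinner_swap_zero\<close>)

lemma closed_csubspace_eq_UNIV:
  assumes M: "closed_csubspace M" and z: "\<And>x. (\<And>y. y \<in> M \<Longrightarrow> cinner x y = 0) \<Longrightarrow> x = 0"
  shows "M = UNIV"
proof -
  have "x - Proj M x = 0" for x by (rule z) (rule Proj_ortho[OF M])
  then show ?thesis using Proj_in[OF M] by (metis UNIV_eq_I eq_iff_diff_eq_0)
qed


section \<open>Adjoints and square roots\<close>

text \<open>The part \<open>e\<close> of \<open>a\<close> orthogonal to the kernel of
  \<open>f\<close> spans the complement of the kernel: subtracting from \<open>x\<close> the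
  multiple of \<open>e\<close> with the same value of \<open>f\<close> lands in the kernel, so the
  inner product with \<open>e\<close> reads off \<open>f x\<close>.\<close>

lemma riesz:
  assumes f: "bounded_clinear (f :: 'a::complex_hilbert \<Rightarrow> complex)"
  shows "\<exists>u. \<forall>x. f x = cinner x u"
proof (cases "\<forall>x. f x = 0")
  case False
  then obtain a where a: "f a \<noteq> 0" by blast
  define M where "M = {x. \<forall>i\<in>UNIV::unit set. f x = 0}"
  have M: "closed_csubspace M" unfolding M_def by (rule closed_csubspace_zero_set[OF f])
  define e where "e = a - Proj M a"
  have "f (Proj M a) = 0" using Proj_in[OF M, of a] by (auto simp: M_def)
  then have fe: "f e = f a" by (simp add: e_def clin_simps[OF f])
  then have ee: "cinner e e \<noteq> 0" using a clin_zero[OF f] by (auto simp: cinner_same)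
  have "f x = cinner x (cnj (f e / cinner e e) *\<^sub>C e)" for x
  proof -
    have "x - (f x / f e) *\<^sub>C e \<in> M"
      using a fe by (simp add: M_def clin_simps[OF f] scaleC_complex_def)
    then have "cinner e (x - (f x / f e) *\<^sub>C e) = 0"
      unfolding e_def by (rule Proj_ortho[OF M])
    then have "cinner (x - (f x / f e) *\<^sub>C e) e = 0" by (rule cinner_swap_zero)
    then show ?thesis using ee a fe by (simp add: cinner_simps field_simps)
  qed
  then show ?thesis by blast
qed (auto intro: exI[of _ 0])

text \<open>Riesz gives \<open>B y\<close> for each \<open>y\<close> separately. Linearity is forced
  by uniqueness, and boundedness follows since \<open>(norm (B y))\<^sup>2\<close> is the modulus of
  \<open>cinner (A (B y)) y\<close>. This makes the \<open>THE\<close> in \<open>cadjoint\<close>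
  meaningful.\<close>

lemma adjoint_exists:
  assumes A: "bounded_clinear (A :: 'a::complex_hilbert \<Rightarrow> 'b::complex_hilbert)"
  shows "\<exists>B. bounded_clinear B \<and> (\<forall>x y. cinner (A x) y = cinner x (B y))"
proof -
  have "\<exists>u. \<forall>x. cinner (A x) y = cinner x u" for y
    by (rule riesz[OF clin_comp[OF bounded_clinear_cinner_left A]])
  then obtain B where B: "\<And>x y. cinner (A x) y = cinner x (B y)" by metis
  obtain K where K: "K \<ge> 0" "\<And>x. norm (A x) \<le> norm x * K" using clin_bound[OF A] by blast
  have "norm (B y) \<le> norm y * K" for y
  proof (cases "B y = 0")
    case False
    have "(norm (B y))\<^sup>2 = cmod (cinner (A (B y)) y)"
      by (simp add: B cinner_same norm_power)
    also have "\<dots> \<le> norm (A (B y)) * norm y" by (rule norm_cinner_le)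
    also have "\<dots> \<le> (norm (B y) * K) * norm y" by (rule mult_right_mono[OF K(2)]) auto
    finally show ?thesis using False by (simp add: power2_eq_square mult.commute)
  qed (simp add: K)
  moreover have "B (x + y) = B x + B y" for x y
    by (rule cinner_ext') (simp add: cinner_add_right flip: B)
  moreover have "B (c *\<^sub>C x) = c *\<^sub>C B x" for c x
    by (rule cinner_ext') (simp add: cinner_scaleC_right flip: B)
  ultimately have "bounded_clinear B"
    by (intro bounded_clinearI[of _ K])
  then show ?thesis using B by blast
qed

lemma cadjoint_eqI:
  assumes "bounded_clinear B" "\<And>x y. cinner (A x) y = cinner x (B y)"
  shows "cadjoint A = B"
  unfolding cadjoint_def
proof (rule the_equality)
  show "bounded_clinear B \<and> (\<forall>x y. cinner (A x) y = cinner x (B y))" using assms by blast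
  fix B' assume "bounded_clinear B' \<and> (\<forall>x y. cinner (A x) y = cinner x (B' y))"
  then show "B' = B" using assms(2) by (metis cinner_ext' ext)
qed

lemma
  assumes "bounded_clinear A"
  shows cadjoint_clin: "bounded_clinear (cadjoint A)"
    and cinner_cadjoint: "cinner (A x) y = cinner x (cadjoint A y)"
    and cinner_cadjoint': "cinner (cadjoint A y) x = cinner y (A x)"
proof -
  obtain B where B: "bounded_clinear B" "\<And>x y. cinner (A x) y = cinner x (B y)"
    using adjoint_exists[OF assms] by blast
  have e: "cadjoint A = B" by (rule cadjoint_eqI[OF B])
  show "bounded_clinear (cadjoint A)" "cinner (A x) y = cinner x (cadjoint A y)"
    using B unfolding e by auto
  then show "cinner (cadjoint A y) x = cinner y (A x)"
    by (metis cinner_commute)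
qed

lemma cadjoint_comp:
  assumes "bounded_clinear A" "bounded_clinear B"
  shows "cadjoint (\<lambda>x. A (B x)) y = cadjoint B (cadjoint A y)"
  by (subst cadjoint_eqI[of "\<lambda>y. cadjoint B (cadjoint A y)"])
    (simp_all add: assms cadjoint_clin cinner_cadjoint[OF assms(1)] cinner_cadjoint[OF assms(2)] clin_comp)

text \<open>Polarisation with the scalars 1 and \<i> isolates the off-diagonal terms. Over the
  complex numbers this turns norm identities into operator identities, which is how isometries and
  self-adjointness are obtained below.\<close>

lemma quadratic_form_zero:
  assumes A: "bounded_clinear (A :: 'a::complex_hilbert \<Rightarrow> 'a)" and z: "\<And>x. cinner (A x) x = 0"
  shows "A x = 0"
proof (rule cinner_eq_zero_all)
  fix y
  have 1: "cinner (A x) y + cinner (A y) x = 0"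
    using z[of "x + y"] z[of x] z[of y] by (simp add: clin_simps[OF A] cinner_simps add.commute)
  have "\<i> * (cinner (A y) x - cinner (A x) y) = 0"
    using z[of "x + \<i> *\<^sub>C y"] z[of x] z[of y] by (simp add: clin_simps[OF A] cinner_simps algebra_simps)
  with 1 show "cinner (A x) y = 0" by simp
qed

lemma isometry_cinner:
  assumes A: "bounded_clinear A" and n: "\<And>x. norm (A x) = norm x"
  shows "cinner (A x) (A y) = cinner x y"
proof -
  have "cadjoint A (A x) - x = 0" for x
  proof (rule quadratic_form_zero[of "\<lambda>x. cadjoint A (A x) - x"])
    show "bounded_clinear (\<lambda>x. cadjoint A (A x) - x)"
      by (intro clin_intros clin_comp[OF cadjoint_clin A] A)
    show "cinner (cadjoint A (A x) - x) x = 0" for x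
      by (simp add: cinner_simps cinner_cadjoint'[OF A] cinner_same n)
  qed
  then have "cadjoint A (A x) = x" by simp
  then show ?thesis using cinner_cadjoint'[OF A, of "A x" y] by simp
qed

section \<open>Positive operators and their square roots\<close>

lemma positive_op_clin: "positive_op A \<Longrightarrow> bounded_clinear A"
  by (simp add: positive_op_def)

lemma positive_op_selfadjoint:
  assumes "positive_op A"
  shows "cinner (A x) y = cinner x (A y)"
proof -
  have A: "bounded_clinear A" using assms by (simp add: positive_op_def)
  have re: "cnj (cinner (A x) x) = cinner (A x) x" for x
    using assms by (metis positive_op_def nonneg_Reals_cases complex_cnj_complex_of_real)
  have "A x - cadjoint A x = 0" for x
  proof (rule quadratic_form_zero[of "\<lambda>x. A x - cadjoint A x"])
    show "bounded_clinear (\<lambda>x. A x - cadjoint A x)"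
      by (intro clin_intros cadjoint_clin A)
    show "cinner (A x - cadjoint A x) x = 0" for x
      using re[of x] by (simp add: cinner_simps cinner_cadjoint'[OF A] cinner_commute[of x "A x"])
  qed
  then show ?thesis using cinner_cadjoint[OF A, of x y] by simp
qed

text \<open>Perturb \<open>y\<close> in the direction \<open>A y\<close>: along this line the form
  is a quadratic polynomial in \<open>t\<close> without constant term, and a small negative
  \<open>t\<close> makes it negative if the linear coefficient is positive.\<close>

lemma positive_op_null:
  assumes "positive_op A" "cinner (A y) y = 0"
  shows "A y = 0"
proof (rule ccontr)
  assume nz: "A y \<noteq> 0"
  have A: "bounded_clinear A" using assms by (simp add: positive_op_def)
  define p where "p = (norm (A y))\<^sup>2"
  define q where "q = Re (cinner (A (A y)) (A y))"
  have p: "p > 0" using nz by (simp add: p_def)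
  have pos: "0 \<le> Re (cinner (A x) x)" for x
    using assms(1) by (metis positive_op_def nonneg_Reals_cases Re_complex_of_real)
  have q: "q \<ge> 0" unfolding q_def by (rule pos)
  have "cinner (A (A y)) y = cinner (A y) (A y)" by (rule positive_op_selfadjoint[OF assms(1)])
  then have "Re (cinner (A (y + t *\<^sub>R A y)) (y + t *\<^sub>R A y)) = 2 * t * p + t\<^sup>2 * q" for t
    by (simp add: clin_simps[OF A] cinner_simps cinner_scaleR_left cinner_scaleR_right assms(2)
        cinner_same p_def q_def algebra_simps power2_eq_square)
  then have "0 \<le> 2 * t * p + t\<^sup>2 * q" for t by (metis pos)
  \<comment> \<open>The \<open>+ 1\<close> keeps the denominator positive; since
    \<open>c * q \<le> p\<close>, the value of the form at \<open>t = - c\<close> is at most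
    \<open>- c * p < 0\<close>.\<close>
  define c where "c = p / (q + 1)"
  have c: "c > 0" "c * q \<le> p" using p q by (auto simp: c_def field_simps)
  have "0 \<le> c * (c * q - 2 * p)"
    using \<open>\<And>t. 0 \<le> 2 * t * p + t\<^sup>2 * q\<close>[of "- c"] by (simp add: algebra_simps power2_eq_square)
  then show False using c p by (simp add: zero_le_mult_iff)
qed

text \<open>The iteration converges to the solution \<open>Y\<close> of \<open>2 Y = X + Y\<^sup>2\<close>, that is,
  \<open>(I - Y)\<^sup>2 = I - X\<close>. It is dominated by the same iteration for \<open>X = 1\<close>.\<close>

primrec sqrt_iter :: "('a::complex_hilbert \<Rightarrow> 'a) \<Rightarrow> nat \<Rightarrow> 'a \<Rightarrow> 'a" where
  "sqrt_iter X 0 = (\<lambda>x. 0)"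
| "sqrt_iter X (Suc n) = (\<lambda>x. (1/2) *\<^sub>R (X x + sqrt_iter X n (sqrt_iter X n x)))"

primrec sqrt_bound :: "nat \<Rightarrow> real" where
  "sqrt_bound 0 = 0"
| "sqrt_bound (Suc n) = (1 + (sqrt_bound n)\<^sup>2) / 2"

lemma sqrt_bound_range: "0 \<le> sqrt_bound n \<and> sqrt_bound n \<le> 1"
  by (induction n) (auto simp: power_le_one)

lemma sqrt_bound_mono: "sqrt_bound n \<le> sqrt_bound (Suc n)"
  using zero_le_power2[of "1 - sqrt_bound n"] by (simp add: power2_eq_square algebra_simps)

lemma sqrt_bound_convergent: "Cauchy sqrt_bound"
  using incseq_convergent[of sqrt_bound 1] sqrt_bound_range sqrt_bound_mono
  by (metis LIMSEQ_imp_Cauchy incseq_SucI)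

lemma half_scaleR_clin: "bounded_clinear A \<Longrightarrow> bounded_clinear (\<lambda>x. (1/2) *\<^sub>R A x)"
  using clin_scale_op[of A "1/2"] by (simp flip: scaleC_of_real)

lemma sqrt_iter_clin: "bounded_clinear X \<Longrightarrow> bounded_clinear (sqrt_iter X n)"
  by (induction n) (auto intro!: half_scaleR_clin clin_add_op clin_zero_op clin_comp[of "sqrt_iter X _" "sqrt_iter X _"])

lemma sqrt_iter_selfadjoint:
  assumes "bounded_clinear X" "\<And>x y. cinner (X x) y = cinner x (X y)"
  shows "cinner (sqrt_iter X n x) y = cinner x (sqrt_iter X n y)"
  by (induction n arbitrary: x y)
    (auto simp: cinner_scaleR_left cinner_scaleR_right cinner_simps assms)

text \<open>Serves twice: with \<open>X' = X\<close> it makes any square root of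
  \<open>I - X\<close> commute with the limit, hence uniqueness; with two different operators it
  carries the row operator past the two defect operators.\<close>

lemma sqrt_iter_intertwine:
  assumes "bounded_clinear Z" "\<And>x. Z (X x) = X' (Z x)"
  shows "Z (sqrt_iter X n x) = sqrt_iter X' n (Z x)"
  by (induction n arbitrary: x) (auto simp: clin_simps[OF assms(1)] assms(2))

lemma sqrt_iter_norm:
  assumes "bounded_clinear X" "\<And>x. norm (X x) \<le> norm x"
  shows "norm (sqrt_iter X n x) \<le> sqrt_bound n * norm x"
proof (induction n arbitrary: x)
  case (Suc n)
  have "norm (sqrt_iter X n (sqrt_iter X n x)) \<le> sqrt_bound n * (sqrt_bound n * norm x)"
    by (rule order_trans[OF Suc mult_left_mono[OF Suc]]) (use sqrt_bound_range in auto)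
  then have "norm (X x + sqrt_iter X n (sqrt_iter X n x)) \<le> norm x + sqrt_bound n * (sqrt_bound n * norm x)"
    using assms(2)[of x] norm_triangle_ineq[of "X x"] by (smt (verit))
  then show ?case by (simp add: power2_eq_square distrib_right del: scaleR_add_right)
qed simp

lemma sqrt_iter_step:
  assumes X: "bounded_clinear X" "\<And>x. norm (X x) \<le> norm x"
  shows "norm (sqrt_iter X (Suc n) x - sqrt_iter X n x) \<le> (sqrt_bound (Suc n) - sqrt_bound n) * norm x"
proof (induction n arbitrary: x)
  case 0
  then show ?case using X(2)[of x] by simp
next
  case (Suc n)
  define A where "A = sqrt_iter X (Suc n)"
  define B where "B = sqrt_iter X n"
  define a where "a = sqrt_bound (Suc n)"
  define b where "b = sqrt_bound n"
  have ab: "0 \<le> a" "0 \<le> b" "b \<le> a"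
    using sqrt_bound_range sqrt_bound_mono unfolding a_def b_def by blast+
  have IH: "norm (A y - B y) \<le> (a - b) * norm y" for y
    using Suc unfolding A_def B_def a_def b_def .
  have Ac: "bounded_clinear A" unfolding A_def by (rule sqrt_iter_clin[OF X(1)])
  have An: "norm (A y) \<le> a * norm y" and Bn: "norm (B y) \<le> b * norm y" for y
    unfolding A_def B_def a_def b_def by (rule sqrt_iter_norm[OF X])+
  have "sqrt_iter X (Suc (Suc n)) x - sqrt_iter X (Suc n) x
      = (1/2) *\<^sub>R (X x + A (A x)) - (1/2) *\<^sub>R (X x + B (B x))"
    unfolding sqrt_iter.simps(2) A_def B_def ..
  \<comment> \<open>The splitting mirrors
    \<open>a\<^sup>2 - b\<^sup>2 = a * (a - b) + (a - b) * b\<close> in the scalar iteration, so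
    scalar increments dominate the operator increments.\<close>
  also have "\<dots> = (1/2) *\<^sub>R (A (A x - B x) + (A (B x) - B (B x)))"
    unfolding clin_diff[OF Ac] by (simp add: algebra_simps)
  also have "norm \<dots> \<le> (1/2) * (a * ((a - b) * norm x) + (a - b) * (b * norm x))"
  proof -
    have "norm (A (A x - B x)) \<le> a * ((a - b) * norm x)"
      by (rule order_trans[OF An mult_left_mono[OF IH ab(1)]])
    moreover have "norm (A (B x) - B (B x)) \<le> (a - b) * (b * norm x)"
      by (rule order_trans[OF IH mult_left_mono[OF Bn]]) (use ab in simp)
    ultimately have "norm (A (A x - B x) + (A (B x) - B (B x))) \<le> a * ((a - b) * norm x) + (a - b) * (b * norm x)"
      using norm_triangle_ineq[of "A (A x - B x)" "A (B x) - B (B x)"] by linarith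
    then show ?thesis unfolding norm_scaleR by simp
  qed
  also have "\<dots> = ((1 + a\<^sup>2) / 2 - (1 + b\<^sup>2) / 2) * norm x"
    by (simp add: field_simps power2_eq_square)
  also have "\<dots> = (sqrt_bound (Suc (Suc n)) - sqrt_bound (Suc n)) * norm x"
    unfolding sqrt_bound.simps(2) a_def b_def ..
  finally show ?case .
qed

lemma sqrt_iter_convergent:
  assumes X: "bounded_clinear X" "\<And>x. norm (X x) \<le> norm x"
  shows "\<exists>y. (\<lambda>n. sqrt_iter X n x) \<longlonglongrightarrow> y"
proof -
  let ?Y = "sqrt_iter X" and ?a = "sqrt_bound"
  have d: "norm (?Y (n + k) x - ?Y n x) \<le> (?a (n + k) - ?a n) * norm x" for n k
  proof (induction k)
    case (Suc k)
    have "norm (?Y (n + Suc k) x - ?Y n x)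
        \<le> norm (?Y (Suc (n + k)) x - ?Y (n + k) x) + norm (?Y (n + k) x - ?Y n x)"
      using norm_triangle_ineq[of "?Y (Suc (n + k)) x - ?Y (n + k) x" "?Y (n + k) x - ?Y n x"]
      by (simp del: sqrt_iter.simps)
    also have "\<dots> \<le> (?a (Suc (n + k)) - ?a (n + k)) * norm x + (?a (n + k) - ?a n) * norm x"
      by (rule add_mono[OF sqrt_iter_step[OF X] Suc])
    finally show ?case by (simp add: algebra_simps)
  qed simp
  have "Cauchy (\<lambda>n. ?Y n x)"
  proof (rule metric_CauchyI)
    fix e :: real assume e: "0 < e"
    obtain M where M: "\<And>m n. m \<ge> M \<Longrightarrow> n \<ge> M \<Longrightarrow> dist (?a m) (?a n) < e / (norm x + 1)"
      using metric_CauchyD[OF sqrt_bound_convergent, of "e / (norm x + 1)"] e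
      by (metis add_nonneg_pos divide_pos_pos norm_ge_zero zero_less_one)
    have le: "dist (?Y m x) (?Y n x) < e" if "n \<ge> M" "n \<le> m" for m n
    proof -
      obtain k where k: "m = n + k" using le_Suc_ex \<open>n \<le> m\<close> by blast
      have "dist (?Y m x) (?Y n x) \<le> \<bar>?a m - ?a n\<bar> * norm x"
        using d[of n k] unfolding dist_norm k by (smt (verit) mult_right_mono norm_ge_zero)
      also have "\<dots> \<le> (e / (norm x + 1)) * norm x"
        using M[of m n] that by (intro mult_right_mono) (auto simp: dist_real_def)
      also have "\<dots> < e"
      proof -
        have "norm x < norm x + 1" by simp
        then show ?thesis using e by (simp add: pos_divide_less_eq add_nonneg_pos)
      qed
      finally show ?thesis .
    qed
    show "\<exists>M. \<forall>m\<ge>M. \<forall>n\<ge>M. dist (?Y m x) (?Y n x) < e"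
      by (rule exI[of _ M]) (metis dist_commute le nle_le)
  qed
  then show ?thesis by (auto simp: Cauchy_convergent_iff convergent_def)
qed

text \<open>The limit \<open>Y\<close> of the iteration is a self-adjoint contraction, so
  \<open>R = I - Y\<close> is positive, and the fixed point equation makes it a square root. As
  \<open>sqrt_op\<close> is a \<open>THE\<close>, uniqueness has to be shown too. The third claim
  keeps the approximation available for intertwining.\<close>

lemma sqrt_op_contraction:
  assumes X: "bounded_clinear X" "\<And>x. norm (X x) \<le> norm x" "\<And>x y. cinner (X x) y = cinner x (X y)"
  defines "S \<equiv> sqrt_op (\<lambda>x. x - X x)"
  shows "positive_op S" "S (S x) = x - X x" "(\<lambda>n. sqrt_iter X n x) \<longlonglongrightarrow> x - S x"
proof -
  obtain Y where Y: "\<And>x. (\<lambda>n. sqrt_iter X n x) \<longlonglongrightarrow> Y x"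
    using sqrt_iter_convergent[OF X(1,2)] by metis
  note clin = sqrt_iter_clin[OF X(1)]
  have contr: "norm (sqrt_iter X n x) \<le> norm x" for n x
    by (rule order_trans[OF sqrt_iter_norm[OF X(1,2)] mult_left_le_one_le]) (use sqrt_bound_range in auto)
  have Yn: "norm (Y x) \<le> norm x" for x
    by (rule tendsto_upperbound[OF tendsto_norm[OF Y]]) (auto simp: contr)
  have Yc: "bounded_clinear Y"
  proof (rule bounded_clinearI[of _ 1])
    show "Y (x + y) = Y x + Y y" for x y
      by (rule LIMSEQ_unique[OF Y]) (use tendsto_add[OF Y Y] in \<open>simp add: clin_simps[OF clin]\<close>)
    show "Y (c *\<^sub>C x) = c *\<^sub>C Y x" for x c
      by (rule LIMSEQ_unique[OF Y])
        (use clin_tendsto[OF clin_scale_op[OF clin_id] Y] in \<open>simp add: clin_simps[OF clin]\<close>)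
  qed (simp add: Yn)
  have YY: "(\<lambda>n. sqrt_iter X n (sqrt_iter X n x)) \<longlonglongrightarrow> Y (Y x)" for x
  proof -
    \<comment> \<open>Operator and argument both vary with \<open>n\<close>; since the iterates are
      contractions, the argument may be replaced by its limit first.\<close>
    have "(\<lambda>n. sqrt_iter X n (sqrt_iter X n x - Y x)) \<longlonglongrightarrow> 0"
    proof (rule Lim_null_comparison)
      show "\<forall>\<^sub>F n in sequentially. norm (sqrt_iter X n (sqrt_iter X n x - Y x)) \<le> norm (sqrt_iter X n x - Y x)"
        by (simp add: contr)
      show "(\<lambda>n. norm (sqrt_iter X n x - Y x)) \<longlonglongrightarrow> 0"
        using Y[of x] by (simp add: LIM_zero_iff tendsto_norm_zero_iff)
    qed
    from tendsto_add[OF this Y[of "Y x"]] show ?thesis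
      by (simp add: clin_simps[OF clin])
  qed
  have fixpt: "Y x = (1/2) *\<^sub>R (X x + Y (Y x))" for x
  proof (rule LIMSEQ_unique[OF LIMSEQ_Suc[OF Y]])
    show "(\<lambda>n. sqrt_iter X (Suc n) x) \<longlonglongrightarrow> (1/2) *\<^sub>R (X x + Y (Y x))"
      using tendsto_scaleR[OF tendsto_const tendsto_add[OF tendsto_const YY]] by simp
  qed
  define R where "R = (\<lambda>x. x - Y x)"
  have Ysa: "cinner (Y x) y = cinner x (Y y)" for x y
    by (rule LIMSEQ_unique[OF tendsto_cinner[OF Y tendsto_const]])
      (use tendsto_cinner[OF tendsto_const Y] in \<open>simp add: sqrt_iter_selfadjoint[OF X(1,3)]\<close>)
  have Rc: "bounded_clinear R" unfolding R_def by (intro clin_intros Yc)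
  have R2: "R (R x) = x - X x" for x
  proof -
    have "2 *\<^sub>R Y x = X x + Y (Y x)" by (subst fixpt) simp
    then show ?thesis by (simp add: R_def clin_simps[OF Yc] scaleR_2 algebra_simps)
  qed
  have Rpos: "positive_op R"
    unfolding positive_op_def
  proof (intro conjI allI Rc)
    fix x
    have "cinner (Y x) x \<in> \<real>"
      unfolding Reals_cnj_iff using Ysa[of x x] cinner_commute[of x "Y x"] by simp
    then have real: "cinner (Y x) x = of_real (Re (cinner (Y x) x))"
      by simp
    have "Re (cinner (Y x) x) \<le> cmod (cinner (Y x) x)" by (rule complex_Re_le_cmod)
    also have "\<dots> \<le> norm x * norm x"
      by (rule order_trans[OF norm_cinner_le mult_right_mono[OF Yn]]) simp
    finally have "0 \<le> (norm x)\<^sup>2 - Re (cinner (Y x) x)" by (simp add: power2_eq_square)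
    moreover have "cinner (R x) x = of_real ((norm x)\<^sup>2 - Re (cinner (Y x) x))"
      by (subst of_real_diff, subst real[symmetric]) (simp add: R_def cinner_simps cinner_same)
    ultimately show "cinner (R x) x \<in> \<real>\<^sub>\<ge>\<^sub>0"
      by (metis nonneg_Reals_of_real_iff)
  qed
  have "S = R"
    unfolding S_def sqrt_op_def
  proof (rule the_equality)
    show "positive_op R \<and> R \<circ> R = (\<lambda>x. x - X x)" using Rpos R2 by auto
    fix B assume B: "positive_op B \<and> B \<circ> B = (\<lambda>x. x - X x)"
    then have Bc: "bounded_clinear B" and B2: "\<And>x. B (B x) = x - X x"
      by (auto simp: positive_op_def fun_eq_iff)
    have "B (X x) = X (B x)" for x
    proof -
      have "B (x - X x) = B x - X (B x)" by (simp flip: B2)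
      then show ?thesis by (simp add: clin_simps[OF Bc])
    qed
    then have "B (sqrt_iter X n x) = sqrt_iter X n (B x)" for n x
      by (rule sqrt_iter_intertwine[of B X X, OF Bc])
    then have "B (Y x) = Y (B x)" for x
      using LIMSEQ_unique[OF clin_tendsto[OF Bc Y[of x]]] Y[of "B x"] by simp
    then have comm: "B (R x) = R (B x)" for x by (simp add: R_def clin_simps[OF Bc])
    show "B = R"
    proof
      fix x
      \<comment> \<open>\<open>B\<close> commutes with \<open>R\<close> and has the same square, so
        \<open>R + B\<close> annihilates \<open>y\<close>. Two nonnegative forms with sum zero
        vanish separately, and \<open>R y = B y = 0\<close> forces \<open>y = 0\<close>.\<close>
      define y where "y = R x - B x"
      have "R y + B y = 0"
        unfolding y_def by (simp add: clin_simps[OF Bc] clin_simps[OF Rc] R2 B2 comm)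
      then have "cinner (R y) y + cinner (B y) y = 0"
        by (metis cinner_add_left cinner_zero_left)
      moreover have "cinner (R y) y \<in> \<real>\<^sub>\<ge>\<^sub>0" "cinner (B y) y \<in> \<real>\<^sub>\<ge>\<^sub>0"
        using Rpos B by (auto simp: positive_op_def)
      ultimately have "cinner (R y) y = 0 \<and> cinner (B y) y = 0"
        by (auto elim!: nonneg_Reals_cases simp: complex_eq_iff)
      then have "R y = 0" "B y = 0" using positive_op_null Rpos B by blast+
      moreover have "cinner y y = cinner x (R y) - cinner x (B y)"
        unfolding positive_op_selfadjoint[OF Rpos, of x y, symmetric]
          positive_op_selfadjoint[OF conjunct1[OF B], of x y, symmetric]
          cinner_diff_left[symmetric] y_def[symmetric] ..
      ultimately have "cinner y y = 0" by simp
      then show "B x = R x" by (simp add: cinner_same y_def)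
    qed
  qed
  then show "positive_op S" "S (S x) = x - X x" "(\<lambda>n. sqrt_iter X n x) \<longlonglongrightarrow> x - S x"
    using Rpos R2 Y by (auto simp: R_def)
qed

lemma sqrt_op_intertwine:
  assumes X: "bounded_clinear X" "\<And>x. norm (X x) \<le> norm x" "\<And>x y. cinner (X x) y = cinner x (X y)"
    and X': "bounded_clinear X'" "\<And>x. norm (X' x) \<le> norm x" "\<And>x y. cinner (X' x) y = cinner x (X' y)"
    and Z: "bounded_clinear Z" "\<And>x. Z (X x) = X' (Z x)"
  shows "Z (sqrt_op (\<lambda>x. x - X x) x) = sqrt_op (\<lambda>x. x - X' x) (Z x)"
proof -
  have "(\<lambda>n. Z (sqrt_iter X n x)) \<longlonglongrightarrow> Z (x - sqrt_op (\<lambda>x. x - X x) x)"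
    by (rule clin_tendsto[OF Z(1) sqrt_op_contraction(3)[OF X]])
  then have "Z (x - sqrt_op (\<lambda>x. x - X x) x) = Z x - sqrt_op (\<lambda>x. x - X' x) (Z x)"
    using sqrt_op_contraction(3)[OF X', of "Z x"]
    by (simp add: sqrt_iter_intertwine[of Z X X', OF Z] LIMSEQ_unique)
  then show ?thesis by (simp add: clin_simps[OF Z(1)])
qed


section \<open>Vector-valued square-summable families\<close>

lemma ell2_eqI: "(\<And>i. ell2_nth x i = ell2_nth y i) \<Longrightarrow> x = y"
  using ell2_nth_inject by blast

lemmas ell2_nth_simps [simp] = zero_ell2.rep_eq plus_ell2.rep_eq minus_ell2.rep_eq uminus_ell2.rep_eq
  scaleC_ell2.rep_eq scaleR_ell2.rep_eq

lemma ell2_nth_clin: "bounded_clinear (\<lambda>x. ell2_nth x i)"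
  by (rule bounded_clinearI[of _ 1]) (auto simp: norm_ell2_nth_le)

lemma ell2_nth_sum [simp]: "ell2_nth (\<Sum>a\<in>F. f a) i = (\<Sum>a\<in>F. ell2_nth (f a) i)"
  by (rule clin_sum[OF ell2_nth_clin])

lemma ell2_norm_le:
  assumes "\<And>F. finite F \<Longrightarrow> L2_set (\<lambda>i. norm (ell2_nth x i)) F \<le> C"
  shows "norm x \<le> C"
  unfolding norm_ell2.rep_eq by (rule ell2_bound(2)[OF assms])

lemma L2_set_le_norm: "finite F \<Longrightarrow> L2_set (\<lambda>i. norm (ell2_nth x i)) F \<le> norm x"
  unfolding norm_ell2.rep_eq using ell2_nth by (intro L2_set_le_ell2) auto

lemma cinner_ell2_has_sum: "((\<lambda>i. cinner (ell2_nth x i) (ell2_nth y i)) has_sum cinner x y) UNIV"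
  unfolding cinner_ell2.rep_eq using ell2_nth[of x] ell2_nth[of y]
  by (intro has_sum_infsum ell2_cinner_summable) auto

lemma norm_sq_ell2_has_sum: "((\<lambda>i. (norm (ell2_nth x i))\<^sup>2) has_sum (norm x)\<^sup>2) UNIV"
proof -
  have "((\<lambda>i. (norm (ell2_nth x i))\<^sup>2) has_sum (\<Sum>\<^sub>\<infinity>i. (norm (ell2_nth x i))\<^sup>2)) UNIV"
    using ell2_nth[of x] by (intro has_sum_infsum) auto
  then show ?thesis by (simp add: norm_ell2.rep_eq infsum_nonneg)
qed

lemma
  fixes \<phi> \<psi> :: "('i, complex) ell2" and h k :: "'a::complex_hilbert"
  shows tensor_clin_left: "bounded_clinear (\<lambda>\<phi> :: ('i, complex) ell2. \<phi> \<otimes> h)"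
  and cinner_tensor: "cinner (\<phi> \<otimes> h) (\<psi> \<otimes> k) = cinner \<phi> \<psi> * cinner h k"
proof -
  show c: "cinner (\<phi> \<otimes> h) (\<psi> \<otimes> k) = cinner \<phi> \<psi> * cinner h k" for \<phi> \<psi> :: "('i, complex) ell2" and h k :: 'a
    by transfer (simp add: cinner_simps cinner_complex_def mult_ac flip: infsum_cmult_right')
  have n: "norm (\<phi> \<otimes> h) = norm \<phi> * norm h" for \<phi> :: "('i, complex) ell2" and h :: 'a
  proof -
    have "complex_of_real ((norm (\<phi> \<otimes> h))\<^sup>2) = of_real ((norm \<phi> * norm h)\<^sup>2)"
      unfolding cinner_same[symmetric] c by (simp add: cinner_same power_mult_distrib)
    then show ?thesis unfolding of_real_eq_iff by simp
  qed
  show "bounded_clinear (\<lambda>\<phi> :: ('i, complex) ell2. \<phi> \<otimes> h)"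
    by (rule bounded_clinearI[of _ "norm h"])
      (auto intro!: ell2_eqI simp: tensor.rep_eq scaleC_add_left scaleC_scaleC scaleC_complex_def n)
qed

lemma ket_tensor_nth: "ell2_nth (ket i \<otimes> h) j = (if j = i then h else 0)"
  by (simp add: tensor.rep_eq ket.rep_eq scaleC_one)

lemma cinner_ket_tensor: "cinner x (ket i \<otimes> h) = cinner (ell2_nth x i) h"
proof -
  have "cinner x (ket i \<otimes> h) = (\<Sum>\<^sub>\<infinity>j. cinner (ell2_nth x j) (if j = i then h else 0))"
    by (simp add: cinner_ell2.rep_eq ket_tensor_nth)
  also have "\<dots> = (\<Sum>\<^sub>\<infinity>j\<in>{i}. cinner (ell2_nth x j) (if j = i then h else 0))"
    by (rule infsum_cong_neutral) auto
  finally show ?thesis by simp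
qed

text \<open>A vector orthogonal to all \<open>ket i \<otimes> h\<close> has zero coordinates.
  Identities of bounded operators thereby reduce to elementary tensors with basis vectors.\<close>

lemma ell2_dense:
  assumes "closed_csubspace M" "\<And>i h. ket i \<otimes> h \<in> M"
  shows "M = (UNIV :: ('i, 'a::complex_hilbert) ell2 set)"
proof (rule closed_csubspace_eq_UNIV[OF assms(1)])
  fix x :: "('i, 'a) ell2" assume x: "\<And>y. y \<in> M \<Longrightarrow> cinner x y = 0"
  show "x = 0"
  proof (rule ell2_eqI)
    fix i
    have "cinner (ell2_nth x i) (ell2_nth x i) = 0"
      using x[OF assms(2), of i "ell2_nth x i"] by (simp add: cinner_ket_tensor)
    then show "ell2_nth x i = ell2_nth 0 i" by (simp add: cinner_same)
  qed
qed

lemma clin_eq_on_kets: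
  fixes A B :: "('i, 'a::complex_hilbert) ell2 \<Rightarrow> 'b::complex_hilbert"
  assumes "bounded_clinear A" "bounded_clinear B" "\<And>i h. A (ket i \<otimes> h) = B (ket i \<otimes> h)"
  shows "A x = B x"
proof -
  have "{x. \<forall>i\<in>{()}. A x - B x = 0} = UNIV"
    by (rule ell2_dense[OF closed_csubspace_zero_set]) (auto intro: clin_intros assms simp: assms(3))
  then have "x \<in> {x. \<forall>i\<in>{()}. A x - B x = 0}" by blast
  then show ?thesis by simp
qed

lemma tensor_opI:
  assumes "bounded_clinear C" "\<And>\<phi> h. C (\<phi> \<otimes> h) = A \<phi> \<otimes> B h"
  shows "A \<otimes>\<^sub>O B = C"
  unfolding tensor_op_def
proof (rule the_equality)
  show "bounded_clinear C \<and> (\<forall>\<phi> h. C (\<phi> \<otimes> h) = A \<phi> \<otimes> B h)" using assms by blast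
  fix C' assume C': "bounded_clinear C' \<and> (\<forall>\<phi> h. C' (\<phi> \<otimes> h) = A \<phi> \<otimes> B h)"
  show "C' = C"
  proof
    show "C' x = C x" for x
      by (rule clin_eq_on_kets) (use C' assms in auto)
  qed
qed

text \<open>The uniform norm bound makes the set of convergence a closed subspace. Truncation by
  length and radial damping both converge strongly for this reason.\<close>

lemma tendsto_on_kets:
  fixes A :: "'t \<Rightarrow> ('i, 'a::complex_hilbert) ell2 \<Rightarrow> 'b::complex_hilbert"
  assumes F: "\<forall>\<^sub>F t in F. bounded_clinear (A t) \<and> (\<forall>x. norm (A t x) \<le> norm x)"
    and B: "bounded_clinear B"
    and lim: "\<And>i h. ((\<lambda>t. A t (ket i \<otimes> h)) \<longlongrightarrow> B (ket i \<otimes> h)) F"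
  shows "((\<lambda>t. A t x) \<longlongrightarrow> B x) F"
proof -
  define M where "M = {x. ((\<lambda>t. A t x) \<longlongrightarrow> B x) F}"
  have ev: "\<forall>\<^sub>F t in F. P (A t)" if "\<And>C. bounded_clinear C \<Longrightarrow> \<forall>x. norm (C x) \<le> norm x \<Longrightarrow> P C" for P
    using F by (rule eventually_mono) (use that in blast)
  have "M = UNIV"
  proof (rule ell2_dense)
    show "closed_csubspace M"
    proof (rule closed_csubspaceI)
      show "0 \<in> M"
        unfolding M_def mem_Collect_eq clin_zero[OF B]
        by (rule tendsto_eventually, rule ev) (rule clin_zero)
      show "x + y \<in> M" if "x \<in> M" "y \<in> M" for x y
      proof -
        have "((\<lambda>t. A t x + A t y) \<longlongrightarrow> B (x + y)) F"
          using that unfolding M_def mem_Collect_eq clin_add[OF B] by (intro tendsto_add)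
        moreover have "\<forall>\<^sub>F t in F. A t x + A t y = A t (x + y)"
          by (rule ev) (rule clin_add[symmetric])
        ultimately show ?thesis unfolding M_def mem_Collect_eq by (rule Lim_transform_eventually)
      qed
      show "c *\<^sub>C x \<in> M" if "x \<in> M" for c x
      proof -
        have "((\<lambda>t. c *\<^sub>C A t x) \<longlongrightarrow> B (c *\<^sub>C x)) F"
          using that unfolding M_def mem_Collect_eq clin_scaleC[OF B]
          by (rule clin_tendsto[OF clin_scale_op[OF clin_id]])
        moreover have "\<forall>\<^sub>F t in F. c *\<^sub>C A t x = A t (c *\<^sub>C x)"
          by (rule ev) (rule clin_scaleC[symmetric])
        ultimately show ?thesis unfolding M_def mem_Collect_eq by (rule Lim_transform_eventually)
      qed
      show "closed M"
        unfolding closed_sequential_limits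
      proof (intro allI impI, elim conjE)
        fix f l assume f: "\<forall>n. f n \<in> M" "f \<longlonglongrightarrow> l"
        obtain K where K: "K \<ge> 0" "\<And>x. norm (B x) \<le> norm x * K" using clin_bound[OF B] by blast
        show "l \<in> M"
          unfolding M_def mem_Collect_eq tendsto_iff
        proof (intro allI impI)
          fix e :: real assume e: "0 < e"
          \<comment> \<open>Three errors must add up to \<open>e\<close>: \<open>d\<close> for
            changing the argument under \<open>A t\<close>, \<open>d\<close> for the convergence at
            \<open>f n\<close>, and \<open>d * K\<close> for changing the argument under
            \<open>B\<close>.\<close>
          define d where "d = e / (2 + K)"
          have "d * (2 + K) = e" using K(1) by (simp add: d_def)
          moreover have "d > 0" using e K(1) by (simp add: d_def)
          ultimately have d: "d > 0" "d + d + d * K = e" by (simp_all add: distrib_left)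
          obtain n where n: "dist (f n) l < d"
            using f(2) d(1) by (metis LIMSEQ_iff_nz dist_norm lim_sequentially order_refl)
          have "\<forall>\<^sub>F t in F. dist (A t (f n)) (B (f n)) < d"
            using f(1) d(1) unfolding M_def mem_Collect_eq tendsto_iff by blast
          moreover have "\<forall>\<^sub>F t in F. dist (A t l) (A t (f n)) < d"
            by (rule ev) (metis clin_diff dist_norm dist_commute le_less_trans n)
          ultimately show "\<forall>\<^sub>F t in F. dist (A t l) (B l) < e"
          proof eventually_elim
            case (elim t)
            have "dist (B (f n)) (B l) \<le> dist (f n) l * K"
              using K(2)[of "f n - l"] by (simp add: dist_norm clin_diff[OF B])
            also have "\<dots> \<le> d * K" using n K by (intro mult_right_mono) auto
            finally show ?case
              using elim dist_triangle[of "A t l" "B l" "A t (f n)"]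
                dist_triangle[of "A t (f n)" "B l" "B (f n)"] d(2) by linarith
          qed
        qed
      qed
    qed
  qed (simp add: M_def lim)
  then show ?thesis unfolding M_def by blast
qed


subsection \<open>Amplified, shifted and diagonal operators\<close>

text \<open>The guards in the definitions of \<open>ell2_map\<close>, \<open>ell2_push\<close> and \<open>ell2_diag\<close> only ensure
  square-summability; where they fail, the coordinate takes the junk value \<open>0\<close>.\<close>

lift_definition ell2_map :: "('a::complex_hilbert \<Rightarrow> 'b::complex_hilbert) \<Rightarrow> ('i, 'a) ell2 \<Rightarrow> ('i, 'b) ell2"
  is "\<lambda>B f i. if bounded_clinear B then B (f i) else 0"
proof -
  fix B :: "'a \<Rightarrow> 'b" and f :: "'i \<Rightarrow> 'a" assume f: "(\<lambda>i. (norm (f i))\<^sup>2) summable_on UNIV"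
  show "(\<lambda>i. (norm (if bounded_clinear B then B (f i) else 0))\<^sup>2) summable_on UNIV"
  proof (cases "bounded_clinear B")
    case True
    obtain K where K: "K \<ge> 0" "\<And>x. norm (B x) \<le> norm x * K" using clin_bound[OF True] by blast
    have "(\<lambda>i. (norm (B (f i)))\<^sup>2) summable_on UNIV"
    proof (rule summable_on_comparison_test)
      show "(\<lambda>i. (norm (f i))\<^sup>2 * K\<^sup>2) summable_on UNIV" by (rule summable_on_cmult_left[OF f])
      show "(norm (B (f i)))\<^sup>2 \<le> (norm (f i))\<^sup>2 * K\<^sup>2" for i
        using power_mono[OF K(2)[of "f i"], of 2] by (simp add: power_mult_distrib)
    qed auto
    then show ?thesis using True by simp
  qed simp
qed

lemma ell2_map_nth: "bounded_clinear B \<Longrightarrow> ell2_nth (ell2_map B x) i = B (ell2_nth x i)"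
  by (simp add: ell2_map.rep_eq)

lemma ell2_map_norm_le:
  fixes x :: "('i, 'a::complex_hilbert) ell2"
  assumes B: "bounded_clinear B" and K: "K \<ge> 0" "\<And>x. norm (B x) \<le> norm x * K"
  shows "norm (ell2_map B x) \<le> norm x * K"
proof (rule ell2_norm_le)
  fix F :: "'i set" assume F: "finite F"
  have "L2_set (\<lambda>i. norm (ell2_nth (ell2_map B x) i)) F \<le> L2_set (\<lambda>i. norm (ell2_nth x i) * K) F"
    by (rule L2_set_mono) (auto simp: ell2_map_nth[OF B] K)
  also have "\<dots> = L2_set (\<lambda>i. norm (ell2_nth x i)) F * K"
    by (rule L2_set_left_distrib[symmetric, OF K(1)])
  also have "\<dots> \<le> norm x * K" by (rule mult_right_mono[OF L2_set_le_norm[OF F] K(1)])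
  finally show "L2_set (\<lambda>i. norm (ell2_nth (ell2_map B x) i)) F \<le> norm x * K" .
qed

lemma ell2_map_clin:
  assumes B: "bounded_clinear B"
  shows "bounded_clinear (ell2_map B)"
proof -
  obtain K where K: "K \<ge> 0" "\<And>x. norm (B x) \<le> norm x * K" using clin_bound[OF B] by blast
  show ?thesis
    by (rule bounded_clinearI[of _ K])
      (auto intro!: ell2_eqI ell2_map_norm_le K B simp: ell2_map_nth[OF B] clin_simps[OF B])
qed

lemma ell2_map_comp:
  assumes "bounded_clinear A" "bounded_clinear B"
  shows "ell2_map A (ell2_map B x) = ell2_map (\<lambda>h. A (B h)) x"
  by (rule ell2_eqI) (simp add: assms ell2_map_nth clin_comp)

lemma ell2_map_tensor: "bounded_clinear B \<Longrightarrow> ell2_map B (\<phi> \<otimes> h) = \<phi> \<otimes> B h"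
  by (rule ell2_eqI) (simp add: tensor.rep_eq ell2_map_nth clin_scaleC)

lemma tensor_op_amplify:
  assumes "bounded_clinear A'" "bounded_clinear B" "\<And>\<phi> h. A' (\<phi> \<otimes> h) = A \<phi> \<otimes> h"
  shows "A \<otimes>\<^sub>O B = (\<lambda>x. A' (ell2_map B x))"
  by (rule tensor_opI) (auto intro: clin_comp ell2_map_clin assms simp: ell2_map_tensor assms)

lift_definition ell2_push :: "('i \<Rightarrow> 'j) \<Rightarrow> ('i, 'a::complex_hilbert) ell2 \<Rightarrow> ('j, 'a) ell2"
  is "\<lambda>h f j. if inj h \<and> j \<in> range h then f (inv h j) else 0"
proof -
  fix h :: "'i \<Rightarrow> 'j" and f :: "'i \<Rightarrow> 'a" assume f: "(\<lambda>i. (norm (f i))\<^sup>2) summable_on UNIV"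
  show "(\<lambda>j. (norm (if inj h \<and> j \<in> range h then f (inv h j) else 0))\<^sup>2) summable_on UNIV" (is "?g summable_on _")
  proof (cases "inj h")
    case True
    have "?g summable_on range h"
      using f True by (simp add: summable_on_reindex[OF True] comp_def)
    then show ?thesis
      by (rule summable_on_cong_neutral[THEN iffD1, rotated -1]) auto
  qed simp
qed

lemma ell2_push_nth: "inj h \<Longrightarrow> ell2_nth (ell2_push h x) (h i) = ell2_nth x i"
  and ell2_push_nth_out: "j \<notin> range h \<Longrightarrow> ell2_nth (ell2_push h x) j = 0"
  by (auto simp: ell2_push.rep_eq)

lemma ell2_push_cinner:
  assumes "inj h"
  shows "((\<lambda>i. cinner (ell2_nth x i) (ell2_nth y (h i))) has_sum cinner (ell2_push h x) y) UNIV"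
proof -
  have "((\<lambda>j. cinner (ell2_nth (ell2_push h x) j) (ell2_nth y j)) has_sum cinner (ell2_push h x) y) (range h)"
    using cinner_ell2_has_sum[of "ell2_push h x" y]
    by (rule has_sum_cong_neutral[THEN iffD1, rotated -1]) (auto simp: ell2_push_nth_out)
  then show ?thesis
    by (simp add: has_sum_reindex[OF assms] comp_def ell2_push_nth[OF assms])
qed

lemma ell2_push_isometry:
  assumes "inj h"
  shows "cinner (ell2_push h x) (ell2_push h y) = cinner x y" "norm (ell2_push h x) = norm x"
proof -
  show i: "cinner (ell2_push h x) (ell2_push h y) = cinner x y" for x y
    using ell2_push_cinner[OF assms, of x "ell2_push h y"] cinner_ell2_has_sum[of x y]
    by (simp add: ell2_push_nth[OF assms] has_sum_unique)
  show "norm (ell2_push h x) = norm x" by (rule norm_eq_of_cinner[OF i])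
qed

lemma ell2_push_clin:
  assumes "inj h"
  shows "bounded_clinear (ell2_push h)"
  by (rule bounded_clinearI[of _ 1])
    (auto intro!: ell2_eqI simp: ell2_push.rep_eq ell2_push_isometry[OF assms])

lemma ell2_push_map: "bounded_clinear B \<Longrightarrow> ell2_push h (ell2_map B x) = ell2_map B (ell2_push h x)"
  by (rule ell2_eqI) (simp add: ell2_push.rep_eq ell2_map_nth clin_zero)

lift_definition ell2_diag :: "('i \<Rightarrow> real) \<Rightarrow> ('i, 'a::complex_hilbert) ell2 \<Rightarrow> ('i, 'a) ell2"
  is "\<lambda>c f i. if \<bar>c i\<bar> \<le> 1 then c i *\<^sub>R f i else 0"
  by (rule summable_on_comparison_test, assumption)
    (auto simp: power_mult_distrib mult_left_le_one_le abs_square_le_1)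

lemma ell2_diag_nth: "\<bar>c i\<bar> \<le> 1 \<Longrightarrow> ell2_nth (ell2_diag c x) i = c i *\<^sub>R ell2_nth x i"
  by (simp add: ell2_diag.rep_eq)

lemma ell2_diag_norm_le: "norm (ell2_diag c x) \<le> norm x"
proof (rule ell2_norm_le)
  fix F :: "'a set" assume F: "finite F"
  have "L2_set (\<lambda>i. norm (ell2_nth (ell2_diag c x) i)) F \<le> L2_set (\<lambda>i. norm (ell2_nth x i)) F"
    by (rule L2_set_mono) (auto simp: ell2_diag.rep_eq mult_left_le_one_le)
  then show "L2_set (\<lambda>i. norm (ell2_nth (ell2_diag c x) i)) F \<le> norm x"
    using L2_set_le_norm[OF F, of x] by linarith
qed

lemma ell2_diag_clin: "bounded_clinear (ell2_diag c)"
  by (rule bounded_clinearI[of _ 1])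
    (auto intro!: ell2_eqI simp: ell2_diag_norm_le ell2_diag.rep_eq algebra_simps simp flip: scaleC_of_real
      simp: scaleC_scaleC mult.commute)

lemma ell2_diag_ket: "ell2_diag c (ket i \<otimes> h) = (if \<bar>c i\<bar> \<le> 1 then c i *\<^sub>R (ket i \<otimes> h) else 0)"
  by (rule ell2_eqI) (auto simp: ell2_diag.rep_eq ket_tensor_nth)

lemma ell2_diag_tendsto:
  assumes c: "\<And>i. ((\<lambda>t. c t i) \<longlongrightarrow> 1) F" and b: "\<And>i. \<forall>\<^sub>F t in F. \<bar>c t i\<bar> \<le> 1"
  shows "((\<lambda>t. ell2_diag (c t) x) \<longlongrightarrow> x) F"
proof (rule tendsto_on_kets[where B="\<lambda>x. x"])
  fix i h
  have "((\<lambda>t. c t i *\<^sub>R (ket i \<otimes> h)) \<longlongrightarrow> 1 *\<^sub>R (ket i \<otimes> h)) F"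
    by (intro tendsto_scaleR c tendsto_const)
  moreover have "\<forall>\<^sub>F t in F. c t i *\<^sub>R (ket i \<otimes> h) = ell2_diag (c t) (ket i \<otimes> h)"
    using b[of i] by (rule eventually_mono) (simp add: ell2_diag_ket)
  ultimately show "((\<lambda>t. ell2_diag (c t) (ket i \<otimes> h)) \<longlongrightarrow> ket i \<otimes> h) F"
    by (simp add: Lim_transform_eventually)
qed (auto simp: clin_id ell2_diag_clin ell2_diag_norm_le)


subsection \<open>Tensor products of subspaces\<close>

lemma tensor_space_closed: "closed_csubspace (N \<otimes>\<^sub>S D)"
  unfolding tensor_space_def by (rule closed_csubspace_closure) (rule complex_vector.subspace_span)

lemma tensor_in_space: "\<phi> \<in> N \<Longrightarrow> h \<in> D \<Longrightarrow> \<phi> \<otimes> h \<in> N \<otimes>\<^sub>S D"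
  unfolding tensor_space_def by (rule closure_subset[THEN subsetD], rule complex_vector.span_base) blast

lemma tensor_space_le:
  assumes "closed_csubspace M" "\<And>\<phi> h. \<phi> \<in> N \<Longrightarrow> h \<in> D \<Longrightarrow> \<phi> \<otimes> h \<in> M"
  shows "N \<otimes>\<^sub>S D \<subseteq> M"
  unfolding tensor_space_def by (rule closure_span_le) (use assms in auto)

lemma Proj_tensor:
  assumes N: "closed_csubspace N" and D: "closed_csubspace D"
  shows "Proj (N \<otimes>\<^sub>S D) (\<phi> \<otimes> h) = Proj N \<phi> \<otimes> Proj D h"
proof (rule Proj_eqI[OF tensor_space_closed])
  show "Proj N \<phi> \<otimes> Proj D h \<in> N \<otimes>\<^sub>S D"
    by (intro tensor_in_space Proj_in N D)
  have "N \<otimes>\<^sub>S D \<subseteq> UNIV \<ominus> {\<phi> \<otimes> h - Proj N \<phi> \<otimes> Proj D h}"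
  proof (rule tensor_space_le[OF ortho_complement_closed])
    fix \<psi> k assume "\<psi> \<in> N" "k \<in> D"
    then have "cinner \<psi> (Proj N \<phi>) = cinner \<psi> \<phi>" "cinner k (Proj D h) = cinner k h"
      using Proj_cinner[OF N, of \<psi> \<phi>] Proj_cinner[OF D, of k h] by (simp_all add: Proj_id N D)
    then show "\<psi> \<otimes> k \<in> UNIV \<ominus> {\<phi> \<otimes> h - Proj N \<phi> \<otimes> Proj D h}"
      by (simp add: ortho_diff_def cinner_diff_right cinner_tensor)
  qed
  then show "cinner (\<phi> \<otimes> h - Proj N \<phi> \<otimes> Proj D h) z = 0" if "z \<in> N \<otimes>\<^sub>S D" for z
    using that by (auto simp: ortho_diff_def dest: cinner_swap_zero)
qed

abbreviation amp_Proj :: "('i, complex) ell2 set \<Rightarrow> ('i, 'a::complex_hilbert) ell2 \<Rightarrow> ('i, 'a) ell2" where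
  "amp_Proj N \<equiv> Proj (N \<otimes>\<^sub>S UNIV)"

lemma amp_Proj_clin: "bounded_clinear (amp_Proj N)"
  by (rule Proj_clin[OF tensor_space_closed])

lemma amp_Proj_tensor: "closed_csubspace N \<Longrightarrow> amp_Proj N (\<phi> \<otimes> h) = Proj N \<phi> \<otimes> h"
  by (simp add: Proj_tensor closed_csubspace_UNIV)

lemma amp_Proj_map:
  assumes "closed_csubspace N" "bounded_clinear B"
  shows "amp_Proj N (ell2_map B x) = ell2_map B (amp_Proj N x)"
  by (rule clin_eq_on_kets[of "\<lambda>x. amp_Proj N (ell2_map B x)" "\<lambda>x. ell2_map B (amp_Proj N x)"])
    (auto intro: clin_comp amp_Proj_clin ell2_map_clin assms simp: ell2_map_tensor amp_Proj_tensor assms)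

text \<open>Splitting the projection into a Fock factor and a coefficient factor lets the two
  compressions be treated separately: the first by coinvariance, the second by identities for the
  defect spaces.\<close>

lemma Proj_tensor_space:
  assumes "closed_csubspace N" "closed_csubspace D"
  shows "Proj (N \<otimes>\<^sub>S D) x = ell2_map (Proj D) (amp_Proj N x)"
  by (rule clin_eq_on_kets[of "Proj (N \<otimes>\<^sub>S D)" "\<lambda>x. ell2_map (Proj D) (amp_Proj N x)"])
    (auto intro: clin_comp amp_Proj_clin ell2_map_clin assms Proj_clin tensor_space_closed
      simp: ell2_map_tensor amp_Proj_tensor assms Proj_tensor Proj_clin)

lemma tensor_op_Proj:
  assumes "closed_csubspace N" "bounded_clinear B"
  shows "Proj N \<otimes>\<^sub>O B = (\<lambda>x. amp_Proj N (ell2_map B x))"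
  by (rule tensor_op_amplify) (auto simp: assms amp_Proj_clin amp_Proj_tensor)


subsection \<open>Sums over words by length\<close>

lemma finite_words: "finite {w :: 'n::finite list. length w = k}" "finite {w :: 'n::finite list. length w < k}"
proof -
  show f: "finite {w :: 'n list. length w = k}" for k
    using finite_lists_length_eq[of "UNIV :: 'n set" k] by simp
  have "{w :: 'n list. length w < k} = (\<Union>j<k. {w. length w = j})" by auto
  then show "finite {w :: 'n list. length w < k}" using f by simp
qed

lemma sum_words_less: "(\<Sum>w | length w < m. f w) = (\<Sum>k<m. \<Sum>w | length w = k. f (w :: 'n::finite list))"
proof (induction m)
  case (Suc m)
  have "{w :: 'n list. length w < Suc m} = {w. length w < m} \<union> {w. length w = m}" by auto
  then show ?case
    using Suc by (simp add: sum.union_disjoint[OF finite_words(2) finite_words(1)] disjoint_iff)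
qed simp

lemma sum_words_snoc:
  "(\<Sum>w | length w = Suc k. f w) = (\<Sum>w | length w = k. \<Sum>i\<in>UNIV. f (w @ [i :: 'n::finite]))"
proof -
  have "(\<Sum>w | length w = k. \<Sum>i\<in>UNIV. f (w @ [i])) = (\<Sum>(w, i)\<in>{w. length w = k} \<times> UNIV. f (w @ [i]))"
    by (simp add: sum.cartesian_product)
  also have "\<dots> = (\<Sum>w | length w = Suc k. f w)"
    by (rule sum.reindex_bij_witness[of _ "\<lambda>w. (butlast w, last w)" "\<lambda>(w, i). w @ [i]"])
      (auto intro: append_butlast_last_id)
  finally show ?thesis ..
qed

lemma sum_words_append:
  "(\<Sum>w | length w = m + k. f w) = (\<Sum>w | length w = m. \<Sum>v | length v = k. f (w @ (v :: 'n::finite list)))"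
proof (induction k arbitrary: f)
  case (Suc k)
  have "(\<Sum>w | length w = m + Suc k. f w) = (\<Sum>w | length w = m. \<Sum>v | length v = k. \<Sum>i\<in>UNIV. f ((w @ v) @ [i]))"
    unfolding add_Suc_right sum_words_snoc by (rule Suc)
  then show ?case unfolding sum_words_snoc by simp
qed simp

text \<open>Every finite set of words is bounded in length, so the length cutoffs are cofinal among
  finite sets, and unordered sums become limits of sequences.\<close>

lemma filterlim_words: "filterlim (\<lambda>m. {w :: 'n::finite list. length w < m}) (finite_subsets_at_top UNIV) sequentially"
  unfolding filterlim_finite_subsets_at_top
proof (intro allI impI)
  fix X :: "'n list set" assume X: "finite X \<and> X \<subseteq> UNIV"
  have "\<forall>\<^sub>F m in sequentially. length w < m" for w :: "'n list"
    by (rule eventually_gt_at_top)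
  then have "\<forall>\<^sub>F m in sequentially. \<forall>w\<in>X. length w < m"
    using X by (simp add: eventually_ball_finite_distrib)
  then show "\<forall>\<^sub>F m in sequentially. finite {w :: 'n list. length w < m} \<and> X \<subseteq> {w. length w < m} \<and> {w. length w < m} \<subseteq> UNIV"
    by (rule eventually_mono) (auto simp: finite_words)
qed

lemma has_sum_words:
  assumes "(f has_sum S) (UNIV :: 'n::finite list set)"
  shows "(\<lambda>m. \<Sum>w | length w < m. f w) \<longlonglongrightarrow> S"
  using filterlim_compose[OF assms[unfolded has_sum_def] filterlim_words] .

section \<open>Truncation by word length and radial damping\<close>

definition truncate :: "nat \<Rightarrow> ('n list, 'a::complex_hilbert) ell2 \<Rightarrow> ('n list, 'a) ell2" where
  "truncate m = ell2_diag (\<lambda>w. if length w < m then 1 else 0)"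

lemma truncate_nth: "ell2_nth (truncate m x) w = (if length w < m then ell2_nth x w else 0)"
  by (simp add: truncate_def ell2_diag_nth)

lemma truncate_tendsto: "(\<lambda>m. truncate m x) \<longlonglongrightarrow> x"
  unfolding truncate_def
  by (rule ell2_diag_tendsto) (auto intro!: tendsto_eventually eventually_mono[OF eventually_gt_at_top])

lemma truncate_eq_sum:
  fixes x :: "('n::finite list, 'a::complex_hilbert) ell2"
  shows "truncate m x = (\<Sum>w | length w < m. ket w \<otimes> ell2_nth x w)"
  by (rule ell2_eqI) (simp add: truncate_nth ket_tensor_nth finite_words)

definition radial :: "real \<Rightarrow> ('n list, 'a::complex_hilbert) ell2 \<Rightarrow> ('n list, 'a) ell2" where
  "radial r = ell2_diag (\<lambda>w. r ^ length w)"

lemma radial_nth: "0 \<le> r \<Longrightarrow> r \<le> 1 \<Longrightarrow> ell2_nth (radial r x) w = r ^ length w *\<^sub>R ell2_nth x w"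
  by (simp add: radial_def ell2_diag_nth power_le_one)

lemma eventually_at_left_1: "\<forall>\<^sub>F r in at_left (1::real). 0 < r \<and> r < 1"
  using eventually_at_left_real[of 0 "1::real"] by (auto elim: eventually_mono)

lemma radial_tendsto: "((\<lambda>r. radial r x) \<longlongrightarrow> x) (at_left 1)"
  unfolding radial_def
proof (rule ell2_diag_tendsto)
  show "((\<lambda>r. r ^ length w) \<longlongrightarrow> 1) (at_left (1::real))" for w :: "'a list"
    by (rule tendsto_eq_intros tendsto_ident_at refl)+ simp
  show "\<forall>\<^sub>F r in at_left (1::real). \<bar>r ^ length w\<bar> \<le> 1" for w :: "'a list"
    using eventually_at_left_1 by (rule eventually_mono) (simp add: power_le_one)
qed


section \<open>Operator topologies\<close>

text \<open>The open sets of the pullback are the preimages of open sets cut down to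
  \<open>A\<close>. Limits in the operator topologies thus become ordinary limits of vectors or
  inner products.\<close>

lemma limitin_pullback_topology:
  "limitin (pullback_topology A g euclidean) f l F \<longleftrightarrow>
    l \<in> A \<and> (\<forall>\<^sub>F t in F. f t \<in> A) \<and> ((\<lambda>t. g (f t)) \<longlongrightarrow> g l) F"
proof
  assume L: "limitin (pullback_topology A g euclidean) f l F"
  then have l: "l \<in> A" by (auto simp: limitin_def topspace_pullback_topology)
  have ev: "\<forall>\<^sub>F t in F. f t \<in> g -` U \<inter> A" if "open U" "g l \<in> U" for U
  proof -
    have "openin (pullback_topology A g euclidean) (g -` U \<inter> A)"
      unfolding openin_pullback_topology using that by auto
    from limitinD[OF L this] show ?thesis using l that by blast
  qed
  show "l \<in> A \<and> (\<forall>\<^sub>F t in F. f t \<in> A) \<and> ((\<lambda>t. g (f t)) \<longlongrightarrow> g l) F"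
  proof (intro conjI l topological_tendstoI)
    show "\<forall>\<^sub>F t in F. f t \<in> A" by (rule eventually_mono[OF ev[of UNIV]]) simp_all
    fix U assume "open U" "g l \<in> U"
    then show "\<forall>\<^sub>F t in F. g (f t) \<in> U" by (rule eventually_mono[OF ev]) simp_all
  qed
next
  assume R: "l \<in> A \<and> (\<forall>\<^sub>F t in F. f t \<in> A) \<and> ((\<lambda>t. g (f t)) \<longlongrightarrow> g l) F"
  show "limitin (pullback_topology A g euclidean) f l F"
    unfolding limitin_def
  proof (intro conjI allI impI)
    show "l \<in> topspace (pullback_topology A g euclidean)"
      using R by (simp add: topspace_pullback_topology)
    fix U assume U: "openin (pullback_topology A g euclidean) U \<and> l \<in> U"
    then obtain V where V: "open V" "U = g -` V \<inter> A" by (auto simp: openin_pullback_topology)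
    have "\<forall>\<^sub>F t in F. g (f t) \<in> V"
      using R V U topological_tendstoD[of "\<lambda>t. g (f t)" "g l" F V] by blast
    moreover have "\<forall>\<^sub>F t in F. f t \<in> A" using R by blast
    ultimately show "\<forall>\<^sub>F t in F. f t \<in> U"
      by eventually_elim (simp add: V(2))
  qed
qed

lemma tendsto_fun_iff:
  "((f \<longlongrightarrow> l) F) \<longleftrightarrow> (\<forall>x. ((\<lambda>t. f t x) \<longlongrightarrow> (l x :: 'b::topological_space)) F)"
proof -
  have "limitin (product_topology (\<lambda>_. euclidean :: 'b topology) UNIV) f l F \<longleftrightarrow>
      (\<forall>x. ((\<lambda>t. f t x) \<longlongrightarrow> l x) F)"
    unfolding limitin_componentwise limitin_canonical_iff by simp
  then show ?thesis
    unfolding euclidean_product_topology limitin_canonical_iff .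
qed

lemma limitin_SOT_iff:
  "limitin SOT f l F \<longleftrightarrow>
    bounded_clinear l \<and> (\<forall>\<^sub>F t in F. bounded_clinear (f t)) \<and> (\<forall>x. ((\<lambda>t. f t x) \<longlongrightarrow> l x) F)"
  unfolding SOT_def limitin_pullback_topology tendsto_fun_iff by simp

lemma limitin_WOT_iff:
  "limitin WOT f l F \<longleftrightarrow>
    bounded_clinear l \<and> (\<forall>\<^sub>F t in F. bounded_clinear (f t)) \<and>
    (\<forall>x y. ((\<lambda>t. cinner (f t x) y) \<longlongrightarrow> cinner (l x) y) F)"
  unfolding WOT_def limitin_pullback_topology tendsto_fun_iff by (auto simp: split_paired_All)

lemma limitin_SOT_WOT: "limitin SOT f l F \<Longrightarrow> limitin WOT f l F"
  unfolding limitin_SOT_iff limitin_WOT_iff by (auto intro: tendsto_cinner)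

lemma continuous_map_WOT: "continuous_map WOT euclidean (\<lambda>A. cinner (A x) y)"
proof -
  have "continuous_map euclidean euclidean (\<lambda>f :: 'a \<times> 'b \<Rightarrow> complex. f (x, y))"
    using continuous_on_component[of UNIV] by simp
  from continuous_map_pullback[OF this, of "Collect bounded_clinear" "\<lambda>A (x, y). cinner (A x) y"]
  show ?thesis unfolding WOT_def comp_def by simp
qed


section \<open>Row contractions and their defect operators\<close>

lemma vec_nth_clin: "bounded_clinear (\<lambda>v :: 'a::complex_hilbert ^ 'n. v $ i)"
  by (rule bounded_clinearI[of _ 1]) (auto simp: Finite_Cartesian_Product.norm_nth_le scaleC_vec_def)

lemma scaleC_vec_nth: "(c *\<^sub>C v) $ i = c *\<^sub>C (v $ i)"
  by (simp add: scaleC_vec_def)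

lemma norm_sq_vec: "(norm (v :: 'a::complex_hilbert ^ 'n))\<^sup>2 = (\<Sum>i\<in>UNIV. (norm (v $ i))\<^sup>2)"
  by (simp add: norm_vec_def L2_set_sq)

lemma row_op_clin:
  assumes "\<And>i. bounded_clinear (T i)"
  shows "bounded_clinear (row_op T)"
  unfolding row_op_def by (intro clin_sum_op clin_comp[OF assms vec_nth_clin])

lemma cadjoint_row_op:
  assumes "\<And>i. bounded_clinear (T i)"
  shows "cadjoint (row_op T) x = (\<chi> i. cadjoint (T i) x)"
proof (rule cinner_ext')
  fix v
  have "cinner v (cadjoint (row_op T) x) = cinner (row_op T v) x"
    by (simp add: cinner_cadjoint[OF row_op_clin[OF assms]])
  also have "\<dots> = cinner v (\<chi> i. cadjoint (T i) x)"
    by (simp add: row_op_def cinner_vec_def cinner_sum_left cinner_cadjoint[OF assms])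
  finally show "cinner v (cadjoint (row_op T) x) = cinner v (\<chi> i. cadjoint (T i) x)" .
qed

lemma word_op_Nil [simp]: "word_op T [] = (\<lambda>x. x)"
  and word_op_Cons: "word_op T (i # w) = (\<lambda>x. T i (word_op T w x))"
  by (auto simp: word_op_def)

lemma word_op_snoc: "word_op T (w @ [i]) = (\<lambda>x. word_op T w (T i x))"
  by (induction w) (auto simp: word_op_Cons)

lemma word_op_clin: "(\<And>i. bounded_clinear (T i)) \<Longrightarrow> bounded_clinear (word_op T w)"
  by (induction w) (auto simp: word_op_Cons clin_id intro: clin_comp)

lemma ell2_finite_support:
  assumes "finite {i. f i \<noteq> 0}"
  shows "\<exists>x. ell2_nth x = f"
proof -
  have "(\<lambda>i. (norm (f i))\<^sup>2) summable_on UNIV"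
    by (rule finite_nonzero_values_imp_summable_on) (use assms in simp)
  then show ?thesis using Abs_ell2_inverse[of f] by auto
qed

locale row_contr =
  fixes T :: "'n::finite \<Rightarrow> 'h \<Rightarrow> 'h::complex_hilbert"
  assumes rc: "row_contraction T"
begin

abbreviation "R \<equiv> row_op T"
abbreviation "A \<equiv> cadjoint (row_op T)"
abbreviation "D \<equiv> defect_op T"
abbreviation "E \<equiv> defect_op_adj T"

lemma T_clin: "bounded_clinear (T i)"
  using rc by (simp add: row_contraction_def)

lemma R_clin: "bounded_clinear R"
  by (rule row_op_clin[OF T_clin])

lemma A_clin: "bounded_clinear A"
  by (rule cadjoint_clin[OF R_clin])

lemma A_nth: "A x $ i = cadjoint (T i) x"
  by (simp add: cadjoint_row_op[OF T_clin])

lemma R_A: "cinner (R v) x = cinner v (A x)" "cinner (A x) v = cinner x (R v)"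
  by (simp_all add: cinner_cadjoint[OF R_clin] cinner_cadjoint'[OF R_clin])

lemma A_norm: "norm (A x) \<le> norm x"
proof -
  have "cinner (x - (\<Sum>i\<in>UNIV. T i (cadjoint (T i) x))) x \<in> \<real>\<^sub>\<ge>\<^sub>0"
    using rc by (simp add: row_contraction_def positive_op_def)
  moreover have "(\<Sum>i\<in>UNIV. T i (cadjoint (T i) x)) = R (A x)"
    by (simp add: row_op_def A_nth)
  moreover have "cinner (x - R (A x)) x = complex_of_real ((norm x)\<^sup>2 - (norm (A x))\<^sup>2)"
    by (simp add: cinner_simps cinner_same R_A)
  ultimately have "complex_of_real ((norm x)\<^sup>2 - (norm (A x))\<^sup>2) \<in> \<real>\<^sub>\<ge>\<^sub>0" by simp
  then have "(norm (A x))\<^sup>2 \<le> (norm x)\<^sup>2" unfolding nonneg_Reals_of_real_iff by simp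
  then show ?thesis by (simp add: power2_le_iff_abs_le)
qed

lemma R_norm: "norm (R v) \<le> norm v"
proof (cases "R v = 0")
  case False
  have "(norm (R v))\<^sup>2 = cmod (cinner v (A (R v)))"
    by (simp add: cinner_same norm_power flip: R_A(1))
  also have "\<dots> \<le> norm v * norm (R v)"
    by (rule order_trans[OF norm_cinner_le mult_left_mono[OF A_norm]]) simp
  finally show ?thesis using False by (simp add: power2_eq_square)
qed simp

lemma RA: "bounded_clinear (\<lambda>x. R (A x))" "norm (R (A x)) \<le> norm x" "cinner (R (A x)) y = cinner x (R (A y))"
  using order_trans[OF R_norm A_norm] by (auto simp: R_A intro: clin_comp R_clin A_clin)

lemma AR: "bounded_clinear (\<lambda>x. A (R x))" "norm (A (R v)) \<le> norm v" "cinner (A (R v)) w = cinner v (A (R w))"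
  using order_trans[OF A_norm R_norm] by (auto simp flip: R_A intro: clin_comp R_clin A_clin)

lemma D_positive: "positive_op D" and D_sq: "D (D x) = x - R (A x)"
  unfolding defect_op_def using sqrt_op_contraction(1,2)[OF RA] by auto

lemma E_positive: "positive_op E" and E_sq: "E (E v) = v - A (R v)"
  unfolding defect_op_adj_def using sqrt_op_contraction(1,2)[OF AR] by auto

lemmas D_clin = positive_op_clin[OF D_positive]
  and E_clin = positive_op_clin[OF E_positive]
  and D_selfadjoint = positive_op_selfadjoint[OF D_positive]
  and E_selfadjoint = positive_op_selfadjoint[OF E_positive]

text \<open>\<open>R\<close> intertwines \<open>A R\<close> with \<open>R A\<close>, and
  intertwining passes to the square roots of \<open>I - A R\<close> and
  \<open>I - R A\<close>.\<close>

lemma R_E: "R (E v) = D (R v)"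
  unfolding defect_op_def defect_op_adj_def
  by (rule sqrt_op_intertwine[of "\<lambda>v. A (R v)" "\<lambda>x. R (A x)" R, OF AR RA R_clin refl])

lemma A_D: "A (D x) = E (A x)"
  unfolding defect_op_def defect_op_adj_def
  by (rule sqrt_op_intertwine[of "\<lambda>x. R (A x)" "\<lambda>v. A (R v)" A, OF RA AR A_clin refl])

text \<open>This is the Halmos unitary dilation of the contraction \<open>A\<close>. The diagonal
  terms add up by \<open>D_sq\<close> and \<open>E_sq\<close>, and the cross terms cancel by
  \<open>R_E\<close> and \<open>A_D\<close>.\<close>

lemma julia: "(norm (A x + E v))\<^sup>2 + (norm (D x - R v))\<^sup>2 = (norm x)\<^sup>2 + (norm v)\<^sup>2"
proof -
  have "cinner (A x + E v) (A x + E v) + cinner (D x - R v) (D x - R v)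
      = cinner x (R (A x) + D (D x)) + cinner v (E (E v) + A (R v))
        + (cinner x (R (E v)) - cinner x (D (R v))) + (cinner v (E (A x)) - cinner v (A (D x)))"
    by (simp add: cinner_simps R_A D_selfadjoint E_selfadjoint)
  also have "\<dots> = cinner x x + cinner v v" by (simp add: D_sq E_sq R_E A_D)
  finally have "complex_of_real ((norm (A x + E v))\<^sup>2 + (norm (D x - R v))\<^sup>2)
      = complex_of_real ((norm x)\<^sup>2 + (norm v)\<^sup>2)"
    by (simp only: cinner_same of_real_add)
  then show ?thesis unfolding of_real_eq_iff .
qed


subsection \<open>The state space recursion\<close>

text \<open>Words grow at their end, as under right creation, while list recursion peels off the
  head; hence the reversed word.\<close>

primrec rev_state :: "'h \<Rightarrow> ('n list \<Rightarrow> 'h ^ 'n) \<Rightarrow> 'n list \<Rightarrow> 'h" where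
  "rev_state a \<eta> [] = a"
| "rev_state a \<eta> (i # w) = (A (rev_state a \<eta> w) + E (\<eta> (rev w))) $ i"

definition state :: "'h \<Rightarrow> ('n list \<Rightarrow> 'h ^ 'n) \<Rightarrow> 'n list \<Rightarrow> 'h" where
  "state a \<eta> w = rev_state a \<eta> (rev w)"

definition sys_output :: "'h \<Rightarrow> ('n list \<Rightarrow> 'h ^ 'n) \<Rightarrow> 'n list \<Rightarrow> 'h" where
  "sys_output a \<eta> w = D (state a \<eta> w) - R (\<eta> w)"

lemma state_Nil: "state a \<eta> [] = a"
  and state_snoc: "state a \<eta> (w @ [i]) = (A (state a \<eta> w) + E (\<eta> w)) $ i"
  by (simp_all add: state_def)

lemma state_unique:
  assumes "x [] = a" "\<And>w i. x (w @ [i]) = (A (x w) + E (\<eta> w)) $ i"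
  shows "state a \<eta> w = x w"
  by (induction w rule: rev_induct) (auto simp: state_Nil state_snoc assms)

lemma state_add: "state (a + b) (\<lambda>w. \<eta> w + \<theta> w) w = state a \<eta> w + state b \<theta> w"
  by (rule state_unique) (auto simp: state_Nil state_snoc clin_simps[OF A_clin] clin_simps[OF E_clin])

lemma state_scaleC: "state (c *\<^sub>C a) (\<lambda>w. c *\<^sub>C \<eta> w) w = c *\<^sub>C state a \<eta> w"
  by (rule state_unique)
    (auto simp: state_Nil state_snoc clin_simps[OF A_clin] clin_simps[OF E_clin] scaleC_add_right scaleC_vec_nth)

lemma sys_output_add: "sys_output (a + b) (\<lambda>w. \<eta> w + \<theta> w) w = sys_output a \<eta> w + sys_output b \<theta> w"
  by (simp add: sys_output_def state_add clin_simps[OF D_clin] clin_simps[OF R_clin])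

lemma sys_output_scaleC: "sys_output (c *\<^sub>C a) (\<lambda>w. c *\<^sub>C \<eta> w) w = c *\<^sub>C sys_output a \<eta> w"
  by (simp add: sys_output_def state_scaleC clin_simps[OF D_clin] clin_simps[OF R_clin]
      complex_vector.scale_right_diff_distrib)

text \<open>Once the input has stopped, the state evolves freely by the adjoints of
  \<open>T\<close>. Zero input and \<open>w = []\<close> give the Poisson kernel; for finitely
  supported input this is where purity takes hold.\<close>

lemma state_append:
  assumes "\<And>v. \<eta> (w @ v) = 0"
  shows "state a \<eta> (w @ v) = cadjoint (word_op T v) (state a \<eta> w)"
proof (induction v rule: rev_induct)
  case Nil
  have "cadjoint (\<lambda>x :: 'h. x) = (\<lambda>x. x)" by (rule cadjoint_eqI) (auto simp: clin_id)
  then show ?case by simp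
next
  case (snoc i v)
  have "state a \<eta> ((w @ v) @ [i]) = cadjoint (T i) (state a \<eta> (w @ v))"
    unfolding state_snoc by (simp add: assms A_nth clin_zero[OF E_clin])
  then show ?case
    by (simp add: snoc word_op_snoc cadjoint_comp[OF word_op_clin[OF T_clin] T_clin])
qed

definition energy :: "'h \<Rightarrow> ('n list \<Rightarrow> 'h ^ 'n) \<Rightarrow> nat \<Rightarrow> real" where
  "energy a \<eta> k = (\<Sum>w | length w = k. (norm (state a \<eta> w))\<^sup>2)"

text \<open>The components of \<open>A x + E v\<close> are the states one letter further on, so
  \<open>julia\<close> summed over all words of length \<open>m\<close> links the energies of
  consecutive levels.\<close>

lemma energy_balance:
  "energy a \<eta> m + (\<Sum>w | length w < m. (norm (sys_output a \<eta> w))\<^sup>2)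
    = (norm a)\<^sup>2 + (\<Sum>w | length w < m. (norm (\<eta> w))\<^sup>2)"
proof (induction m)
  case 0
  show ?case by (simp add: energy_def state_Nil)
next
  case (Suc m)
  have "energy a \<eta> (Suc m) + (\<Sum>w | length w = m. (norm (sys_output a \<eta> w))\<^sup>2)
      = (\<Sum>w | length w = m. (norm (A (state a \<eta> w) + E (\<eta> w)))\<^sup>2 + (norm (D (state a \<eta> w) - R (\<eta> w)))\<^sup>2)"
    unfolding energy_def sum_words_snoc state_snoc norm_sq_vec sys_output_def sum.distrib ..
  also have "\<dots> = energy a \<eta> m + (\<Sum>w | length w = m. (norm (\<eta> w))\<^sup>2)"
    unfolding julia sum.distrib energy_def ..
  finally show ?case using Suc unfolding sum_words_less by simp
qed

text \<open>A finite set of words lies below some length, where the energy balance applies with a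
  nonnegative residual energy. This makes the \<open>Abs_ell2\<close> in \<open>Omega\<close>
  legitimate.\<close>

lemma sys_output_bound:
  assumes "finite F"
  shows "L2_set (\<lambda>w. norm (sys_output a (ell2_nth \<eta>) w)) F \<le> sqrt ((norm a)\<^sup>2 + (norm \<eta>)\<^sup>2)"
proof -
  obtain m where m: "\<forall>w\<in>F. length w < m"
    using finite_nat_set_iff_bounded[of "length ` F"] assms by auto
  have "(\<Sum>w\<in>F. (norm (sys_output a (ell2_nth \<eta>) w))\<^sup>2) \<le> (\<Sum>w | length w < m. (norm (sys_output a (ell2_nth \<eta>) w))\<^sup>2)"
    by (rule sum_mono2) (use m finite_words in auto)
  also have "\<dots> \<le> (norm a)\<^sup>2 + (\<Sum>w | length w < m. (norm (ell2_nth \<eta> w))\<^sup>2)"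
    unfolding energy_balance[symmetric] by (simp add: energy_def sum_nonneg)
  also have "(\<Sum>w | length w < m. (norm (ell2_nth \<eta> w))\<^sup>2) \<le> (norm \<eta>)\<^sup>2"
    using power_mono[OF L2_set_le_norm[OF finite_words(2), of \<eta> m] L2_set_nonneg, of 2] by (simp add: L2_set_sq)
  finally show ?thesis by (simp add: L2_set_def)
qed

section \<open>The map from initial state and input to output\<close>

definition Omega :: "'h \<Rightarrow> ('n list, 'h ^ 'n) ell2 \<Rightarrow> ('n list, 'h) ell2" where
  "Omega a \<eta> = Abs_ell2 (sys_output a (ell2_nth \<eta>))"

lemma Omega_nth: "ell2_nth (Omega a \<eta>) w = sys_output a (ell2_nth \<eta>) w"
  using ell2_bound(1)[OF sys_output_bound, of a \<eta>] by (simp add: Omega_def Abs_ell2_inverse)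

lemma Omega_norm: "norm (Omega a \<eta>) \<le> sqrt ((norm a)\<^sup>2 + (norm \<eta>)\<^sup>2)"
  by (rule ell2_norm_le) (simp add: Omega_nth sys_output_bound)

lemma Omega_add: "Omega (a + b) (\<eta> + \<theta>) = Omega a \<eta> + Omega b \<theta>"
  by (rule ell2_eqI) (simp add: Omega_nth sys_output_add plus_ell2.rep_eq)

lemma Omega_scaleC: "Omega (c *\<^sub>C a) (c *\<^sub>C \<eta>) = c *\<^sub>C Omega a \<eta>"
  by (rule ell2_eqI) (simp add: Omega_nth sys_output_scaleC scaleC_ell2.rep_eq)

definition poisson :: "'h \<Rightarrow> ('n list, 'h) ell2" where
  "poisson a = Omega a 0"

definition Theta :: "('n list, 'h ^ 'n) ell2 \<Rightarrow> ('n list, 'h) ell2" where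
  "Theta \<eta> = Omega 0 \<eta>"

lemma Omega_split: "Omega a \<eta> = poisson a + Theta \<eta>"
  using Omega_add[of a 0 0 \<eta>] by (simp add: poisson_def Theta_def)

lemma poisson_clin: "bounded_clinear poisson"
  using Omega_norm[of _ 0] Omega_add[of _ _ 0 0] Omega_scaleC[of _ _ 0]
  by (intro bounded_clinearI[of _ 1]) (auto simp: poisson_def)

lemma Theta_norm_le: "norm (Theta \<eta>) \<le> norm \<eta>"
  using Omega_norm[of 0 \<eta>] by (simp add: Theta_def)

lemma Theta_clin: "bounded_clinear Theta"
  using Omega_add[of 0 0] Omega_scaleC[of _ 0] Theta_norm_le
  by (intro bounded_clinearI[of _ 1]) (auto simp: Theta_def)

lemma poisson_nth: "ell2_nth (poisson a) w = D (cadjoint (word_op T w) a)"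
  using state_append[of "\<lambda>_. 0" "[]" a w]
  by (simp add: poisson_def Omega_nth sys_output_def zero_ell2.rep_eq[abs_def] state_Nil clin_zero[OF R_clin])

text \<open>A state family with output \<open>y\<close>, recovered backwards from the long words, where it vanishes.\<close>

primrec back_state :: "('n list \<Rightarrow> 'h) \<Rightarrow> nat \<Rightarrow> 'n list \<Rightarrow> 'h" where
  "back_state y 0 w = 0"
| "back_state y (Suc k) w = R (\<chi> i. back_state y k (w @ [i])) + D (y w)"

text \<open>The Julia operator is inverted by its adjoint, which sends the next states
  \<open>g w\<close> and the output \<open>?y w\<close> to the state
  \<open>R (g w) + D (?y w)\<close> and the input \<open>E (g w) - A (?y w)\<close>.\<close>

lemma Omega_surj_finite:
  assumes y: "\<And>w. m \<le> length w \<Longrightarrow> ell2_nth y w = 0"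
  shows "\<exists>a \<eta>. y = Omega a \<eta>"
proof -
  let ?y = "ell2_nth y"
  \<comment> \<open>The fuel \<open>m - length w\<close> is the distance to the level where the
    output vanishes; from that level on truncated subtraction gives 0 and hence the zero
    state.\<close>
  define u where "u w = back_state ?y (m - length w) w" for w
  define g where "g w = (\<chi> i. u (w @ [i]))" for w
  define h where "h w = E (g w) - A (?y w)" for w
  have u: "u w = R (g w) + D (?y w)" for w
  proof (cases "length w < m")
    case True
    then have "m - length w = Suc (m - Suc (length w))" by simp
    then show ?thesis by (simp add: g_def u_def)
  next
    case False
    then have "u w = 0" "g w = 0" "?y w = 0" by (simp_all add: u_def g_def y vec_eq_iff)
    then show ?thesis by (simp add: clin_zero[OF R_clin] clin_zero[OF D_clin])
  qed
  have "h w = 0" if "\<not> length w < m" for w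
  proof -
    have "g w = 0" "?y w = 0" using that by (simp_all add: u_def g_def y vec_eq_iff)
    then show ?thesis by (simp add: h_def clin_zero[OF E_clin] clin_zero[OF A_clin])
  qed
  then have "{w. h w \<noteq> 0} \<subseteq> {w. length w < m}" by blast
  then have "finite {w. h w \<noteq> 0}" by (rule finite_subset[OF _ finite_words(2)])
  then obtain \<eta> where \<eta>: "ell2_nth \<eta> = h" by (rule exE[OF ell2_finite_support])
  have "state (u []) h w = u w" for w
  proof (rule state_unique)
    fix w i
    have "A (u w) + E (h w) = g w"
      unfolding u[of w] h_def clin_add[OF A_clin] clin_diff[OF E_clin] A_D E_sq by simp
    then show "u (w @ [i]) = (A (u w) + E (h w)) $ i" by (simp only: g_def vec_lambda_beta)
  qed simp
  moreover have "D (u w) - R (h w) = ?y w" for w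
    unfolding u[of w] h_def clin_diff[OF R_clin] clin_add[OF D_clin] R_E D_sq by simp
  ultimately have "y = Omega (u []) \<eta>"
    by (intro ell2_eqI) (simp add: Omega_nth sys_output_def \<eta>)
  then show ?thesis by blast
qed

end

locale pure_row_contr = row_contr T for T :: "'n::finite \<Rightarrow> 'h \<Rightarrow> 'h::complex_hilbert" +
  assumes pure: "pure_row T"
begin

lemma word_energy_tendsto: "(\<lambda>k. \<Sum>v | length v = k. (norm (cadjoint (word_op T v) x))\<^sup>2) \<longlonglongrightarrow> 0"
proof -
  note wc = word_op_clin[of T, OF T_clin]
  have "(\<lambda>k. \<Sum>v | length v = k. word_op T v (cadjoint (word_op T v) x)) \<longlonglongrightarrow> 0"
    using pure unfolding pure_row_def limitin_SOT_iff by blast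
  then have "(\<lambda>k. Re (cinner (\<Sum>v | length v = k. word_op T v (cadjoint (word_op T v) x)) x)) \<longlonglongrightarrow> Re (cinner 0 x)"
    by (intro tendsto_Re tendsto_cinner tendsto_const)
  then show ?thesis
    by (simp add: cinner_sum_left cinner_cadjoint[OF wc] cinner_same)
qed

text \<open>From level \<open>m\<close> on there are finitely many free evolutions, one for each
  word of length \<open>m\<close>, and purity sends the energy of each to zero.\<close>

lemma energy_tendsto:
  assumes \<eta>: "\<And>w. m \<le> length w \<Longrightarrow> \<eta> w = 0"
  shows "energy a \<eta> \<longlonglongrightarrow> 0"
proof (rule LIMSEQ_offset[of _ m])
  have "energy a \<eta> (k + m) = (\<Sum>w | length w = m. \<Sum>v | length v = k. (norm (cadjoint (word_op T v) (state a \<eta> w)))\<^sup>2)" for k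
    unfolding energy_def add.commute[of k m] sum_words_append by (simp add: state_append \<eta>)
  moreover have "(\<lambda>k. \<Sum>w | length w = m. \<Sum>v | length v = k. (norm (cadjoint (word_op T v) (state a \<eta> w)))\<^sup>2)
      \<longlonglongrightarrow> (\<Sum>w | length (w :: 'n list) = m. 0)"
    by (intro tendsto_sum word_energy_tendsto)
  ultimately show "(\<lambda>k. energy a \<eta> (k + m)) \<longlonglongrightarrow> 0" by simp
qed

text \<open>For finitely supported input the residual energy in the balance tends to zero. For
  general input it is not controlled directly, so that case goes through truncation and the
  continuity of \<open>Theta\<close>.\<close>

lemma Omega_isometry: "(norm (Omega a \<eta>))\<^sup>2 = (norm a)\<^sup>2 + (norm \<eta>)\<^sup>2"
proof -
  have fin: "(norm (Omega a \<theta>))\<^sup>2 = (norm a)\<^sup>2 + (norm \<theta>)\<^sup>2"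
    if z: "\<And>w. m \<le> length w \<Longrightarrow> ell2_nth \<theta> w = 0" for m \<theta>
  proof (rule LIMSEQ_unique)
    have "(\<lambda>m. \<Sum>w | length w < m. (norm (ell2_nth (Omega a \<theta>) w))\<^sup>2) \<longlonglongrightarrow> (norm (Omega a \<theta>))\<^sup>2"
      by (rule has_sum_words[OF norm_sq_ell2_has_sum])
    from tendsto_add[OF energy_tendsto[of m "ell2_nth \<theta>" a, OF z] this]
    show "(\<lambda>m. (norm a)\<^sup>2 + (\<Sum>w | length w < m. (norm (ell2_nth \<theta> w))\<^sup>2)) \<longlonglongrightarrow> (norm (Omega a \<theta>))\<^sup>2"
      by (simp add: Omega_nth energy_balance)
    show "(\<lambda>m. (norm a)\<^sup>2 + (\<Sum>w | length w < m. (norm (ell2_nth \<theta> w))\<^sup>2)) \<longlonglongrightarrow> (norm a)\<^sup>2 + (norm \<theta>)\<^sup>2"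
      by (intro tendsto_add tendsto_const has_sum_words[OF norm_sq_ell2_has_sum])
  qed
  show ?thesis
  proof (rule LIMSEQ_unique)
    show "(\<lambda>m. (norm (Omega a (truncate m \<eta>)))\<^sup>2) \<longlonglongrightarrow> (norm (Omega a \<eta>))\<^sup>2"
      unfolding Omega_split by (intro tendsto_intros clin_tendsto[OF Theta_clin] truncate_tendsto)
    have "(norm (Omega a (truncate m \<eta>)))\<^sup>2 = (norm a)\<^sup>2 + (norm (truncate m \<eta>))\<^sup>2" for m
      by (rule fin[of m]) (simp add: truncate_nth)
    then show "(\<lambda>m. (norm (Omega a (truncate m \<eta>)))\<^sup>2) \<longlonglongrightarrow> (norm a)\<^sup>2 + (norm \<eta>)\<^sup>2"
      by (simp add: tendsto_intros truncate_tendsto)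
  qed
qed

lemma poisson_isometry: "norm (poisson a) = norm a"
  using Omega_isometry[of a 0] unfolding poisson_def by simp

lemma poisson_cinner: "cinner (poisson a) (poisson b) = cinner a b"
  by (rule isometry_cinner[OF poisson_clin poisson_isometry])

lemma Theta_isometry: "norm (Theta \<eta>) = norm \<eta>"
  using Omega_isometry[of 0 \<eta>] unfolding Theta_def by simp

lemma Theta_cinner: "cinner (Theta \<eta>) (Theta \<theta>) = cinner \<eta> \<theta>"
  by (rule isometry_cinner[OF Theta_clin Theta_isometry])

text \<open>The isometry applied to \<open>Omega_split\<close> kills the real part; replacing
  \<open>a\<close> by its multiple with \<i> kills the imaginary part.\<close>

lemma poisson_Theta_ortho: "cinner (poisson a) (Theta \<eta>) = 0"
proof -
  have re: "Re (cinner (poisson a) (Theta \<eta>)) = 0" for a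
    using norm_add_sq[of "poisson a" "Theta \<eta>"] Omega_isometry[of a \<eta>]
    by (simp add: Omega_split poisson_isometry Theta_isometry)
  have "cinner (poisson (\<i> *\<^sub>C a)) (Theta \<eta>) = \<i> * cinner (poisson a) (Theta \<eta>)"
    by (simp add: clin_scaleC[OF poisson_clin] cinner_scaleC_left)
  then show ?thesis using re[of a] re[of "\<i> *\<^sub>C a"] by (simp add: complex_eq_iff)
qed

lemma poisson_adjoint: "cadjoint poisson (poisson a) = a" "cadjoint poisson (Theta \<eta>) = 0"
  and Theta_adjoint: "cadjoint Theta (Theta \<eta>) = \<eta>" "cadjoint Theta (poisson a) = 0"
proof -
  note c = cinner_cadjoint[OF poisson_clin, symmetric] cinner_cadjoint[OF Theta_clin, symmetric]
    poisson_cinner Theta_cinner poisson_Theta_ortho cinner_swap_zero[OF poisson_Theta_ortho] cinner_zero_right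
  show "cadjoint poisson (poisson a) = a" by (rule cinner_ext') (simp only: c)
  show "cadjoint poisson (Theta \<eta>) = 0" by (rule cinner_ext') (simp only: c)
  show "cadjoint Theta (Theta \<eta>) = \<eta>" by (rule cinner_ext') (simp only: c)
  show "cadjoint Theta (poisson a) = 0" by (rule cinner_ext') (simp only: c)
qed

text \<open>Each \<open>ket v \<otimes> h\<close> is finitely supported, hence of the form
  \<open>poisson a + Theta \<eta>\<close>, where the adjoint formulas apply; density does the
  rest.\<close>

lemma resolution_of_identity: "poisson (cadjoint poisson y) + Theta (cadjoint Theta y) = y"
proof (rule clin_eq_on_kets[of "\<lambda>y. poisson (cadjoint poisson y) + Theta (cadjoint Theta y)" "\<lambda>y. y"])
  fix v :: "'n list" and h :: 'h
  have "ell2_nth (ket v \<otimes> h) w = 0" if "Suc (length v) \<le> length w" for w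
    using that by (auto simp: ket_tensor_nth)
  then obtain a \<eta> where "ket v \<otimes> h = Omega a \<eta>"
    using Omega_surj_finite by blast
  then show "poisson (cadjoint poisson (ket v \<otimes> h)) + Theta (cadjoint Theta (ket v \<otimes> h)) = ket v \<otimes> h"
    by (simp add: Omega_split poisson_adjoint Theta_adjoint clin_add[OF cadjoint_clin[OF poisson_clin]]
        clin_add[OF cadjoint_clin[OF Theta_clin]])
  show "bounded_clinear (\<lambda>y. poisson (cadjoint poisson y) + Theta (cadjoint Theta y))"
    by (rule clin_add_op[OF clin_comp[OF poisson_clin cadjoint_clin[OF poisson_clin]]
          clin_comp[OF Theta_clin cadjoint_clin[OF Theta_clin]]])
qed (rule clin_id)

end


section \<open>Resolvents of contractions\<close>

text \<open>Kept abstract for two instances: the transfer operator on the full space and its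
  compression.\<close>

locale hilbert_contraction =
  fixes C :: "'a::complex_hilbert \<Rightarrow> 'a"
  assumes C_clin: "bounded_clinear C" and C_norm: "norm (C x) \<le> norm x"
begin

lemma fixpoint_unique:
  assumes "0 \<le> r" "r < 1" "x - r *\<^sub>R C x = y - r *\<^sub>R C y"
  shows "x = y"
proof -
  have "x - y = r *\<^sub>R C (x - y)"
    using assms(3) by (simp add: clin_diff[OF C_clin] algebra_simps)
  then have "norm (x - y) = r * norm (C (x - y))"
    using assms(1) by (metis norm_scaleR abs_of_nonneg)
  also have "\<dots> \<le> r * norm (x - y)"
    using C_norm assms(1) by (rule mult_left_mono)
  finally have "(1 - r) * norm (x - y) \<le> 0" by (simp add: algebra_simps)
  then show ?thesis using assms(2) by (simp add: mult_le_0_iff)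
qed

lemma fixpoint_exists:
  assumes "0 \<le> r" "r < 1"
  shows "\<exists>x. x - r *\<^sub>R C x = f"
proof -
  have "\<exists>!x. f + r *\<^sub>R C x = x"
  proof (rule banach_fix_type[OF assms])
    show "\<forall>x y. dist (f + r *\<^sub>R C x) (f + r *\<^sub>R C y) \<le> r * dist x y"
      using assms C_norm
      by (simp add: dist_norm mult_left_mono flip: clin_diff[OF C_clin] scaleR_right_diff_distrib)
  qed
  then obtain x where "f + r *\<^sub>R C x = x" by blast
  then have "x - r *\<^sub>R C x = f" by (metis add_diff_cancel_right')
  then show ?thesis ..
qed

definition resolvent :: "real \<Rightarrow> 'a \<Rightarrow> 'a" where
  "resolvent r f = (THE x. x - r *\<^sub>R C x = f)"

context
  fixes r :: real
  assumes r: "0 \<le> r" "r < 1"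
begin

lemma resolvent_eq: "resolvent r f - r *\<^sub>R C (resolvent r f) = f"
  unfolding resolvent_def
proof (rule theI')
  obtain x where x: "x - r *\<^sub>R C x = f" using fixpoint_exists[OF r] by blast
  then show "\<exists>!x. x - r *\<^sub>R C x = f"
    by (rule ex1I) (rule fixpoint_unique[OF r], simp add: x)
qed

lemma resolvent_eqI: "x - r *\<^sub>R C x = f \<Longrightarrow> resolvent r f = x"
  by (rule fixpoint_unique[OF r]) (simp add: resolvent_eq)

lemma resolvent_clin: "bounded_clinear (resolvent r)"
proof (rule bounded_clinearI[of _ "1 / (1 - r)"])
  fix x y c
  have "(resolvent r x + resolvent r y) - r *\<^sub>R C (resolvent r x + resolvent r y)
      = (resolvent r x - r *\<^sub>R C (resolvent r x)) + (resolvent r y - r *\<^sub>R C (resolvent r y))"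
    by (simp add: clin_add[OF C_clin] algebra_simps)
  then show "resolvent r (x + y) = resolvent r x + resolvent r y"
    by (intro resolvent_eqI) (simp add: resolvent_eq)
  have "c *\<^sub>C resolvent r x - r *\<^sub>R C (c *\<^sub>C resolvent r x)
      = c *\<^sub>C (resolvent r x - r *\<^sub>R C (resolvent r x))"
    by (simp add: clin_scaleC[OF C_clin] scaleC_scaleC mult.commute complex_vector.scale_right_diff_distrib
        flip: scaleC_of_real)
  then show "resolvent r (c *\<^sub>C x) = c *\<^sub>C resolvent r x"
    by (intro resolvent_eqI) (simp add: resolvent_eq)
  have "norm (resolvent r x) \<le> norm (resolvent r x - r *\<^sub>R C (resolvent r x)) + norm (r *\<^sub>R C (resolvent r x))"
    using norm_triangle_ineq[of "resolvent r x - r *\<^sub>R C (resolvent r x)" "r *\<^sub>R C (resolvent r x)"] by simp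
  also have "norm (r *\<^sub>R C (resolvent r x)) \<le> r * norm (resolvent r x)"
    using C_norm[of "resolvent r x"] r by (simp add: mult_left_mono)
  finally have "(1 - r) * norm (resolvent r x) \<le> norm x"
    by (simp add: resolvent_eq algebra_simps)
  then show "norm (resolvent r x) \<le> norm x * (1 / (1 - r))"
    using r by (simp add: field_simps)
qed

end

end


section \<open>The characteristic function on the full Fock space\<close>

abbreviation rshift :: "'n \<Rightarrow> ('n list, 'a::complex_hilbert) ell2 \<Rightarrow> ('n list, 'a) ell2" where
  "rshift i \<equiv> ell2_push (\<lambda>w. w @ [i])"

lemma inj_snoc: "inj (\<lambda>w. w @ [i])"
  by (simp add: inj_def)

lemma rshift_nth: "ell2_nth (rshift i x) [] = 0"
  "ell2_nth (rshift i x) (w @ [j]) = (if i = j then ell2_nth x w else 0)"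
  using ell2_push_nth[OF inj_snoc, of i x w] ell2_push_nth_out[of _ "\<lambda>w. w @ [i]" x] by (auto simp: image_iff)

lemma rshift_clin: "bounded_clinear (rshift i)"
  by (rule ell2_push_clin[OF inj_snoc])

lemma rshift_tensor: "rshift i (\<phi> \<otimes> h) = right_creation i \<phi> \<otimes> h"
proof (rule ell2_eqI)
  fix w show "ell2_nth (rshift i (\<phi> \<otimes> h)) w = ell2_nth (right_creation i \<phi> \<otimes> h) w"
    by (cases w rule: rev_cases) (auto simp: rshift_nth tensor.rep_eq right_creation.rep_eq)
qed

definition row_shift :: "('n::finite list, 'a::complex_hilbert ^ 'n) ell2 \<Rightarrow> ('n list, 'a) ell2" where
  "row_shift \<eta> = (\<Sum>i\<in>UNIV. rshift i (ell2_map (\<lambda>v. v $ i) \<eta>))"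

lemma row_shift_clin: "bounded_clinear row_shift"
  unfolding row_shift_def
  by (intro clin_sum_op clin_comp[OF rshift_clin] ell2_map_clin vec_nth_clin)

lemma row_shift_nth: "ell2_nth (row_shift \<eta>) [] = 0"
  "ell2_nth (row_shift \<eta>) (w @ [i]) = ell2_nth \<eta> w $ i"
  by (simp_all add: row_shift_def rshift_nth ell2_map_nth vec_nth_clin)

text \<open>Every nonempty word is \<open>w @ [i]\<close> in exactly one way, so
  \<open>row_shift\<close> only redistributes the components of the coordinates over words one
  letter longer.\<close>

lemma row_shift_norm: "norm (row_shift \<eta>) = norm \<eta>"
proof -
  have "(\<Sum>w | length w < Suc m. (norm (ell2_nth (row_shift \<eta>) w))\<^sup>2) = (\<Sum>w | length w < m. (norm (ell2_nth \<eta> w))\<^sup>2)" for m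
    unfolding sum_words_less sum.lessThan_Suc_shift sum_words_snoc
    by (simp add: row_shift_nth norm_sq_vec)
  then have "(\<lambda>m. \<Sum>w | length w < m. (norm (ell2_nth \<eta> w))\<^sup>2) \<longlonglongrightarrow> (norm (row_shift \<eta>))\<^sup>2"
    using LIMSEQ_Suc[OF has_sum_words[OF norm_sq_ell2_has_sum[of "row_shift \<eta>"]]] by simp
  then have "(norm (row_shift \<eta>))\<^sup>2 = (norm \<eta>)\<^sup>2"
    by (rule LIMSEQ_unique) (rule has_sum_words[OF norm_sq_ell2_has_sum])
  then show ?thesis by simp
qed

lemma row_shift_map:
  assumes "bounded_clinear B"
  shows "row_shift (ell2_map B x) = (\<Sum>i\<in>UNIV. rshift i (ell2_map (\<lambda>h. B h $ i) x))"
  by (simp add: row_shift_def ell2_map_comp[OF vec_nth_clin assms])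

context row_contr
begin

definition transfer_op :: "('n list, 'h) ell2 \<Rightarrow> ('n list, 'h) ell2" where
  "transfer_op x = row_shift (ell2_map A x)"

lemma transfer_op_sum: "transfer_op x = (\<Sum>i\<in>UNIV. rshift i (ell2_map (cadjoint (T i)) x))"
  unfolding transfer_op_def row_shift_map[OF A_clin] A_nth ..

text \<open>The bound 1 comes from factoring through the column operator \<open>A\<close>, a
  contraction, followed by an isometry; a termwise estimate of the sum over \<open>i\<close> would
  lose it.\<close>

sublocale C: hilbert_contraction transfer_op
proof
  show "bounded_clinear transfer_op"
    unfolding transfer_op_def[abs_def] by (intro clin_comp[OF row_shift_clin] ell2_map_clin A_clin)
  show "norm (transfer_op x) \<le> norm x" for x
    unfolding transfer_op_def row_shift_norm using ell2_map_norm_le[OF A_clin, of 1 x] A_norm by simp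
qed

text \<open>Solves the state recursion with zero initial state and a factor \<open>r\<close> per
  letter. For \<open>r < 1\<close> the solution is square-summable, which the undamped state need
  not be.\<close>

definition Theta_state :: "real \<Rightarrow> ('n list, 'h ^ 'n) ell2 \<Rightarrow> ('n list, 'h) ell2" where
  "Theta_state r \<eta> = C.resolvent r (r *\<^sub>R row_shift (ell2_map E \<eta>))"

definition Theta_rad :: "real \<Rightarrow> ('n list, 'h ^ 'n) ell2 \<Rightarrow> ('n list, 'h) ell2" where
  "Theta_rad r \<eta> = ell2_map D (Theta_state r \<eta>) - ell2_map R \<eta>"

context
  fixes r :: real
  assumes r: "0 < r" "r < 1"
begin

lemma Theta_state_clin: "bounded_clinear (Theta_state r)"
proof -
  have "bounded_clinear (\<lambda>\<eta>. of_real r *\<^sub>C row_shift (ell2_map E \<eta>))"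
    by (intro clin_scale_op clin_comp[OF row_shift_clin] ell2_map_clin E_clin)
  from clin_comp[OF C.resolvent_clin this] show ?thesis
    using r by (simp add: Theta_state_def[abs_def] scaleC_of_real)
qed

lemma Theta_rad_clin: "bounded_clinear (Theta_rad r)"
  unfolding Theta_rad_def[abs_def]
  by (intro clin_diff_op clin_comp[OF _ Theta_state_clin] ell2_map_clin D_clin R_clin)

lemma Theta_state_eq: "Theta_state r \<eta> = r *\<^sub>R row_shift (ell2_map A (Theta_state r \<eta>) + ell2_map E \<eta>)"
proof -
  have "Theta_state r \<eta> - r *\<^sub>R transfer_op (Theta_state r \<eta>) = r *\<^sub>R row_shift (ell2_map E \<eta>)"
    unfolding Theta_state_def by (rule C.resolvent_eq) (use r in auto)
  then show ?thesis
    by (simp add: transfer_op_def clin_add[OF row_shift_clin] scaleR_add_right diff_eq_eq add.commute)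
qed

lemma Theta_state_nth: "ell2_nth (Theta_state r \<eta>) [] = 0"
  "ell2_nth (Theta_state r \<eta>) (w @ [i]) = r *\<^sub>R ((A (ell2_nth (Theta_state r \<eta>) w) + E (ell2_nth \<eta> w)) $ i)"
  by (subst Theta_state_eq, simp add: row_shift_nth ell2_map_nth A_clin E_clin)+

text \<open>The Julia identity at every coordinate balances total energies. The state is
  \<open>r\<close> times the shifted \<open>z\<close>, so it is no larger than \<open>z\<close>, and
  what remains bounds the output by the input, uniformly in \<open>r\<close>.\<close>

lemma Theta_rad_norm: "norm (Theta_rad r \<eta>) \<le> norm \<eta>"
proof -
  let ?x = "Theta_state r \<eta>"
  define z where "z = ell2_map A ?x + ell2_map E \<eta>"
  have "((\<lambda>w. (norm (ell2_nth z w))\<^sup>2 + (norm (ell2_nth (Theta_rad r \<eta>) w))\<^sup>2) has_sum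
      (norm z)\<^sup>2 + (norm (Theta_rad r \<eta>))\<^sup>2) UNIV"
    by (intro has_sum_add norm_sq_ell2_has_sum)
  moreover have "(norm (ell2_nth z w))\<^sup>2 + (norm (ell2_nth (Theta_rad r \<eta>) w))\<^sup>2
      = (norm (ell2_nth ?x w))\<^sup>2 + (norm (ell2_nth \<eta> w))\<^sup>2" for w
    by (simp add: z_def Theta_rad_def ell2_map_nth A_clin E_clin D_clin R_clin julia)
  ultimately have "((\<lambda>w. (norm (ell2_nth ?x w))\<^sup>2 + (norm (ell2_nth \<eta> w))\<^sup>2) has_sum
      (norm z)\<^sup>2 + (norm (Theta_rad r \<eta>))\<^sup>2) UNIV" by simp
  then have "(norm z)\<^sup>2 + (norm (Theta_rad r \<eta>))\<^sup>2 = (norm ?x)\<^sup>2 + (norm \<eta>)\<^sup>2"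
    by (rule has_sum_unique) (intro has_sum_add norm_sq_ell2_has_sum)
  moreover have "(norm ?x)\<^sup>2 \<le> (norm z)\<^sup>2"
  proof -
    have "norm ?x = r * norm z"
      by (subst Theta_state_eq) (use r in \<open>simp add: row_shift_norm z_def\<close>)
    also have "\<dots> \<le> norm z" using r by (simp add: mult_left_le_one_le)
    finally show ?thesis by (simp add: power_mono)
  qed
  ultimately have "(norm (Theta_rad r \<eta>))\<^sup>2 \<le> (norm \<eta>)\<^sup>2" by linarith
  then show ?thesis by (simp add: power2_le_iff_abs_le)
qed

text \<open>Appending a letter multiplies the damping weight by \<open>r\<close>, exactly the factor
  in the damped recursion, so the weighted undamped state solves that recursion.\<close>

lemma Theta_rad_radial: "Theta_rad r (radial r \<eta>) = radial r (Theta \<eta>)"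
proof -
  have st: "ell2_nth (Theta_state r (radial r \<eta>)) w = r ^ length w *\<^sub>R state 0 (ell2_nth \<eta>) w" for w
  proof (induction w rule: rev_induct)
    case (snoc i w)
    then show ?case
      using r by (simp add: Theta_state_nth state_snoc radial_nth clin_scaleR[OF A_clin] clin_scaleR[OF E_clin]
          scaleR_add_right)
  qed (simp add: Theta_state_nth state_Nil)
  show ?thesis
    using r by (intro ell2_eqI) (simp add: Theta_rad_def ell2_map_nth D_clin R_clin st radial_nth Theta_def
        Omega_nth sys_output_def clin_scaleR[OF D_clin] clin_scaleR[OF R_clin] scaleR_diff_right)
qed

end

text \<open>\<open>Theta_rad r \<circ> radial r = radial r \<circ> Theta\<close> upgrades coordinatewise to strong convergence.\<close>

lemma Theta_rad_tendsto: "((\<lambda>r. Theta_rad r \<eta>) \<longlongrightarrow> Theta \<eta>) (at_left 1)"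
proof -
  have "((\<lambda>r. norm (\<eta> - radial r \<eta>)) \<longlongrightarrow> norm (\<eta> - \<eta>)) (at_left 1)"
    by (intro tendsto_intros radial_tendsto)
  then have "((\<lambda>r. norm (\<eta> - radial r \<eta>)) \<longlongrightarrow> 0) (at_left 1)" by simp
  moreover have "\<forall>\<^sub>F r in at_left 1. norm (Theta_rad r \<eta> - radial r (Theta \<eta>)) \<le> norm (\<eta> - radial r \<eta>)"
    using eventually_at_left_1
  proof (rule eventually_mono)
    fix r :: real assume r: "0 < r \<and> r < 1"
    then have "Theta_rad r \<eta> - radial r (Theta \<eta>) = Theta_rad r (\<eta> - radial r \<eta>)"
      by (simp add: Theta_rad_radial clin_diff[OF Theta_rad_clin])
    then show "norm (Theta_rad r \<eta> - radial r (Theta \<eta>)) \<le> norm (\<eta> - radial r \<eta>)"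
      using Theta_rad_norm r by simp
  qed
  ultimately have "((\<lambda>r. Theta_rad r \<eta> - radial r (Theta \<eta>)) \<longlongrightarrow> 0) (at_left 1)"
    by (rule Lim_null_comparison[rotated])
  from tendsto_add[OF this radial_tendsto[of "Theta \<eta>"]] show ?thesis by simp
qed


subsection \<open>Defect spaces\<close>

lemma range_clin_subspace: "bounded_clinear B \<Longrightarrow> complex_vector.subspace (range B)"
  by (rule complex_vector.subspaceI)
    (auto simp: image_iff simp flip: clin_add clin_scaleC, metis clin_zero)

lemma defect_space_closed: "closed_csubspace (defect_space T)"
  unfolding defect_space_def by (rule closed_csubspace_closure[OF range_clin_subspace[OF D_clin]])

lemma defect_space_adj_closed: "closed_csubspace (defect_space_adj T)"
  unfolding defect_space_adj_def by (rule closed_csubspace_closure[OF range_clin_subspace[OF E_clin]])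

lemma D_in: "D x \<in> defect_space T" and E_in: "E v \<in> defect_space_adj T"
  unfolding defect_space_def defect_space_adj_def by (rule closure_subset[THEN subsetD, OF rangeI])+

lemma closure_range_minimal:
  assumes "closed_csubspace M" "range B \<subseteq> M" "x \<in> closure (range B)"
  shows "x \<in> M"
  using closure_minimal[of "range B" M] assms unfolding closed_csubspace_def by blast

lemma Proj_defect_zero_iff: "Proj (defect_space T) x = 0 \<longleftrightarrow> D x = 0"
proof
  assume "Proj (defect_space T) x = 0"
  then have "cinner x (D (D x)) = 0"
    using D_in by (simp add: Proj_eq_zero_iff[OF defect_space_closed])
  then show "D x = 0" by (simp add: cinner_same flip: D_selfadjoint)
next
  assume x: "D x = 0"
  have "defect_space T \<subseteq> UNIV \<ominus> {x}"
    unfolding defect_space_def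
  proof (rule closure_minimal)
    show "closed (UNIV \<ominus> {x})" using ortho_complement_closed closed_csubspaceD(1) by blast
    show "range D \<subseteq> UNIV \<ominus> {x}" by (auto simp: ortho_diff_def D_selfadjoint x)
  qed
  then show "Proj (defect_space T) x = 0"
    unfolding Proj_eq_zero_iff[OF defect_space_closed] ortho_diff_def using cinner_swap_zero by blast
qed

lemma Proj_D: "Proj (defect_space T) (D x) = D x"
  by (rule Proj_id[OF defect_space_closed D_in])

lemma E_Proj: "E (Proj (defect_space_adj T) v) = E v"
proof -
  let ?u = "v - Proj (defect_space_adj T) v"
  have "cinner ?u (E (E ?u)) = 0" by (rule Proj_ortho[OF defect_space_adj_closed E_in])
  then have "E ?u = 0" by (simp add: cinner_same flip: E_selfadjoint)
  then show ?thesis by (simp add: clin_diff[OF E_clin])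
qed

lemma R_defect_space: "v \<in> defect_space_adj T \<Longrightarrow> R v \<in> defect_space T"
proof -
  let ?M = "{v. \<forall>i\<in>{()}. Proj (defect_space T) (R v) - R v = 0}"
  assume "v \<in> defect_space_adj T"
  then have "v \<in> ?M"
    unfolding defect_space_adj_def
  proof (rule closure_range_minimal[rotated 2])
    show "closed_csubspace ?M"
      by (intro closed_csubspace_zero_set clin_diff_op clin_comp[OF _ R_clin] Proj_clin defect_space_closed R_clin)
    show "range E \<subseteq> ?M" by (auto simp: R_E Proj_D)
  qed
  then show ?thesis
    using Proj_in[OF defect_space_closed, of "R v"] by simp
qed

text \<open>\<open>E\<close> vanishes on the complement of \<open>defect_space_adj T\<close>, so
  \<open>R_E\<close> sends that complement under \<open>R\<close> into the kernel of
  \<open>D\<close>, which the projection removes.\<close>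

lemma Proj_R_Proj:
  "Proj (defect_space T) (R (Proj (defect_space_adj T) v)) = Proj (defect_space T) (R v)"
proof -
  let ?u = "v - Proj (defect_space_adj T) v"
  have "D (R ?u) = R (E ?u)" by (simp add: R_E)
  also have "\<dots> = 0" by (simp add: clin_diff[OF E_clin] E_Proj clin_zero[OF R_clin])
  finally have "Proj (defect_space T) (R ?u) = 0" by (simp add: Proj_defect_zero_iff)
  then show ?thesis by (simp add: clin_diff[OF R_clin] clin_diff[OF Proj_clin[OF defect_space_closed]])
qed

end


subsection \<open>Compression to a coinvariant subspace\<close>

text \<open>\<open>N_coinvariant\<close> expresses invariance of \<open>N\<close> under the adjoints
  of the right creation operators: a compression after right creation makes one before it
  redundant.\<close>

locale coinvariant_row_contr = row_contr T for T :: "'n::finite \<Rightarrow> 'h \<Rightarrow> 'h::complex_hilbert" +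
  fixes N :: "'n fock set"
  assumes N_closed: "closed_csubspace N"
    and N_coinvariant: "Proj N (right_creation i (Proj N \<phi>)) = Proj N (right_creation i \<phi>)"
begin

abbreviation "P \<equiv> amp_Proj N"
abbreviation "W i \<equiv> Proj N \<circ> right_creation i \<circ> Proj N"
abbreviation "PT \<equiv> Proj (N \<otimes>\<^sub>S defect_space T)"
abbreviation "PE \<equiv> Proj (N \<otimes>\<^sub>S defect_space_adj T)"

lemmas P_clin = amp_Proj_clin[of N]
lemmas P_map = amp_Proj_map[OF N_closed]
lemmas P_tensor = amp_Proj_tensor[OF N_closed]

lemma P_idem: "P (P x) = P x"
  by (rule Proj_idem[OF tensor_space_closed])

lemma PT_eq: "PT x = ell2_map (Proj (defect_space T)) (P x)"
  by (rule Proj_tensor_space[OF N_closed defect_space_closed])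

lemma PE_eq: "PE x = ell2_map (Proj (defect_space_adj T)) (P x)"
  by (rule Proj_tensor_space[OF N_closed defect_space_adj_closed])

lemma P_rshift_P_clin: "bounded_clinear (\<lambda>x. P (rshift i (P x)))"
  by (rule clin_comp[OF P_clin clin_comp[OF rshift_clin P_clin]])

lemma P_rshift: "P (rshift i (P x)) = P (rshift i (x :: ('n list, 'a::complex_hilbert) ell2))"
  by (rule clin_eq_on_kets[of "\<lambda>x. P (rshift i (P x))" "\<lambda>x. P (rshift i x)"])
    (simp_all add: P_tensor rshift_tensor N_coinvariant P_rshift_P_clin clin_comp[OF P_clin rshift_clin])

lemma P_row_shift: "P (row_shift (P \<eta>)) = P (row_shift \<eta>)"
proof -
  have "P (rshift i (ell2_map (\<lambda>v. v $ i) (P \<eta>))) = P (rshift i (ell2_map (\<lambda>v. v $ i) \<eta>))" for i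
    by (metis P_map vec_nth_clin P_rshift)
  then show ?thesis by (simp add: row_shift_def clin_sum[OF P_clin])
qed

lemma P_transfer: "P (transfer_op (P x)) = P (transfer_op x)"
  unfolding transfer_op_def by (metis A_clin P_map P_row_shift)

lemma scaled_W_amplification:
  assumes "bounded_clinear B"
  shows "(\<lambda>\<phi>. complex_of_real r *\<^sub>C W i \<phi>) \<otimes>\<^sub>O B = (\<lambda>x. r *\<^sub>R P (rshift i (P (ell2_map B x))))"
proof -
  have "(\<lambda>\<phi>. complex_of_real r *\<^sub>C W i \<phi>) \<otimes>\<^sub>O B = (\<lambda>x. complex_of_real r *\<^sub>C P (rshift i (P (ell2_map B x))))"
    by (rule tensor_op_amplify[of "\<lambda>x. complex_of_real r *\<^sub>C P (rshift i (P x))"])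
      (simp_all add: assms P_tensor rshift_tensor clin_scaleC[OF tensor_clin_left] clin_scale_op P_rshift_P_clin)
  then show ?thesis by (simp add: scaleC_of_real)
qed

lemma sum_W_P: "(\<Sum>i\<in>UNIV. r *\<^sub>R P (rshift i (P (ell2_map (cadjoint (T i)) x)))) = r *\<^sub>R P (transfer_op x)"
  by (simp add: P_rshift transfer_op_sum clin_sum[OF P_clin] scaleR_sum_right)

sublocale PC: hilbert_contraction "\<lambda>x. P (transfer_op x)"
proof
  show "bounded_clinear (\<lambda>x. P (transfer_op x))" by (rule clin_comp[OF P_clin C.C_clin])
  show "norm (P (transfer_op x)) \<le> norm x" for x
    using order_trans[OF Proj_norm_le[OF tensor_space_closed] C.C_norm] .
qed

context
  fixes r :: real
  assumes r: "0 < r" "r < 1"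
begin

text \<open>Coinvariance passes to the resolvent: the difference of the two solutions compresses to
  a solution of the homogeneous compressed equation, which must be zero.\<close>

lemma P_resolvent: "P (C.resolvent r (P f)) = P (C.resolvent r f)"
proof -
  have r': "0 \<le> r" "r < 1" using r by auto
  define x where "x = C.resolvent r (P f) - C.resolvent r f"
  have "x - r *\<^sub>R transfer_op x = P f - f"
  proof -
    have "x - r *\<^sub>R transfer_op x = (C.resolvent r (P f) - r *\<^sub>R transfer_op (C.resolvent r (P f)))
        - (C.resolvent r f - r *\<^sub>R transfer_op (C.resolvent r f))"
      by (simp add: x_def clin_diff[OF C.C_clin] scaleR_diff_right)
    then show ?thesis unfolding C.resolvent_eq[OF r'] .
  qed
  then have "P (x - r *\<^sub>R transfer_op x) = 0" by (simp add: clin_diff[OF P_clin] P_idem)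
  then have "P x - r *\<^sub>R P (transfer_op (P x)) = 0 - r *\<^sub>R P (transfer_op 0)"
    unfolding P_transfer clin_diff[OF P_clin] clin_scaleR[OF P_clin] by (simp add: clin_zero[OF C.C_clin] clin_zero[OF P_clin])
  then have "P x = 0" by (rule PC.fixpoint_unique[OF r'])
  then show ?thesis by (simp add: x_def clin_diff[OF P_clin])
qed

lemma P_Theta_state: "P (Theta_state r (P \<eta>)) = P (Theta_state r \<eta>)"
proof -
  have "P (r *\<^sub>R row_shift (ell2_map E (P \<eta>))) = P (r *\<^sub>R row_shift (ell2_map E \<eta>))"
    by (simp add: clin_scaleR[OF P_clin] P_row_shift flip: P_map[OF E_clin])
  then show ?thesis unfolding Theta_state_def by (metis P_resolvent)
qed

lemma P_Theta_rad: "P (Theta_rad r (P \<eta>)) = P (Theta_rad r \<eta>)"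
  unfolding Theta_rad_def clin_diff[OF P_clin] P_map[OF D_clin] P_map[OF R_clin] P_Theta_state P_idem ..

lemma PT_Theta_rad_PE: "PT (Theta_rad r (PE \<eta>)) = PT (Theta_rad r \<eta>)"
proof -
  have DE: "bounded_clinear (Proj (defect_space_adj T))" "bounded_clinear (Proj (defect_space T))"
    by (intro Proj_clin defect_space_adj_closed defect_space_closed)+
  have "Theta_state r (ell2_map (Proj (defect_space_adj T)) x) = Theta_state r x" for x
    unfolding Theta_state_def ell2_map_comp[OF E_clin DE(1)] E_Proj ..
  moreover have "ell2_map (Proj (defect_space T)) (ell2_map R (ell2_map (Proj (defect_space_adj T)) x))
      = ell2_map (Proj (defect_space T)) (ell2_map R x)" for x
    by (rule ell2_eqI) (simp add: ell2_map_nth DE R_clin Proj_R_Proj)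
  ultimately have e: "ell2_map (Proj (defect_space T)) (Theta_rad r (ell2_map (Proj (defect_space_adj T)) x))
      = ell2_map (Proj (defect_space T)) (Theta_rad r x)" for x
    by (simp add: Theta_rad_def clin_diff[OF ell2_map_clin[OF DE(2)]])
  have "PT (Theta_rad r (PE \<eta>)) = P (ell2_map (Proj (defect_space T)) (Theta_rad r (P \<eta>)))"
    unfolding PT_eq PE_eq P_map[OF DE(2), symmetric] e ..
  also have "\<dots> = PT (Theta_rad r \<eta>)"
    unfolding PT_eq P_map[OF DE(2)] P_Theta_rad ..
  finally show ?thesis .
qed

text \<open>The inverse in the definition lives on \<open>N \<otimes>\<^sub>S UNIV\<close>.
  Compressing the equation of \<open>Theta_state\<close> shows that
  \<open>P (Theta_state r \<eta>)\<close> solves the compressed equation, and injectivity identifies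
  it with the value of \<open>inv_into\<close>.\<close>

lemma char_expression_eq:
  "char_expression N (\<lambda>i \<phi>. complex_of_real r *\<^sub>C W i \<phi>) T \<xi> = PT (Theta_rad r \<xi>)"
proof -
  have r': "0 \<le> r" "r < 1" using r by auto
  define \<eta> where "\<eta> = PE \<xi>"
  have DE: "bounded_clinear (Proj (defect_space_adj T))" "bounded_clinear (Proj (defect_space T))"
    by (intro Proj_clin defect_space_adj_closed defect_space_closed)+
  have P\<eta>: "P \<eta> = \<eta>"
    unfolding \<eta>_def PE_eq by (simp add: P_map[OF DE(1)] P_idem)
  have \<eta>_nth: "ell2_nth \<eta> w \<in> defect_space_adj T" for w
    unfolding \<eta>_def PE_eq by (simp add: ell2_map_nth DE Proj_in defect_space_adj_closed)
  define \<zeta> where "\<zeta> = P (r *\<^sub>R row_shift (ell2_map E \<eta>))"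
  define L where "L = (\<lambda>x. x - r *\<^sub>R P (transfer_op x))"
  define u where "u = P (Theta_state r \<eta>)"
  have s: "(\<Sum>i\<in>UNIV. ((\<lambda>\<phi>. complex_of_real r *\<^sub>C W i \<phi>) \<otimes>\<^sub>O (\<lambda>v. v $ i)) ((Proj N \<otimes>\<^sub>O E) \<eta>)) = \<zeta>"
    unfolding scaled_W_amplification[OF vec_nth_clin] tensor_op_Proj[OF N_closed E_clin] \<zeta>_def row_shift_def
    by (simp add: P_map E_clin P\<eta> P_rshift clin_sum[OF P_clin] clin_scaleR[OF P_clin] scaleR_sum_right)
  have "L u = P (Theta_state r \<eta> - r *\<^sub>R transfer_op (Theta_state r \<eta>))"
    unfolding L_def u_def P_transfer by (simp add: clin_simps[OF P_clin])
  also have "\<dots> = \<zeta>"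
    unfolding \<zeta>_def Theta_state_def C.resolvent_eq[OF r'] ..
  finally have Lu: "L u = \<zeta>" .
  have inj: "inj_on L (N \<otimes>\<^sub>S UNIV)"
    unfolding L_def by (rule inj_onI) (rule PC.fixpoint_unique[OF r'])
  have inv: "inv_into (N \<otimes>\<^sub>S UNIV) L \<zeta> = u"
    by (rule inv_into_f_eq[OF inj _ Lu]) (simp add: u_def Proj_in tensor_space_closed)
  have L: "(\<lambda>x. x - (\<Sum>i\<in>UNIV. ((\<lambda>\<phi>. complex_of_real r *\<^sub>C W i \<phi>) \<otimes>\<^sub>O cadjoint (T i)) x)) = L"
    unfolding scaled_W_amplification[OF cadjoint_clin[OF T_clin]] sum_W_P L_def ..
  have "char_expression N (\<lambda>i \<phi>. complex_of_real r *\<^sub>C W i \<phi>) T \<xi> =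
      - (Proj N \<otimes>\<^sub>O R) \<eta> + (Proj N \<otimes>\<^sub>O D) u"
    unfolding char_expression_def Let_def \<eta>_def[symmetric] s L inv ..
  also have "\<dots> = P (Theta_rad r \<eta>)"
    unfolding tensor_op_Proj[OF N_closed R_clin] tensor_op_Proj[OF N_closed D_clin] Theta_rad_def u_def
    by (simp add: P_map D_clin P_idem clin_diff[OF P_clin])
  also have "\<dots> = PT (Theta_rad r \<eta>)"
  proof -
    \<comment> \<open>The coordinates of \<open>\<eta>\<close> lie in
      \<open>defect_space_adj T\<close>, which \<open>R\<close> maps into
      \<open>defect_space T\<close>; so the outer projection can be inserted.\<close>
    have "ell2_map (Proj (defect_space T)) (Theta_rad r \<eta>) = Theta_rad r \<eta>"
      by (rule ell2_eqI) (simp add: Theta_rad_def ell2_map_nth DE D_clin R_clin clin_diff[OF DE(2)] Proj_D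
          Proj_id[OF defect_space_closed R_defect_space[OF \<eta>_nth]])
    then show ?thesis unfolding PT_eq by (metis P_map DE(2))
  qed
  also have "\<dots> = PT (Theta_rad r \<xi>)" unfolding \<eta>_def by (rule PT_Theta_rad_PE)
  finally show ?thesis .
qed

end

lemma PT_Theta_PE: "PT (Theta (PE \<eta>)) = PT (Theta \<eta>)"
proof (rule tendsto_unique)
  show "((\<lambda>r. PT (Theta_rad r \<eta>)) \<longlongrightarrow> PT (Theta \<eta>)) (at_left 1)"
    by (rule clin_tendsto[OF Proj_clin[OF tensor_space_closed] Theta_rad_tendsto])
  have "((\<lambda>r. PT (Theta_rad r (PE \<eta>))) \<longlongrightarrow> PT (Theta (PE \<eta>))) (at_left 1)"
    by (rule clin_tendsto[OF Proj_clin[OF tensor_space_closed] Theta_rad_tendsto])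
  then show "((\<lambda>r. PT (Theta_rad r \<eta>)) \<longlongrightarrow> PT (Theta (PE \<eta>))) (at_left 1)"
    by (rule Lim_transform_eventually)
      (use eventually_at_left_1 in \<open>rule eventually_mono\<close>, simp add: PT_Theta_rad_PE)
qed simp

end


section \<open>The noncommutative analytic Toeplitz algebra\<close>

abbreviation lshift :: "'n \<Rightarrow> ('n list, 'a::complex_hilbert) ell2 \<Rightarrow> ('n list, 'a) ell2" where
  "lshift i \<equiv> ell2_push ((#) i)"

lemma lshift_nth: "ell2_nth (lshift i x) [] = 0"
  "ell2_nth (lshift i x) (j # w) = (if i = j then ell2_nth x w else 0)"
  using ell2_push_nth[of "(#) i" x w] ell2_push_nth_out[of _ "(#) i" x] by (auto simp: image_iff)

lemma lshift_clin: "bounded_clinear (lshift i)"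
  by (rule ell2_push_clin) simp

lemma lshift_tensor: "lshift i (\<phi> \<otimes> h) = left_creation i \<phi> \<otimes> h"
proof (rule ell2_eqI)
  fix w show "ell2_nth (lshift i (\<phi> \<otimes> h)) w = ell2_nth (left_creation i \<phi> \<otimes> h) w"
    by (cases w) (auto simp: lshift_nth tensor.rep_eq left_creation.rep_eq)
qed

lemma left_creation_clin: "bounded_clinear (left_creation i)"
proof -
  have "left_creation i \<phi> = lshift i \<phi>" for \<phi>
  proof (rule ell2_eqI)
    show "ell2_nth (left_creation i \<phi>) w = ell2_nth (lshift i \<phi>) w" for w
      by (cases w) (auto simp: lshift_nth left_creation.rep_eq)
  qed
  then have "left_creation i = lshift i" by blast
  then show ?thesis using lshift_clin[of i] by simp
qed

lemma right_creation_clin: "bounded_clinear (right_creation i)"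
proof -
  have "right_creation i \<phi> = rshift i \<phi>" for \<phi>
  proof (rule ell2_eqI)
    show "ell2_nth (right_creation i \<phi>) w = ell2_nth (rshift i \<phi>) w" for w
      by (cases w rule: rev_cases) (auto simp: rshift_nth right_creation.rep_eq)
  qed
  then have "right_creation i = rshift i" by blast
  then show ?thesis using rshift_clin[of i] by simp
qed

lemma left_right_creation_commute:
  "left_creation i (right_creation j \<phi>) = right_creation j (left_creation i \<phi>)"
proof (rule ell2_eqI)
  fix w
  show "ell2_nth (left_creation i (right_creation j \<phi>)) w = ell2_nth (right_creation j (left_creation i \<phi>)) w"
  proof (cases w)
    case (Cons a v)
    then show ?thesis
      by (cases v rule: rev_cases) (auto simp: left_creation.rep_eq right_creation.rep_eq)
  qed (simp add: left_creation.rep_eq right_creation.rep_eq)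
qed

text \<open>Moving \<open>R i\<close> to the other side by its adjoint writes each commutation
  relation as the vanishing of a difference of two WOT-continuous functionals of
  \<open>A\<close>.\<close>

lemma commutant_WOT_closed:
  fixes R :: "'i \<Rightarrow> 'a::complex_hilbert \<Rightarrow> 'a"
  assumes R: "\<And>i. bounded_clinear (R i)"
  shows "closedin WOT {A. bounded_clinear A \<and> (\<forall>i x. A (R i x) = R i (A x))}"
proof -
  define g where "g = (\<lambda>(i, x, y) A. cinner (A (R i x)) y - cinner (A x) (cadjoint (R i) y))"
  have "closedin WOT (\<Inter>k\<in>UNIV. {A \<in> topspace WOT. g k A \<in> {0}})"
  proof (rule closedin_INT)
    fix k
    have "continuous_map WOT euclidean (g k)"
      unfolding g_def by (cases k) (simp add: continuous_map_diff continuous_map_WOT)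
    then show "closedin WOT {A \<in> topspace WOT. g k A \<in> {0}}"
      by (rule closedin_continuous_map_preimage) simp
  qed simp
  also have "(\<Inter>k\<in>UNIV. {A \<in> topspace WOT. g k A \<in> {0}})
      = {A. bounded_clinear A \<and> (\<forall>i x. A (R i x) = R i (A x))}"
  proof (intro set_eqI iffI)
    fix A assume "A \<in> (\<Inter>k\<in>UNIV. {A \<in> topspace WOT. g k A \<in> {0}})"
    then have A: "A \<in> topspace WOT" and g: "\<And>k. g k A = 0" by auto
    have "A (R i x) = R i (A x)" for i x
      by (rule cinner_ext) (use g[of "(i, x, _)"] in \<open>simp add: g_def cinner_cadjoint[OF R]\<close>)
    then show "A \<in> {A. bounded_clinear A \<and> (\<forall>i x. A (R i x) = R i (A x))}"
      using A by (simp add: WOT_def topspace_pullback_topology)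
  next
    fix A assume "A \<in> {A. bounded_clinear A \<and> (\<forall>i x. A (R i x) = R i (A x))}"
    then show "A \<in> (\<Inter>k\<in>UNIV. {A \<in> topspace WOT. g k A \<in> {0}})"
      by (auto simp: g_def cinner_cadjoint[OF R] WOT_def topspace_pullback_topology)
  qed
  finally show ?thesis .
qed

lemma generated_algebra_minimal:
  assumes "op_algebra V" "closedin \<tau> V" "G \<subseteq> V"
  shows "generated_algebra \<tau> G \<subseteq> V"
  unfolding generated_algebra_def using assms by blast

lemma generated_algebra_base: "G \<subseteq> generated_algebra \<tau> G"
  unfolding generated_algebra_def by blast

lemma generated_algebra_comp:
  assumes "A \<in> generated_algebra \<tau> G" "B \<in> generated_algebra \<tau> G"
  shows "A \<circ> B \<in> generated_algebra \<tau> G"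
  using assms unfolding generated_algebra_def by (auto simp: op_algebra_def)

text \<open>The commutant of the right creation operators is itself a WOT-closed algebra containing
  the generators.\<close>

lemma F_infinity_commutes:
  assumes "A \<in> F_infinity"
  shows "bounded_clinear A" "A (right_creation i \<phi>) = right_creation i (A \<phi>)"
proof -
  let ?V = "{A. bounded_clinear A \<and> (\<forall>i \<phi>. A (right_creation i \<phi>) = right_creation i (A \<phi>))}"
  have "F_infinity \<subseteq> ?V"
    unfolding F_infinity_def
  proof (rule generated_algebra_minimal)
    show "op_algebra ?V"
      unfolding op_algebra_def op_subspace_def
      by (auto intro: clin_zero_op clin_add_op clin_scale_op clin_o simp: clin_simps[OF right_creation_clin])
    show "closedin WOT ?V" by (rule commutant_WOT_closed[OF right_creation_clin])
    show "insert (\<lambda>\<phi>. \<phi>) (range left_creation) \<subseteq> ?V"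
      by (auto simp: clin_id left_creation_clin left_right_creation_commute)
  qed
  then show "bounded_clinear A" "A (right_creation i \<phi>) = right_creation i (A \<phi>)"
    using assms by blast+
qed

text \<open>The functional calculus sees only \<open>f (ket [])\<close>. Composing \<open>f\<close>
  on the right with these operators stays in the ideal and makes \<open>f (ket \<alpha>)\<close> the
  visible vector.\<close>

lemma left_creation_word: "word_op left_creation \<alpha> \<in> F_infinity" "word_op left_creation \<alpha> (ket []) = ket \<alpha>"
proof -
  show "word_op left_creation \<alpha> (ket []) = ket \<alpha>"
    by (induction \<alpha>) (auto simp: word_op_Cons left_creation_ket)
  show "word_op left_creation \<alpha> \<in> F_infinity"
  proof (induction \<alpha>)
    case Nil
    show ?case unfolding F_infinity_def word_op_Nil by (rule generated_algebra_base[THEN subsetD]) simp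
  next
    case (Cons i \<alpha>)
    have "left_creation i \<in> F_infinity"
      unfolding F_infinity_def by (rule generated_algebra_base[THEN subsetD]) simp
    from generated_algebra_comp[OF this[unfolded F_infinity_def] Cons[unfolded F_infinity_def]]
    show ?case by (simp add: F_infinity_def word_op_Cons comp_def)
  qed
qed

section \<open>The constrained subspace and its coinvariance\<close>

lemma N_space_closed: "closed_csubspace (N_space J)"
  unfolding N_space_def by (rule ortho_complement_closed)

text \<open>Elements of \<open>J\<close> commute with right creation, so the closed span
  \<open>M\<close> of their ranges is invariant under it, and \<open>N_space J\<close> is the
  complement of \<open>M\<close>.\<close>

lemma N_space_coinvariant:
  assumes J: "J \<subseteq> F_infinity"
  shows "Proj (N_space J) (right_creation i (Proj (N_space J) \<phi>)) = Proj (N_space J) (right_creation i \<phi>)"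
proof -
  define M where "M = closure (complex_vector.span {f \<phi> | f \<phi>. f \<in> J})"
  have M: "closed_csubspace M"
    unfolding M_def by (rule closed_csubspace_closure) (rule complex_vector.subspace_span)
  have N: "Proj (N_space J) x = x - Proj M x" for x
    unfolding N_space_def M_def[symmetric] by (rule Proj_ortho_complement[OF M])
  let ?S = "{x. \<forall>u\<in>{()}. right_creation i x - Proj M (right_creation i x) = 0}"
  have "M \<subseteq> ?S"
    unfolding M_def
  proof (rule closure_span_le)
    show "closed_csubspace {x. \<forall>u\<in>{()}. right_creation i x - Proj (closure (complex_vector.span {f \<phi> | f \<phi>. f \<in> J})) (right_creation i x) = 0}"
      unfolding M_def[symmetric]
      by (intro closed_csubspace_zero_set clin_diff_op clin_comp[OF Proj_clin[OF M]] right_creation_clin)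
    have "right_creation i (f \<phi>) \<in> M" if "f \<in> J" for f \<phi>
    proof -
      have "right_creation i (f \<phi>) = f (right_creation i \<phi>)"
        by (rule F_infinity_commutes(2)[OF subsetD[OF J that], symmetric])
      moreover have "f (right_creation i \<phi>) \<in> complex_vector.span {f \<phi> | f \<phi>. f \<in> J}"
        by (rule complex_vector.span_base) (use that in blast)
      ultimately show ?thesis
        unfolding M_def by (simp add: subsetD[OF closure_subset])
    qed
    then show "{f \<phi> | f \<phi>. f \<in> J} \<subseteq> {x. \<forall>u\<in>{()}. right_creation i x - Proj (closure (complex_vector.span {f \<phi> | f \<phi>. f \<in> J})) (right_creation i x) = 0}"
      unfolding M_def[symmetric] by (auto simp: Proj_id[OF M])
  qed
  then have "right_creation i (Proj M \<phi>) - Proj M (right_creation i (Proj M \<phi>)) = 0"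
    using Proj_in[OF M, of \<phi>] by blast
  then show ?thesis
    by (simp add: N clin_diff[OF right_creation_clin] clin_diff[OF Proj_clin[OF M]])
qed

lemma amp_Proj_fixed:
  assumes N: "closed_csubspace N" and y: "\<And>\<phi> k. cinner y ((\<phi> - Proj N \<phi>) \<otimes> k) = 0"
  shows "amp_Proj N y = y"
proof (rule ell2_eqI, rule cinner_ext)
  fix w k
  have "cinner y (ket w \<otimes> k - amp_Proj N (ket w \<otimes> k)) = 0"
    using y[of "ket w" k] by (simp add: amp_Proj_tensor[OF N] clin_diff[OF tensor_clin_left])
  then have "cinner (amp_Proj N y) (ket w \<otimes> k) = cinner y (ket w \<otimes> k)"
    by (simp add: cinner_diff_right Proj_cinner[OF tensor_space_closed])
  then show "cinner (ell2_nth (amp_Proj N y) w) k = cinner (ell2_nth y w) k"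
    by (simp add: cinner_ket_tensor)
qed

text \<open>\<open>X'\<close> acts on the Fock factor and \<open>ell2_map C\<close> on the
  coefficients.\<close>

lemma amplification_map:
  fixes C :: "'a::complex_hilbert \<Rightarrow> 'a"
  assumes "bounded_clinear X'" "\<And>\<phi> h. X' (\<phi> \<otimes> h) = X \<phi> \<otimes> h" "bounded_clinear C"
  shows "ell2_map C (X' x) = X' (ell2_map C x)"
  by (rule clin_eq_on_kets[of "\<lambda>x. ell2_map C (X' x)" "\<lambda>x. X' (ell2_map C x)"])
    (simp_all add: clin_comp[OF ell2_map_clin[OF assms(3)] assms(1)] clin_comp[OF assms(1) ell2_map_clin[OF assms(3)]]
      assms(2) ell2_map_tensor[OF assms(3)])

section \<open>The Poisson kernel and the constraint\<close>

context pure_row_contr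
begin

lemma poisson_adjoint_ket: "cadjoint poisson (ket w \<otimes> k) = word_op T w (D k)"
proof (rule cinner_ext')
  fix a
  show "cinner a (cadjoint poisson (ket w \<otimes> k)) = cinner a (word_op T w (D k))"
    by (simp add: cinner_cadjoint[OF poisson_clin, symmetric] cinner_ket_tensor poisson_nth D_selfadjoint
        cinner_cadjoint'[OF word_op_clin[OF T_clin]])
qed

text \<open>Cutting a vector at word length \<open>m\<close> gives exactly the \<open>m\<close>-th
  partial sum by homogeneous parts, so the series converges by continuity of the adjoint of the
  Poisson kernel.\<close>

lemma poisson_adjoint_sums:
  assumes r: "0 \<le> r" "r \<le> 1"
  shows "(\<lambda>j. \<Sum>\<alpha> | length \<alpha> = j. (complex_of_real (r ^ length \<alpha>) * ell2_nth \<phi> \<alpha>) *\<^sub>C word_op T \<alpha> (D k))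
    sums cadjoint poisson (radial r (\<phi> \<otimes> k))"
proof -
  let ?K = "cadjoint poisson"
  have Kc: "bounded_clinear ?K" by (rule cadjoint_clin[OF poisson_clin])
  have "?K (truncate m (radial r (\<phi> \<otimes> k))) =
      (\<Sum>j<m. \<Sum>\<alpha> | length \<alpha> = j. (complex_of_real (r ^ length \<alpha>) * ell2_nth \<phi> \<alpha>) *\<^sub>C word_op T \<alpha> (D k))" for m
    unfolding truncate_eq_sum clin_sum[OF Kc] sum_words_less poisson_adjoint_ket
      radial_nth[OF r] tensor.rep_eq clin_scaleR[OF D_clin] clin_scaleC[OF D_clin]
      clin_scaleR[OF word_op_clin[OF T_clin]] clin_scaleC[OF word_op_clin[OF T_clin]]
      scaleC_scaleC[symmetric] scaleC_of_real ..
  moreover have "(\<lambda>m. ?K (truncate m (radial r (\<phi> \<otimes> k)))) \<longlonglongrightarrow> ?K (radial r (\<phi> \<otimes> k))"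
    by (rule clin_tendsto[OF Kc truncate_tendsto])
  ultimately show ?thesis unfolding sums_def by simp
qed

text \<open>The radial functional calculus at \<open>\<Delta>\<^sub>T k\<close> is the adjoint of the Poisson kernel applied
  to \<open>f(1) \<otimes> k\<close>.\<close>

lemma poisson_ortho_constraint:
  assumes "functional_calculus f T (\<lambda>_. 0)"
  shows "cinner (f (ket []) \<otimes> k) (poisson h) = 0"
proof -
  let ?K = "cadjoint poisson"
  have "((\<lambda>r. \<Sum>j. \<Sum>\<alpha> | length \<alpha> = j. (complex_of_real (r ^ length \<alpha>) * ell2_nth (f (ket [])) \<alpha>) *\<^sub>C word_op T \<alpha> (D k)) \<longlongrightarrow> 0) (at_left 1)"
    using assms unfolding functional_calculus_def limitin_SOT_iff by blast
  moreover have "\<forall>\<^sub>F r in at_left 1. (\<Sum>j. \<Sum>\<alpha> | length \<alpha> = j. (complex_of_real (r ^ length \<alpha>) * ell2_nth (f (ket [])) \<alpha>) *\<^sub>C word_op T \<alpha> (D k))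
      = ?K (radial r (f (ket []) \<otimes> k))"
    using eventually_at_left_1
  proof (rule eventually_mono)
    fix r :: real assume "0 < r \<and> r < 1"
    then show "(\<Sum>j. \<Sum>\<alpha> | length \<alpha> = j. (complex_of_real (r ^ length \<alpha>) * ell2_nth (f (ket [])) \<alpha>) *\<^sub>C word_op T \<alpha> (D k))
      = ?K (radial r (f (ket []) \<otimes> k))"
      by (intro sums_unique[symmetric] poisson_adjoint_sums) auto
  qed
  ultimately have "((\<lambda>r. ?K (radial r (f (ket []) \<otimes> k))) \<longlongrightarrow> 0) (at_left 1)"
    by (rule Lim_transform_eventually)
  moreover have "((\<lambda>r. ?K (radial r (f (ket []) \<otimes> k))) \<longlongrightarrow> ?K (f (ket []) \<otimes> k)) (at_left 1)"
    by (rule clin_tendsto[OF cadjoint_clin[OF poisson_clin] radial_tendsto])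
  ultimately have "?K (f (ket []) \<otimes> k) = 0"
    using tendsto_unique[OF trivial_limit_at_left_real] by blast
  then show ?thesis by (simp add: cinner_cadjoint'[OF poisson_clin, symmetric])
qed

text \<open>What the projection removes from \<open>\<phi>\<close> lies in the closed span
  \<open>M\<close> of the vectors \<open>f \<psi>\<close> with \<open>f\<close> in \<open>J\<close>;
  by density it suffices to take \<open>\<psi> = ket \<alpha>\<close>, where the constraint applies
  to \<open>f\<close> composed with left creations.\<close>

lemma poisson_in_constrained:
  assumes J: "WOT_closed_ideal J" and c: "constrained J T"
  shows "amp_Proj (N_space J) (poisson h) = poisson h"
proof (rule amp_Proj_fixed[OF N_space_closed])
  fix \<phi> :: "'n fock" and k :: 'h
  define M where "M = closure (complex_vector.span {f \<phi> | f \<phi>. f \<in> J})"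
  have M: "closed_csubspace M"
    unfolding M_def by (rule closed_csubspace_closure) (rule complex_vector.subspace_span)
  have JF: "J \<subseteq> F_infinity" "\<And>f g. f \<in> J \<Longrightarrow> g \<in> F_infinity \<Longrightarrow> f \<circ> g \<in> J"
    using J by (auto simp: WOT_closed_ideal_def)
  have gen: "cinner (f \<psi> \<otimes> k) (poisson h) = 0" if f: "f \<in> J" for f \<psi>
  proof -
    have fc: "bounded_clinear f" using F_infinity_commutes(1) JF(1) f by blast
    have "cinner (f (ket \<alpha>) \<otimes> k) (poisson h) = 0" for \<alpha>
    proof -
      have "f \<circ> word_op left_creation \<alpha> \<in> J" by (rule JF(2)[OF f left_creation_word(1)])
      then have "functional_calculus (f \<circ> word_op left_creation \<alpha>) T (\<lambda>_. 0)"
        using c by (simp add: constrained_def)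
      from poisson_ortho_constraint[OF this] show ?thesis by (simp add: left_creation_word(2))
    qed
    \<comment> \<open>With scalars as coefficient space, the density lemma for
      \<open>ket i \<otimes> h\<close> also covers the plain Fock space.\<close>
    moreover have "ket \<alpha> \<otimes> c = c *\<^sub>C ket \<alpha>" for \<alpha> :: "'n list" and c :: complex
      by (rule ell2_eqI) (simp add: tensor.rep_eq scaleC_complex_def mult.commute)
    ultimately show ?thesis
      by (intro clin_eq_on_kets[of "\<lambda>\<psi>. cinner (f \<psi> \<otimes> k) (poisson h)" "\<lambda>_. 0" \<psi>] clin_zero_op
          clin_comp[OF bounded_clinear_cinner_left clin_comp[OF tensor_clin_left fc]])
        (simp add: clin_scaleC[OF fc] clin_scaleC[OF tensor_clin_left] cinner_scaleC_left)
  qed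
  let ?S = "{\<psi>. \<forall>u\<in>{()}. cinner (\<psi> \<otimes> k) (poisson h) = 0}"
  have "M \<subseteq> ?S"
    unfolding M_def
    by (rule closure_span_le[OF closed_csubspace_zero_set[OF clin_comp[OF bounded_clinear_cinner_left tensor_clin_left]]])
      (auto simp: gen)
  then have "cinner (Proj M \<phi> \<otimes> k) (poisson h) = 0" using Proj_in[OF M, of \<phi>] by blast
  moreover have "\<phi> - Proj (N_space J) \<phi> = Proj M \<phi>"
    unfolding N_space_def M_def[symmetric] by (simp add: Proj_ortho_complement[OF M])
  ultimately show "cinner (poisson h) ((\<phi> - Proj (N_space J) \<phi>) \<otimes> k) = 0"
    using cinner_swap_zero by simp
qed

end


section \<open>The constrained characteristic function\<close>

locale constrained_row_contr = pure_row_contr T + coinvariant_row_contr T N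
  for T :: "'n::finite \<Rightarrow> 'h \<Rightarrow> 'h::complex_hilbert" and N :: "'n fock set" +
  assumes P_poisson: "P (poisson h) = poisson h"
begin

definition Theta_J :: "('n list, 'h ^ 'n) ell2 \<Rightarrow> ('n list, 'h) ell2" where
  "Theta_J \<eta> = PT (Theta \<eta>)"

abbreviation "K \<equiv> poisson"
abbreviation "K' \<equiv> cadjoint poisson"

lemmas PT_clin = Proj_clin[OF tensor_space_closed[of N "defect_space T"]]
  and PT_cinner = Proj_cinner[OF tensor_space_closed[of N "defect_space T"]]
  and PE_cinner = Proj_cinner[OF tensor_space_closed[of N "defect_space_adj T"]]
  and K'_clin = cadjoint_clin[OF poisson_clin]

lemma Theta_J_clin: "bounded_clinear Theta_J"
  unfolding Theta_J_def[abs_def] by (rule clin_comp[OF PT_clin Theta_clin])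

lemma Theta_J_PE: "Theta_J (PE \<eta>) = Theta_J \<eta>"
  unfolding Theta_J_def by (rule PT_Theta_PE)

lemma map_Proj_K: "ell2_map (Proj (defect_space T)) (K h) = K h"
  by (rule ell2_eqI) (simp add: ell2_map_nth Proj_clin defect_space_closed poisson_nth Proj_D)

lemma PT_K: "PT (K h) = K h"
  by (simp add: PT_eq P_poisson map_Proj_K)

lemma K'_PT: "K' (PT y) = K' y" and K'_P: "K' (P y) = K' y"
  by (rule cinner_ext', simp add: cinner_cadjoint[OF poisson_clin, symmetric] PT_K P_poisson
      PT_cinner[symmetric] Proj_cinner[OF tensor_space_closed, symmetric])+

lemma K'_K: "K' (K h) = h"
  by (rule poisson_adjoint(1))

lemma Theta_J_adjoint: "cadjoint Theta_J y = cadjoint Theta (PT y)"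
proof (rule cinner_ext')
  fix x
  show "cinner x (cadjoint Theta_J y) = cinner x (cadjoint Theta (PT y))"
    by (simp add: cinner_cadjoint[OF Theta_J_clin, symmetric] cinner_cadjoint[OF Theta_clin, symmetric]
        Theta_J_def PT_cinner)
qed

lemma Theta_J_coisometry: "Theta_J (cadjoint Theta_J y) = PT y - K (K' y)"
proof -
  have "Theta (cadjoint Theta (PT y)) = PT y - K (K' (PT y))"
    using resolution_of_identity[of "PT y"] by (simp add: algebra_simps)
  then show ?thesis
    unfolding Theta_J_adjoint Theta_J_def K'_PT
    by (simp add: clin_diff[OF PT_clin] PT_K Proj_idem[OF tensor_space_closed])
qed

lemma K'_Theta_J: "K' (Theta_J \<eta>) = 0"
  unfolding Theta_J_def K'_PT by (rule poisson_adjoint(2))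

text \<open>By the coisometry formula, \<open>x\<close> differs from \<open>z\<close>, its image
  under \<open>Theta_J\<close> followed by the adjoint, by a kernel vector \<open>v\<close>. Both
  \<open>x\<close> and \<open>z\<close> are orthogonal to \<open>v\<close>, so \<open>x = z\<close>,
  which is norm preservation.\<close>

lemma Theta_J_partial_isometry:
  "partial_isometry (N \<otimes>\<^sub>S defect_space_adj T) (N \<otimes>\<^sub>S defect_space T) Theta_J"
  unfolding partial_isometry_def ops_def
proof (intro conjI ballI CollectI)
  show "bounded_clinear Theta_J" by (rule Theta_J_clin)
  show "range Theta_J \<subseteq> N \<otimes>\<^sub>S defect_space T"
    unfolding Theta_J_def by (auto intro: Proj_in tensor_space_closed)
  show "Theta_J \<circ> PE = Theta_J" by (simp add: fun_eq_iff Theta_J_PE)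
  fix x assume x: "x \<in> N \<otimes>\<^sub>S defect_space_adj T \<ominus> {y \<in> N \<otimes>\<^sub>S defect_space_adj T. Theta_J y = 0}"
  define z where "z = cadjoint Theta_J (Theta_J x)"
  define v where "v = x - z"
  have "PE z = z"
    by (rule cinner_ext') (simp add: z_def cinner_cadjoint[OF Theta_J_clin, symmetric] Theta_J_PE
        PE_cinner[symmetric])
  then have "z \<in> N \<otimes>\<^sub>S defect_space_adj T" by (metis Proj_in tensor_space_closed)
  then have vM: "v \<in> N \<otimes>\<^sub>S defect_space_adj T"
    using x closed_csubspaceD(5)[OF tensor_space_closed] by (auto simp: v_def ortho_diff_def)
  have "PT (Theta_J x) = Theta_J x"
    unfolding Theta_J_def by (rule Proj_idem[OF tensor_space_closed])
  then have v0: "Theta_J v = 0"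
    unfolding v_def z_def clin_diff[OF Theta_J_clin] Theta_J_coisometry K'_Theta_J
    by (simp add: clin_zero[OF poisson_clin])
  then have "cinner x v = 0" using x vM by (auto simp: ortho_diff_def)
  moreover have "cinner z v = 0"
    unfolding z_def cinner_cadjoint'[OF Theta_J_clin] v0 by simp
  ultimately have "cinner v v = 0" by (subst (1) v_def) (simp add: cinner_diff_left)
  then have "x = z" by (simp add: cinner_same v_def)
  then have "cinner (Theta_J x) (Theta_J x) = cinner x x"
    unfolding cinner_cadjoint[OF Theta_J_clin] z_def by simp
  then show "norm (Theta_J x) = norm x" by (rule norm_eq_of_cinner)
qed

text \<open>Orthogonality to the range of \<open>Theta_J\<close> means that its adjoint kills
  \<open>y\<close>; the coisometry formula then reads \<open>y = K (K' y)\<close>.\<close>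

lemma range_K: "N \<otimes>\<^sub>S defect_space T \<ominus> Theta_J ` (N \<otimes>\<^sub>S defect_space_adj T) = range K"
proof (intro equalityI subsetI)
  fix y assume "y \<in> N \<otimes>\<^sub>S defect_space T \<ominus> Theta_J ` (N \<otimes>\<^sub>S defect_space_adj T)"
  then have yM: "PT y = y" and y: "\<And>\<eta>. \<eta> \<in> N \<otimes>\<^sub>S defect_space_adj T \<Longrightarrow> cinner y (Theta_J \<eta>) = 0"
    by (auto simp: ortho_diff_def Proj_id tensor_space_closed)
  have "cadjoint Theta_J y = 0"
  proof (rule cinner_eq_zero_all)
    fix \<eta>
    have "cinner y (Theta_J (PE \<eta>)) = 0" by (rule y[OF Proj_in[OF tensor_space_closed]])
    then show "cinner (cadjoint Theta_J y) \<eta> = 0"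
      by (simp add: cinner_cadjoint'[OF Theta_J_clin] Theta_J_PE)
  qed
  then have "y = K (K' y)"
    using Theta_J_coisometry[of y] by (simp add: yM clin_zero[OF Theta_J_clin])
  then show "y \<in> range K" by blast
next
  fix y assume "y \<in> range K"
  then obtain h where h: "y = K h" by blast
  have "y \<in> N \<otimes>\<^sub>S defect_space T"
    unfolding h by (metis PT_K Proj_in tensor_space_closed)
  moreover have "cinner (K h) (Theta_J \<eta>) = 0" for \<eta>
    unfolding cinner_cadjoint[OF poisson_clin] K'_Theta_J by simp
  ultimately show "y \<in> N \<otimes>\<^sub>S defect_space T \<ominus> Theta_J ` (N \<otimes>\<^sub>S defect_space_adj T)"
    by (auto simp: ortho_diff_def h)
qed

lemma range_K_closed: "closed_csubspace (range K)"
proof -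
  have "range K = {y. \<forall>u\<in>{()}. K (K' y) - y = 0}"
  proof (intro equalityI subsetI)
    fix y assume "y \<in> {y. \<forall>u\<in>{()}. K (K' y) - y = 0}"
    then have "y = K (K' y)" by simp
    then show "y \<in> range K" by blast
  qed (auto simp: K'_K)
  moreover have "closed_csubspace {y. \<forall>u\<in>{()}. K (K' y) - y = 0}"
    by (rule closed_csubspace_zero_set) (rule clin_diff_op[OF clin_comp[OF poisson_clin K'_clin] clin_id])
  ultimately show ?thesis by simp
qed

lemma Proj_range_K: "Proj (range K) y = K (K' y)"
proof (rule Proj_eqI[OF range_K_closed])
  fix z assume "z \<in> range K"
  then obtain h where "z = K h" by blast
  then show "cinner (y - K (K' y)) z = 0"
    by (simp add: cinner_diff_left poisson_cinner cinner_cadjoint'[OF poisson_clin])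
qed simp

text \<open>The coordinate of \<open>K g\<close> at \<open>i # w\<close> is that of
  \<open>K (cadjoint (T i) g)\<close> at \<open>w\<close>, so the adjoint left shift acts on the
  range of \<open>K\<close> as the adjoint of \<open>T i\<close>.\<close>

lemma K_lshift: "K' (lshift i (K h)) = T i h"
proof (rule cinner_ext)
  fix g
  have "ell2_nth (K g) (i # w) = ell2_nth (K (cadjoint (T i) g)) w" for w
    by (simp add: poisson_nth word_op_Cons cadjoint_comp[OF T_clin word_op_clin[OF T_clin]])
  then have "cinner (lshift i (K h)) (K g) = cinner (K h) (K (cadjoint (T i) g))"
    using ell2_push_cinner[of "(#) i" "K h" "K g"] cinner_ell2_has_sum[of "K h" "K (cadjoint (T i) g)"]
    by (simp add: has_sum_unique)
  then show "cinner (K' (lshift i (K h))) g = cinner (T i h) g"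
    by (simp add: cinner_cadjoint'[OF poisson_clin] poisson_cinner cinner_cadjoint[OF T_clin])
qed

lemma B_amplification:
  assumes "bounded_clinear B"
  shows "(Proj N \<circ> left_creation i \<circ> Proj N) \<otimes>\<^sub>O B = (\<lambda>x. P (lshift i (P (ell2_map B x))))"
  by (rule tensor_op_amplify[of "\<lambda>x. P (lshift i (P x))"])
    (simp_all add: assms P_tensor lshift_tensor clin_comp[OF P_clin clin_comp[OF lshift_clin P_clin]])

lemma K_unitary: "unitary_onto (range K) K"
  by (simp add: unitary_onto_def poisson_clin poisson_cinner)

lemma K_intertwines:
  "K' (Proj (range K) (((Proj N \<circ> left_creation i \<circ> Proj N) \<otimes>\<^sub>O Proj (defect_space T)) (Proj (range K) (K h)))) = T i h"
  unfolding B_amplification[OF Proj_clin[OF defect_space_closed]] Proj_range_K K'_K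
  by (simp add: map_Proj_K P_poisson K'_P K_lshift)


subsection \<open>Membership in the tensor product of the constrained algebra\<close>

text \<open>The tensor product is an intersection, so membership is shown for an arbitrary
  \<open>V\<close> in the intersected family. Starting from \<open>Proj N\<close> and multiplying by
  \<open>W i\<close> on the right yields the Fock factors of the Neumann series.\<close>

context
  fixes WA :: "('n fock \<Rightarrow> 'n fock) set" and V :: "(('n list, 'h ^ 'n) ell2 \<Rightarrow> ('n list, 'h) ell2) set"
  assumes WA_Proj: "Proj N \<in> WA" and WA_W: "\<And>A i. A \<in> WA \<Longrightarrow> A \<circ> W i \<in> WA"
    and V_sub: "op_subspace V" and V_closed: "closedin WOT V"
    and V_gen: "\<And>A B. A \<in> WA \<Longrightarrow> B \<in> ops (defect_space_adj T) (defect_space T) \<Longrightarrow> A \<otimes>\<^sub>O B \<in> V"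
begin

lemma V_add: "X \<in> V \<Longrightarrow> Y \<in> V \<Longrightarrow> (\<lambda>x. X x + Y x) \<in> V"
  and V_scaleC: "X \<in> V \<Longrightarrow> (\<lambda>x. c *\<^sub>C X x) \<in> V"
  and V_zero: "(\<lambda>x. 0) \<in> V"
  using V_sub by (auto simp: op_subspace_def)

lemma V_scaleR: "X \<in> V \<Longrightarrow> (\<lambda>x. c *\<^sub>R X x) \<in> V"
  using V_scaleC[of X "complex_of_real c"] by (simp add: scaleC_of_real)

lemma V_sum: "(\<And>i. i \<in> F \<Longrightarrow> X i \<in> V) \<Longrightarrow> (\<lambda>x. \<Sum>i\<in>F. X i x) \<in> V"
  by (induction F rule: infinite_finite_induct) (auto intro: V_zero V_add)

text \<open>All coefficients of the characteristic function except the constant one have this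
  form.\<close>

lemma ops_defect:
  assumes "bounded_clinear B"
  shows "(\<lambda>v. D (B (E v))) \<in> ops (defect_space_adj T) (defect_space T)"
  unfolding ops_def
  by (auto simp: fun_eq_iff E_Proj D_in intro: clin_comp[OF D_clin clin_comp[OF assms E_clin]])

lemma ops_row: "(\<lambda>v. R (Proj (defect_space_adj T) v)) \<in> ops (defect_space_adj T) (defect_space T)"
  unfolding ops_def
  by (auto simp: fun_eq_iff Proj_idem[OF defect_space_adj_closed]
      intro: R_defect_space Proj_in defect_space_adj_closed clin_comp[OF R_clin Proj_clin])

context
  fixes r :: real
  assumes r: "0 < r" "r < 1"
begin

definition neumann_step :: "('n list, 'h) ell2 \<Rightarrow> ('n list, 'h) ell2" where
  "neumann_step x = r *\<^sub>R P (transfer_op (P x))"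

definition neumann_init :: "('n list, 'h ^ 'n) ell2 \<Rightarrow> ('n list, 'h) ell2" where
  "neumann_init \<xi> = r *\<^sub>R P (row_shift (ell2_map E \<xi>))"

lemma neumann_step_clin: "bounded_clinear neumann_step"
proof -
  have "bounded_clinear (\<lambda>x. complex_of_real r *\<^sub>C P (transfer_op (P x)))"
    by (rule clin_scale_op[OF clin_comp[OF P_clin clin_comp[OF C.C_clin P_clin]]])
  then show ?thesis by (simp add: neumann_step_def[abs_def] scaleC_of_real)
qed

lemma neumann_step_norm: "norm (neumann_step x) \<le> r * norm x"
proof -
  have "norm (P (transfer_op (P x))) \<le> norm x"
    by (rule order_trans[OF PC.C_norm Proj_norm_le[OF tensor_space_closed]])
  then show ?thesis using r by (simp add: neumann_step_def mult_left_mono)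
qed

text \<open>The amplification \<open>X'\<close> of an element of the algebra is carried along so that the
  induction hypothesis applies to \<open>X \<circ> W i\<close>.\<close>

lemma neumann_term_in:
  assumes "X \<in> WA" "bounded_clinear X'" "\<And>\<phi> h. X' (\<phi> \<otimes> h) = X \<phi> \<otimes> h" "bounded_clinear B"
  shows "(\<lambda>\<xi>. ell2_map (\<lambda>h. D (B h)) (X' ((neumann_step ^^ k) (neumann_init \<xi>)))) \<in> V"
  using assms
proof (induction k arbitrary: X X' B)
  case (0 X X' B)
  note X' = \<open>bounded_clinear X'\<close>
  have DB: "bounded_clinear (\<lambda>h. D (B h))" by (rule clin_comp[OF D_clin 0(4)])
  define G where "G i = (\<lambda>h. D (B (E h $ i)))" for i
  have Bi: "bounded_clinear (\<lambda>v. B (v $ i))" for i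
    by (rule clin_comp[OF 0(4) vec_nth_clin])
  have G: "bounded_clinear (G i)" "G i \<in> ops (defect_space_adj T) (defect_space T)" for i
    unfolding G_def using ops_defect[OF Bi] clin_comp[OF D_clin clin_comp[OF Bi E_clin]] by auto
  have ext: "(X \<circ> W i) \<otimes>\<^sub>O G i = (\<lambda>\<xi>. X'' (P (rshift i (P (ell2_map (G i) \<xi>)))))"
    if "bounded_clinear X''" "\<And>\<phi> h. X'' (\<phi> \<otimes> h) = X \<phi> \<otimes> h" for X'' i
    by (rule tensor_op_amplify[of "\<lambda>x. X'' (P (rshift i (P x)))"])
      (simp_all add: that clin_comp[OF that(1) P_rshift_P_clin] G P_tensor rshift_tensor)
  have "ell2_map (\<lambda>h. D (B h)) (X' (neumann_init \<xi>)) = r *\<^sub>R (\<Sum>i\<in>UNIV. ((X \<circ> W i) \<otimes>\<^sub>O G i) \<xi>)" for \<xi>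
  proof -
    have "ell2_map (\<lambda>h. D (B h)) (rshift i (ell2_map (\<lambda>h. E h $ i) \<xi>)) = rshift i (ell2_map (G i) \<xi>)" for i
      unfolding ell2_push_map[OF DB, symmetric] G_def
      by (simp add: ell2_map_comp[OF DB clin_comp[OF vec_nth_clin E_clin]])
    then have "ell2_map (\<lambda>h. D (B h)) (neumann_init \<xi>) = r *\<^sub>R (\<Sum>i\<in>UNIV. P (rshift i (P (ell2_map (G i) \<xi>))))"
      by (simp add: neumann_init_def row_shift_map[OF E_clin] clin_scaleR[OF ell2_map_clin[OF DB]]
          clin_sum[OF ell2_map_clin[OF DB]] clin_sum[OF P_clin] P_rshift flip: P_map[OF DB])
    then show ?thesis
      unfolding ext[OF X' 0(3)] amplification_map[OF X' 0(3) DB]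
      by (simp add: clin_scaleR[OF X'] clin_sum[OF X'])
  qed
  moreover have "(\<lambda>\<xi>. r *\<^sub>R (\<Sum>i\<in>UNIV. ((X \<circ> W i) \<otimes>\<^sub>O G i) \<xi>)) \<in> V"
    by (intro V_scaleR V_sum V_gen WA_W 0(1) G(2))
  ultimately show ?case by simp
next
  case (Suc k X X' B)
  note X' = \<open>bounded_clinear X'\<close>
  have DB: "bounded_clinear (\<lambda>h. D (B h))" by (rule clin_comp[OF D_clin Suc.prems(4)])
  define X'' where "X'' i = (\<lambda>x. X' (P (rshift i (P x))))" for i
  have X'': "bounded_clinear (X'' i)" "X'' i (\<phi> \<otimes> h) = (X \<circ> W i) \<phi> \<otimes> h" for i \<phi> h
    unfolding X''_def using clin_comp[OF X' P_rshift_P_clin] by (simp_all add: P_tensor rshift_tensor Suc.prems(3))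
  have B': "bounded_clinear (\<lambda>h. B (cadjoint (T i) h))" for i
    by (rule clin_comp[OF Suc.prems(4) cadjoint_clin[OF T_clin]])
  \<comment> \<open>One factor is peeled off at the outer end of the iterate: its shift joins
    \<open>X\<close> as \<open>X \<circ> W i\<close>, and \<open>cadjoint (T i)\<close>, acting on
    the other tensor factor, moves into \<open>B\<close>.\<close>
  have "ell2_map (\<lambda>h. D (B h)) (X' (neumann_step y))
      = (\<Sum>i\<in>UNIV. r *\<^sub>R ell2_map (\<lambda>h. D (B (cadjoint (T i) h))) (X'' i y))" for y
  proof -
    have "X' (neumann_step y) = (\<Sum>i\<in>UNIV. r *\<^sub>R X'' i (ell2_map (cadjoint (T i)) y))"
      unfolding neumann_step_def P_transfer sum_W_P[symmetric] X''_def
      by (simp add: clin_sum[OF X'] clin_scaleR[OF X'])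
    also have "\<dots> = (\<Sum>i\<in>UNIV. r *\<^sub>R ell2_map (cadjoint (T i)) (X'' i y))"
      by (simp add: amplification_map[OF X'' cadjoint_clin[OF T_clin]])
    finally show ?thesis
      by (simp add: clin_sum[OF ell2_map_clin[OF DB]] clin_scaleR[OF ell2_map_clin[OF DB]]
          ell2_map_comp[OF DB cadjoint_clin[OF T_clin]])
  qed
  moreover have "(\<lambda>\<xi>. \<Sum>i\<in>UNIV. r *\<^sub>R ell2_map (\<lambda>h. D (B (cadjoint (T i) h)))
      (X'' i ((neumann_step ^^ k) (neumann_init \<xi>)))) \<in> V"
    by (intro V_sum V_scaleR Suc.IH[OF WA_W[OF Suc.prems(1)] X'' B'])
  ultimately show ?case by simp
qed

text \<open>The partial sums miss the fixed point \<open>u\<close> exactly by the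
  \<open>m\<close>-th iterate of the step at \<open>u\<close>, which decays like
  \<open>r ^ m\<close>.\<close>

lemma neumann_limit:
  "(\<lambda>m. \<Sum>k<m. (neumann_step ^^ k) (neumann_init \<xi>)) \<longlonglongrightarrow> P (Theta_state r \<xi>)"
proof -
  define u where "u = P (Theta_state r \<xi>)"
  have u: "u - neumann_init \<xi> = neumann_step u"
  proof -
    have "P (Theta_state r \<xi> - r *\<^sub>R transfer_op (Theta_state r \<xi>)) = neumann_init \<xi>"
      using C.resolvent_eq[of r "r *\<^sub>R row_shift (ell2_map E \<xi>)"] r
      by (simp add: Theta_state_def neumann_init_def clin_scaleR[OF P_clin])
    then have "u - r *\<^sub>R P (transfer_op (Theta_state r \<xi>)) = neumann_init \<xi>"
      unfolding clin_diff[OF P_clin] clin_scaleR[OF P_clin] u_def .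
    moreover have "neumann_step u = r *\<^sub>R P (transfer_op (Theta_state r \<xi>))"
      unfolding neumann_step_def u_def P_idem P_transfer ..
    ultimately show ?thesis by (metis diff_diff_eq2 add_diff_cancel_left')
  qed
  have pow: "bounded_clinear (neumann_step ^^ k)" for k
    by (induction k) (simp_all add: id_def clin_id comp_def clin_comp[OF neumann_step_clin])
  have norm_pow: "norm ((neumann_step ^^ k) x) \<le> r ^ k * norm x" for k x
  proof (induction k)
    case (Suc k)
    have "norm ((neumann_step ^^ Suc k) x) \<le> r * norm ((neumann_step ^^ k) x)"
      using neumann_step_norm by simp
    also have "\<dots> \<le> r * (r ^ k * norm x)" using Suc r by (simp add: mult_left_mono)
    finally show ?case by (simp add: mult.assoc)
  qed simp
  have rem: "u - (\<Sum>k<m. (neumann_step ^^ k) (neumann_init \<xi>)) = (neumann_step ^^ m) u" for m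
  proof (induction m)
    case (Suc m)
    have "u - (\<Sum>k<Suc m. (neumann_step ^^ k) (neumann_init \<xi>))
        = (neumann_step ^^ m) u - (neumann_step ^^ m) (neumann_init \<xi>)"
      using Suc by (simp add: algebra_simps)
    also have "\<dots> = (neumann_step ^^ m) (neumann_step u)"
      unfolding clin_diff[OF pow, symmetric] u ..
    also have "\<dots> = (neumann_step ^^ Suc m) u" by (simp only: funpow_Suc_right o_apply)
    finally show ?case .
  qed simp
  have "(\<lambda>m. (neumann_step ^^ m) u) \<longlonglongrightarrow> 0"
  proof (rule Lim_null_comparison)
    show "\<forall>\<^sub>F m in sequentially. norm ((neumann_step ^^ m) u) \<le> r ^ m * norm u"
      by (simp add: norm_pow)
    show "(\<lambda>m. r ^ m * norm u) \<longlonglongrightarrow> 0"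
      using r by (intro tendsto_mult_left_zero LIMSEQ_realpow_zero) auto
  qed
  from tendsto_diff[OF tendsto_const[of u] this] show ?thesis
    unfolding rem[symmetric] by (simp add: u_def)
qed

text \<open>The constant term is one elementary tensor; the rest is a strong limit of partial
  Neumann sums, and a WOT-closed set contains its strong limits.\<close>

lemma PT_Theta_rad_in: "(\<lambda>\<xi>. PT (Theta_rad r \<xi>)) \<in> V"
proof -
  have PD: "bounded_clinear (Proj (defect_space T))" by (rule Proj_clin[OF defect_space_closed])
  define S where "S = (\<lambda>m \<xi>. \<Sum>k<m. ell2_map D (P ((neumann_step ^^ k) (neumann_init \<xi>))))"
  have SV: "S m \<in> V" for m
    unfolding S_def using neumann_term_in[OF WA_Proj P_clin P_tensor clin_id] by (intro V_sum) simp
  have "(\<lambda>\<xi>. ell2_map D (P (Theta_state r \<xi>))) \<in> V"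
  proof (rule limitin_closedin[OF limitin_SOT_WOT V_closed])
    show "limitin SOT S (\<lambda>\<xi>. ell2_map D (P (Theta_state r \<xi>))) sequentially"
      unfolding limitin_SOT_iff
    proof (intro conjI allI)
      show "bounded_clinear (\<lambda>\<xi>. ell2_map D (P (Theta_state r \<xi>)))"
        by (rule clin_comp[OF ell2_map_clin[OF D_clin] clin_comp[OF P_clin Theta_state_clin[OF r]]])
      show "\<forall>\<^sub>F m in sequentially. bounded_clinear (S m)"
        using SV V_sub by (intro always_eventually) (auto simp: op_subspace_def)
      fix \<xi>
      have "(\<lambda>m. ell2_map D (P (\<Sum>k<m. (neumann_step ^^ k) (neumann_init \<xi>))))
          \<longlonglongrightarrow> ell2_map D (P (P (Theta_state r \<xi>)))"
        by (intro clin_tendsto[OF ell2_map_clin[OF D_clin]] clin_tendsto[OF P_clin] neumann_limit)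
      then show "(\<lambda>m. S m \<xi>) \<longlonglongrightarrow> ell2_map D (P (Theta_state r \<xi>))"
        by (simp add: S_def P_idem clin_sum[OF P_clin] clin_sum[OF ell2_map_clin[OF D_clin]])
    qed
  qed (simp_all add: SV)
  moreover have "(\<lambda>\<xi>. (- 1) *\<^sub>R (Proj N \<otimes>\<^sub>O (\<lambda>v. R (Proj (defect_space_adj T) v))) \<xi>) \<in> V"
    by (intro V_scaleR V_gen WA_Proj ops_row)
  moreover have "PT (Theta_rad r \<xi>) = ell2_map D (P (Theta_state r \<xi>))
      + (- 1) *\<^sub>R (Proj N \<otimes>\<^sub>O (\<lambda>v. R (Proj (defect_space_adj T) v))) \<xi>" for \<xi>
  proof -
    have RP: "bounded_clinear (\<lambda>v. R (Proj (defect_space_adj T) v))"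
      by (rule clin_comp[OF R_clin Proj_clin[OF defect_space_adj_closed]])
    have "Proj (defect_space T) (R v) = R (Proj (defect_space_adj T) v)" for v
      by (rule trans[OF Proj_R_Proj[symmetric] Proj_id[OF defect_space_closed
            R_defect_space[OF Proj_in[OF defect_space_adj_closed]]]])
    then have "ell2_map (Proj (defect_space T)) (ell2_map R x) = ell2_map (\<lambda>v. R (Proj (defect_space_adj T) v)) x"
      for x :: "('n list, 'h ^ 'n) ell2"
      by (simp add: ell2_map_comp[OF PD R_clin])
    moreover have "ell2_map (Proj (defect_space T)) (ell2_map D x) = ell2_map D x"
      for x :: "('n list, 'h) ell2"
      by (simp add: ell2_map_comp[OF PD D_clin] Proj_D)
    ultimately show ?thesis
      unfolding PT_eq tensor_op_Proj[OF N_closed RP] P_map[OF PD, symmetric] Theta_rad_def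
      by (simp add: clin_diff[OF ell2_map_clin[OF PD]] clin_diff[OF P_clin] P_map[OF D_clin])
  qed
  ultimately show ?thesis by (simp only: V_add)
qed

end

lemma Theta_J_in: "Theta_J \<in> V"
proof (rule limitin_closedin[OF limitin_SOT_WOT V_closed])
  show "limitin SOT (\<lambda>r \<xi>. PT (Theta_rad r \<xi>)) Theta_J (at_left 1)"
    unfolding limitin_SOT_iff
  proof (intro conjI allI Theta_J_clin)
    show "\<forall>\<^sub>F r in at_left 1. bounded_clinear (\<lambda>\<xi>. PT (Theta_rad r \<xi>))"
      using eventually_at_left_1 by (rule eventually_mono) (simp add: clin_comp[OF PT_clin Theta_rad_clin])
    show "((\<lambda>r. PT (Theta_rad r \<xi>)) \<longlongrightarrow> Theta_J \<xi>) (at_left 1)" for \<xi>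
      unfolding Theta_J_def by (rule clin_tendsto[OF PT_clin Theta_rad_tendsto])
  qed
  show "\<forall>\<^sub>F r in at_left 1. (\<lambda>\<xi>. PT (Theta_rad r \<xi>)) \<in> V"
    using eventually_at_left_1 by (rule eventually_mono) (simp add: PT_Theta_rad_in)
qed (rule trivial_limit_at_left_real)

end

end

theorem theorem4p3:
  fixes J :: "('n::finite fock \<Rightarrow> 'n fock) set"
    and T :: "'n \<Rightarrow> 'h \<Rightarrow> 'h::complex_hilbert"
  assumes "WOT_closed_ideal J" and "J \<noteq> F_infinity"
    and "row_contraction T" and "pure_row T" and "constrained J T"
  shows "limitin SOT (char_fun_radial J T) (char_fun J T) (at_left 1) \<and>
    char_fun J T \<in> W_algebra J \<otimes>\<^sub>W ops (defect_space_adj T) (defect_space T) \<and>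
    partial_isometry (N_space J \<otimes>\<^sub>S defect_space_adj T) (N_space J \<otimes>\<^sub>S defect_space T) (char_fun J T) \<and>
    unitarily_equivalent T (model_space J T) (model_op J T)"
proof -
  interpret pure_row_contr T
    by unfold_locales (use assms in auto)
  have "J \<subseteq> F_infinity" using assms(1) by (simp add: WOT_closed_ideal_def)
  then interpret constrained_row_contr T "N_space J"
    by unfold_locales
      (auto intro: N_space_closed N_space_coinvariant poisson_in_constrained[OF assms(1,5)])
  have rad: "char_fun_radial J T r = (\<lambda>\<xi>. PT (Theta_rad r \<xi>))" if "0 < r" "r < 1" for r
    unfolding char_fun_radial_def W_op_def using char_expression_eq[OF that] by blast
  have lim: "((\<lambda>r. char_fun_radial J T r \<xi>) \<longlongrightarrow> Theta_J \<xi>) (at_left 1)" for \<xi>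
  proof (rule Lim_transform_eventually)
    show "((\<lambda>r. PT (Theta_rad r \<xi>)) \<longlongrightarrow> Theta_J \<xi>) (at_left 1)"
      unfolding Theta_J_def by (rule clin_tendsto[OF PT_clin Theta_rad_tendsto])
    show "\<forall>\<^sub>F r in at_left 1. PT (Theta_rad r \<xi>) = char_fun_radial J T r \<xi>"
      using eventually_at_left_1 by (rule eventually_mono) (simp add: rad)
  qed
  have cf: "char_fun J T = Theta_J"
    unfolding char_fun_def using tendsto_Lim[OF trivial_limit_at_left_real lim] by blast
  have sot: "limitin SOT (char_fun_radial J T) Theta_J (at_left 1)"
    unfolding limitin_SOT_iff
  proof (intro conjI allI Theta_J_clin lim)
    show "\<forall>\<^sub>F r in at_left 1. bounded_clinear (char_fun_radial J T r)"
      using eventually_at_left_1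
      by (rule eventually_mono) (simp add: rad clin_comp[OF PT_clin Theta_rad_clin])
  qed
  have "Theta_J \<in> W_algebra J \<otimes>\<^sub>W ops (defect_space_adj T) (defect_space T)"
    unfolding spatial_tensor_def WOT_closed_span_def
  proof (intro InterI, elim CollectE conjE)
    fix V assume V: "op_subspace V" "closedin WOT V"
      "{A \<otimes>\<^sub>O B |A B. A \<in> W_algebra J \<and> B \<in> ops (defect_space_adj T) (defect_space T)} \<subseteq> V"
    have base: "Proj (N_space J) \<in> W_algebra J" "W i \<in> W_algebra J" for i
      unfolding W_algebra_def W_op_def[abs_def] by (auto intro!: generated_algebra_base[THEN subsetD])
    show "Theta_J \<in> V"
    proof (rule Theta_J_in[of "W_algebra J", OF base(1) _ V(1,2)])
      show "A \<circ> W i \<in> W_algebra J" if "A \<in> W_algebra J" for A i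
        using generated_algebra_comp that base(2) unfolding W_algebra_def by blast
      show "A \<otimes>\<^sub>O B \<in> V" if "A \<in> W_algebra J" "B \<in> ops (defect_space_adj T) (defect_space T)" for A B
        using V(3) that by blast
    qed
  qed
  moreover have ms: "model_space J T = range K"
    unfolding model_space_def cf by (rule range_K)
  have "unitarily_equivalent T (model_space J T) (model_op J T)"
    unfolding unitarily_equivalent_def ms
  proof (intro exI[of _ K] conjI allI K_unitary)
    \<comment> \<open>The projections in \<open>model_op\<close> onto the range of \<open>K\<close>
      equal \<open>K K'\<close> and are absorbed by the outer \<open>K'\<close> and
      \<open>K\<close>.\<close>
    show "T i = K' \<circ> model_op J T i \<circ> K" for i
      unfolding model_op_def ms B_op_def using K_intertwines by (simp add: fun_eq_iff)
  qed
  ultimately show ?thesis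
    using sot Theta_J_partial_isometry unfolding cf by blast
qed

end
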